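(* Let $D$ be a $2$-dimensional regular local ring and let $\mathcal{S}$ be a nonempty subset of $Q^*(D)$. The following are equivalent: 1. $\mathcal{S}$ is a Noetherian topological space in the Zariski topology. 2. $\mathcal{S}$ has only finitely many irreducible components (in the Zariski topology). 3. There are valuation rings $V_1,\dots,V_n$ in $Q^*(D)$ such that $\mathcal{S}\subseteq \downarrow^*\{V_1,\dots,V_n\}$. 4. The Zariski closure of $\mathcal{S}$ in $Q^*(D)$ is a Noetherian space. If moreover $\mathcal{S}\subseteq Q(D)$, then items 1–4 are also equivalent to: 5. The Zariski closure of $\mathcal{S}$ in $Q(D)$ is a Noetherian space.
   Context: $D$ is a $2$-dimensional regular local ring with maximal ideal $\mathfrak{m}_D$ and quotient field $F$. A local ring $R$ with $D\subseteq R\subseteq F$ birationally dominates $D$ if $\mathfrak{m}_R\cap D=\mathfrak{m}_D$; $L(D)$ denotes the set of all such local rings. For $x_1,\dots,x_n\in F$ let $\mathcal{U}(x_1,\dots,x_n)=\{R\in L(D): x_1,\dots,x_n\in R\}$. The Zariski topology on $L(D)$ is the topology with basis of open sets the sets $\mathcal{U}(x_1,\dots,x_n)$; subsets of $L(D)$ carry the subspace topology. $Q(D)$ is the set of all $2$-dimensional regular local rings $\alpha$ with $D\subseteq\alpha\subseteq F$ (all of these dominate $D$). $Q^*(D)$ is the union of $Q(D)$ and the set of all valuation rings in $L(D)$. For a subset $\mathcal{S}\subseteq Q^*(D)$, $\downarrow^*\mathcal{S}=\{\alpha\in Q^*(D):\alpha\subseteq\beta\text{ for some }\beta\in\mathcal{S}\}$.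 *)

theory Defs
  imports "HOL-Analysis.Analysis"
begin

text \<open>All rings considered are subrings of a fixed field, the type 'a (playing the role of F).\<close>

definition subring :: "'a::field set \<Rightarrow> bool" where
  "subring R \<longleftrightarrow> 0 \<in> R \<and> 1 \<in> R \<and> (\<forall>x\<in>R. \<forall>y\<in>R. x + y \<in> R \<and> x * y \<in> R) \<and> (\<forall>x\<in>R. - x \<in> R)"

definition ideal_in :: "'a::field set \<Rightarrow> 'a set \<Rightarrow> bool" where
  "ideal_in R I \<longleftrightarrow> I \<subseteq> R \<and> 0 \<in> I \<and> (\<forall>x\<in>I. \<forall>y\<in>I. x + y \<in> I) \<and> (\<forall>r\<in>R. \<forall>x\<in>I. r * x \<in> I)"

definition prime_ideal_in :: "'a::field set \<Rightarrow> 'a set \<Rightarrow> bool" where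
  "prime_ideal_in R P \<longleftrightarrow> ideal_in R P \<and> P \<noteq> R \<and> (\<forall>a\<in>R. \<forall>b\<in>R. a * b \<in> P \<longrightarrow> a \<in> P \<or> b \<in> P)"

definition maximal_ideal_in :: "'a::field set \<Rightarrow> 'a set \<Rightarrow> bool" where
  "maximal_ideal_in R M \<longleftrightarrow> ideal_in R M \<and> M \<noteq> R \<and> (\<forall>J. ideal_in R J \<and> M \<subseteq> J \<longrightarrow> J = M \<or> J = R)"

definition ideal_gen :: "'a::field set \<Rightarrow> 'a set \<Rightarrow> 'a set" where
  "ideal_gen R G = {\<Sum>g\<in>G. c g * g | c. \<forall>g\<in>G. c g \<in> R}"

definition noetherian_ring :: "'a::field set \<Rightarrow> bool" where
  "noetherian_ring R \<longleftrightarrow> subring R \<and>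
     (\<forall>I. ideal_in R I \<longrightarrow> (\<exists>G. finite G \<and> G \<subseteq> R \<and> I = ideal_gen R G))"

definition local_ring :: "'a::field set \<Rightarrow> bool" where
  "local_ring R \<longleftrightarrow> subring R \<and> (\<exists>!M. maximal_ideal_in R M)"

definition max_ideal :: "'a::field set \<Rightarrow> 'a set" where
  "max_ideal R = (THE M. maximal_ideal_in R M)"

definition prime_chain :: "'a::field set \<Rightarrow> nat \<Rightarrow> bool" where
  "prime_chain R n \<longleftrightarrow> (\<exists>P :: nat \<Rightarrow> 'a set. (\<forall>i\<le>n. prime_ideal_in R (P i)) \<and> (\<forall>i<n. P i \<subset> P (Suc i)))"

definition krull_dim_eq :: "'a::field set \<Rightarrow> nat \<Rightarrow> bool" where
  "krull_dim_eq R d \<longleftrightarrow> prime_chain R d \<and> \<not> prime_chain R (Suc d)"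

definition regular_local :: "'a::field set \<Rightarrow> nat \<Rightarrow> bool" where
  "regular_local R d \<longleftrightarrow> local_ring R \<and> noetherian_ring R \<and> krull_dim_eq R d \<and>
     (\<exists>G. finite G \<and> card G = d \<and> G \<subseteq> R \<and> max_ideal R = ideal_gen R G)"

definition quotient_field_of :: "'a::field set \<Rightarrow> bool" where
  "quotient_field_of D \<longleftrightarrow> (\<forall>x. \<exists>a\<in>D. \<exists>b\<in>D. b \<noteq> 0 \<and> x = a / b)"

definition valuation_ring :: "'a::field set \<Rightarrow> bool" where
  "valuation_ring V \<longleftrightarrow> subring V \<and> (\<forall>x. x \<noteq> 0 \<longrightarrow> x \<in> V \<or> inverse x \<in> V)"

definition Ldom :: "'a::field set \<Rightarrow> 'a set set" where
  "Ldom D = {R. local_ring R \<and> D \<subseteq> R \<and> max_ideal R \<inter> D = max_ideal D}"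

definition Qreg :: "'a::field set \<Rightarrow> 'a set set" where
  "Qreg D = {\<alpha>. regular_local \<alpha> 2 \<and> D \<subseteq> \<alpha>}"

definition Qstar :: "'a::field set \<Rightarrow> 'a set set" where
  "Qstar D = Qreg D \<union> {V \<in> Ldom D. valuation_ring V}"

definition down_star :: "'a::field set \<Rightarrow> 'a set set \<Rightarrow> 'a set set" where
  "down_star D S = {\<alpha> \<in> Qstar D. \<exists>\<beta>\<in>S. \<alpha> \<subseteq> \<beta>}"

definition zariski :: "'a::field set \<Rightarrow> 'a set topology" where
  "zariski D = topology_generated_by {{R \<in> Ldom D. X \<subseteq> R} | X. finite X}"

definition noetherian_space :: "'b topology \<Rightarrow> bool" where
  "noetherian_space T \<longleftrightarrow> (\<forall>C :: nat \<Rightarrow> 'b set. (\<forall>n. closedin T (C n) \<and> C (Suc n) \<subseteq> C n)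
      \<longrightarrow> (\<exists>N. \<forall>n\<ge>N. C n = C N))"

definition irreducible_in :: "'b topology \<Rightarrow> 'b set \<Rightarrow> bool" where
  "irreducible_in T S \<longleftrightarrow> S \<subseteq> topspace T \<and> S \<noteq> {} \<and>
     (\<forall>A B. closedin T A \<and> closedin T B \<and> S \<subseteq> A \<union> B \<longrightarrow> S \<subseteq> A \<or> S \<subseteq> B)"

definition irreducible_components :: "'b topology \<Rightarrow> 'b set set" where
  "irreducible_components T = {C. irreducible_in T C \<and> (\<forall>C'. irreducible_in T C' \<and> C \<subseteq> C' \<longrightarrow> C' = C)}"

end

theory Submission
  imports Defs "HOL-Computational_Algebra.Polynomial"
begin

text \<open>The closure of a point \<open>R\<close> in the Zariski topology consists of the rings contained in \<open>R\<close>.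
  If a set of rings is irreducible, then its union is a subring in which \<open>m\<^sub>D\<close> does not generate
  the unit ideal, so by Zorn's lemma it lies in a valuation ring dominating \<open>D\<close>. This gives item 3
  from item 2, and everything else follows once \<open>\<down>\<^sup>*{V}\<close> is known to be a Noetherian space.

  A space fails to be Noetherian iff it contains a sequence in which every point has a neighbourhood
  missing all later points. Given such a sequence below \<open>V\<close>, follow the quadratic transforms of
  \<open>D\<close> along \<open>V\<close>. By Abhyankar's factorization step every member of the sequence contains each
  transform, as long as \<open>V\<close> is not the order valuation of the current ring. If that never happens,
  the union of the transforms is a valuation ring, so all members of the sequence equal it.
  If \<open>V\<close> is the order valuation of \<open>A\<close>, then its elements are quotients of polynomials
  in \<open>y / x\<close>, so an element of \<open>V\<close> is missing only from members of the sequence centred at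
  finitely many points of the exceptional curve. Hence infinitely many members have the same centre,
  and along the strict transforms of the exceptional curve the previous argument applies again.

  Only the properties collected in the locale \<open>regular_pair\<close> are needed, and these pass from a
  ring to its quadratic transforms without any appeal to Noetherianity.\<close>

section \<open>Quasi-local subrings of a field\<close>

text \<open>Two obstacles shape the development. First, transforms must be iterated without end, and
  it is laborious to carry the classical properties of a regular surface point (Noetherian,
  factorial, of dimension two) through a localisation of A[y/x]. \<open>regular_pair\<close> keeps
  only their traces: the parameters generate the maximal ideal, its powers intersect in 0, and every
  fraction is some a / b with powers of both parameters in (a, b). The last clause is what
  factoriality yields in dimension two, and it survives a transform because a and b are merely
  divided by a common power of x. Second, the transforms are chosen along V, whereas the members of
  the sequence lie in V but need not be dominated by it, and their centres might differ from that of
  V. The link is a monic polynomial P over A, irreducible modulo the maximal ideal: as soon as P(y /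
  x) is a nonunit of a dominating ring, P is the minimal polynomial there, and the transform depends
  on P alone. When V is an order valuation, such a P is found by pigeonhole on the members instead
  of being read off from V.\<close>

lemma subringD:
  assumes "subring R"
  shows "0 \<in> R" "1 \<in> R" "\<And>a b. a \<in> R \<Longrightarrow> b \<in> R \<Longrightarrow> a + b \<in> R"
    "\<And>a b. a \<in> R \<Longrightarrow> b \<in> R \<Longrightarrow> a * b \<in> R" "\<And>a. a \<in> R \<Longrightarrow> - a \<in> R"
    "\<And>a b. a \<in> R \<Longrightarrow> b \<in> R \<Longrightarrow> a - b \<in> R"
    "\<And>a n. a \<in> R \<Longrightarrow> a ^ n \<in> R"
proof -
  show c: "0 \<in> R" "1 \<in> R" "\<And>a b. a \<in> R \<Longrightarrow> b \<in> R \<Longrightarrow> a + b \<in> R"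
    "\<And>a b. a \<in> R \<Longrightarrow> b \<in> R \<Longrightarrow> a * b \<in> R" "\<And>a. a \<in> R \<Longrightarrow> - a \<in> R"
    using assms by (auto simp: subring_def)
  show "a - b \<in> R" if "a \<in> R" "b \<in> R" for a b
    using c(3)[OF that(1) c(5)[OF that(2)]] by simp
  show "a ^ n \<in> R" if "a \<in> R" for a n
    by (induction n) (use c that in auto)
qed

lemma subring_sum: "subring R \<Longrightarrow> (\<And>i. i \<in> I \<Longrightarrow> f i \<in> R) \<Longrightarrow> sum f I \<in> R"
  by (induction I rule: infinite_finite_induct) (auto simp: subringD)

text \<open>The disjunct \<open>r = 0\<close> is there because \<open>inverse 0 = 0\<close> lies in
  every subring.\<close>

definition nonunits :: "'a::field set \<Rightarrow> 'a set" where
  "nonunits R = {r \<in> R. r = 0 \<or> inverse r \<notin> R}"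

definition span2 :: "'a::field set \<Rightarrow> 'a \<Rightarrow> 'a \<Rightarrow> 'a set" where
  "span2 R a b = {a * u + b * v | u v. u \<in> R \<and> v \<in> R}"

lemma span2I: "u \<in> R \<Longrightarrow> v \<in> R \<Longrightarrow> a * u + b * v \<in> span2 R a b"
  by (auto simp: span2_def)

lemma span2E:
  assumes "c \<in> span2 R a b"
  obtains u v where "u \<in> R" "v \<in> R" "c = a * u + b * v"
  using assms by (auto simp: span2_def)

lemma span2_commute: "span2 R a b = span2 R b a"
  unfolding span2_def by (auto; metis add.commute)

lemma subring_span2:
  assumes R: "subring R" and xy: "x \<in> R" "y \<in> R"
  shows "span2 R x y \<subseteq> R" "0 \<in> span2 R x y" "x \<in> span2 R x y" "y \<in> span2 R x y"
    "\<And>a b. a \<in> span2 R x y \<Longrightarrow> b \<in> span2 R x y \<Longrightarrow> a + b \<in> span2 R x y"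
    "\<And>a b. a \<in> span2 R x y \<Longrightarrow> b \<in> span2 R x y \<Longrightarrow> a - b \<in> span2 R x y"
    "\<And>a b. a \<in> span2 R x y \<Longrightarrow> b \<in> R \<Longrightarrow> a * b \<in> span2 R x y"
    "\<And>a b. a \<in> span2 R x y \<Longrightarrow> b \<in> R \<Longrightarrow> b * a \<in> span2 R x y"
proof -
  note cl = subringD[OF R]
  show "span2 R x y \<subseteq> R" unfolding span2_def using xy by (auto intro!: cl)
  show "0 \<in> span2 R x y" unfolding span2_def
    by (rule CollectI, rule exI[of _ 0], rule exI[of _ 0]) (simp add: cl)
  show "x \<in> span2 R x y" unfolding span2_def
    by (rule CollectI, rule exI[of _ 1], rule exI[of _ 0]) (simp add: cl)
  show "y \<in> span2 R x y" unfolding span2_def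
    by (rule CollectI, rule exI[of _ 0], rule exI[of _ 1]) (simp add: cl)
  fix a b
  {
    assume "a \<in> span2 R x y" "b \<in> span2 R x y"
    then obtain u v u' v' where *: "a = x * u + y * v" "b = x * u' + y * v'"
      "u \<in> R" "v \<in> R" "u' \<in> R" "v' \<in> R" unfolding span2_def by auto
    have "a + b = x * (u + u') + y * (v + v')" using * by (simp add: algebra_simps)
    then show "a + b \<in> span2 R x y" using * by (auto intro!: span2I cl)
    have "a - b = x * (u - u') + y * (v - v')" using * by (simp add: algebra_simps)
    then show "a - b \<in> span2 R x y" using * by (auto intro!: span2I cl)
  next
    assume "a \<in> span2 R x y" "b \<in> R"
    then obtain u v where *: "a = x * u + y * v" "u \<in> R" "v \<in> R" unfolding span2_def by auto
    have "a * b = x * (u * b) + y * (v * b)" using * by (simp add: algebra_simps)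
    then show "a * b \<in> span2 R x y" using * \<open>b \<in> R\<close> by (auto intro!: span2I cl)
    then show "b * a \<in> span2 R x y" by (simp add: mult.commute)
  }
qed

text \<open>Local rings in elementary form: a ring is local iff its nonunits are closed under
  addition. No maximal ideal is quantified, so the condition is easily checked for localisations and
  valuation rings.\<close>

locale quasi_local =
  fixes R :: "'a::field set"
  assumes subring: "subring R"
    and nonunits_add: "a \<in> nonunits R \<Longrightarrow> b \<in> nonunits R \<Longrightarrow> a + b \<in> nonunits R"
begin

lemmas cl = subringD[OF subring]

lemma nonunits_sub: "a \<in> nonunits R \<Longrightarrow> a \<in> R"
  by (simp add: nonunits_def)

lemma zero_nonunit: "0 \<in> nonunits R"
  by (simp add: nonunits_def cl)

lemma one_unit: "1 \<notin> nonunits R"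
  by (simp add: nonunits_def cl)

lemma unitD:
  assumes "a \<in> R" "a \<notin> nonunits R"
  shows "a \<noteq> 0" "inverse a \<in> R"
  using assms by (auto simp: nonunits_def)

lemma nonunits_mult:
  assumes "a \<in> nonunits R" "b \<in> R"
  shows "a * b \<in> nonunits R" "b * a \<in> nonunits R"
proof -
  show "a * b \<in> nonunits R"
  proof (rule ccontr)
    assume "a * b \<notin> nonunits R"
    with assms have "a * b \<noteq> 0" "inverse (a * b) \<in> R"
      by (auto simp: nonunits_def cl)
    then have "a \<noteq> 0" "b * inverse (a * b) \<in> R" "b * inverse (a * b) = inverse a"
      using cl(4)[OF assms(2)] by auto
    then have "inverse a \<in> R" by metis
    with assms \<open>a \<noteq> 0\<close> show False by (auto simp: nonunits_def)
  qed
  then show "b * a \<in> nonunits R" by (simp add: mult.commute)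
qed

lemma nonunits_minus: "a \<in> nonunits R \<Longrightarrow> - a \<in> nonunits R"
  using nonunits_mult(1)[of a "-1"] cl by simp

lemma nonunits_diff: "a \<in> nonunits R \<Longrightarrow> b \<in> nonunits R \<Longrightarrow> a - b \<in> nonunits R"
  using nonunits_add[OF _ nonunits_minus, of a b] by simp

lemma nonunits_sum: "(\<And>i. i \<in> I \<Longrightarrow> f i \<in> nonunits R) \<Longrightarrow> sum f I \<in> nonunits R"
  by (induction I rule: infinite_finite_induct) (auto simp: zero_nonunit nonunits_add)

lemma units_mult:
  assumes "a \<in> R" "b \<in> R" "a * b \<in> nonunits R"
  shows "a \<in> nonunits R \<or> b \<in> nonunits R"
proof (rule ccontr)
  assume "\<not> ?thesis"
  then have "inverse a \<in> R" "inverse b \<in> R" "a \<noteq> 0" "b \<noteq> 0"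
    using unitD assms by auto
  then have "inverse a * inverse b \<in> R" "a * b \<noteq> 0" by (auto intro: cl)
  then show False using assms by (auto simp: nonunits_def)
qed

lemma units_power: "a \<in> R \<Longrightarrow> a ^ n \<in> nonunits R \<Longrightarrow> a \<in> nonunits R"
proof (induction n)
  case (Suc n)
  then show ?case using units_mult[of a "a ^ n"] cl(7)[of a n] by auto
qed (simp add: one_unit)

lemma unit_add_nonunit: "a \<in> R \<Longrightarrow> a \<notin> nonunits R \<Longrightarrow> b \<in> nonunits R \<Longrightarrow> a + b \<notin> nonunits R"
  using nonunits_diff[of "a + b" b] by auto

lemma unit_diff_nonunit: "a \<in> R \<Longrightarrow> a \<notin> nonunits R \<Longrightarrow> b \<in> nonunits R \<Longrightarrow> a - b \<notin> nonunits R"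
  using nonunits_add[of "a - b" b] by auto

lemmas span2_cl = subring_span2[OF subring]

lemma span2_nonunits: "x \<in> nonunits R \<Longrightarrow> y \<in> nonunits R \<Longrightarrow> span2 R x y \<subseteq> nonunits R"
  unfolding span2_def by (auto intro!: nonunits_add nonunits_mult(1))

end

section \<open>Polynomials with coefficients in a set\<close>

definition polys :: "'a::field set \<Rightarrow> 'a poly set" where
  "polys R = {p. \<forall>i. coeff p i \<in> R}"

lemma polys_mono: "R \<subseteq> S \<Longrightarrow> polys R \<subseteq> polys S"
  by (auto simp: polys_def)

lemma polys_coeff: "p \<in> polys R \<Longrightarrow> coeff p i \<in> R"
  by (simp add: polys_def)

lemma subring_polys:
  assumes R: "subring R"
  shows  "0 \<in> polys R" "1 \<in> polys R" "\<And>p q. p \<in> polys R \<Longrightarrow> q \<in> polys R \<Longrightarrow> p + q \<in> polys R"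
  "\<And>p q. p \<in> polys R \<Longrightarrow> q \<in> polys R \<Longrightarrow> p - q \<in> polys R"
  "\<And>p. p \<in> polys R \<Longrightarrow> - p \<in> polys R"
  "\<And>p q. p \<in> polys R \<Longrightarrow> q \<in> polys R \<Longrightarrow> p * q \<in> polys R"
  "\<And>c p. c \<in> R \<Longrightarrow> p \<in> polys R \<Longrightarrow> smult c p \<in> polys R"
  "\<And>c n. c \<in> R \<Longrightarrow> monom c n \<in> polys R"
  "\<And>c p. c \<in> R \<Longrightarrow> p \<in> polys R \<Longrightarrow> pCons c p \<in> polys R"
  "\<And>p n. p \<in> polys R \<Longrightarrow> p ^ n \<in> polys R"
proof -
  note cl = subringD[OF R]
  show c: "0 \<in> polys R" "1 \<in> polys R" "\<And>p q. p \<in> polys R \<Longrightarrow> q \<in> polys R \<Longrightarrow> p + q \<in> polys R"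
    "\<And>p q. p \<in> polys R \<Longrightarrow> q \<in> polys R \<Longrightarrow> p - q \<in> polys R"
    "\<And>p. p \<in> polys R \<Longrightarrow> - p \<in> polys R"
    by (auto simp: polys_def cl coeff_1)
  show m: "p * q \<in> polys R" if "p \<in> polys R" "q \<in> polys R" for p q
    using that by (auto simp: polys_def coeff_mult intro!: subring_sum[OF R] cl)
  show "smult c p \<in> polys R" if "c \<in> R" "p \<in> polys R" for c p
    using that by (auto simp: polys_def intro!: cl)
  show "monom c n \<in> polys R" if "c \<in> R" for c n
    using that by (auto simp: polys_def cl)
  show "pCons c p \<in> polys R" if "c \<in> R" "p \<in> polys R" for c p
    using that by (auto simp: polys_def coeff_pCons cl split: nat.splits)
  show "p ^ n \<in> polys R" if "p \<in> polys R" for p n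
    by (induction n) (use c m that in auto)
qed

context quasi_local
begin

abbreviation "M \<equiv> nonunits R"
abbreviation "RT \<equiv> polys R"
abbreviation "MT \<equiv> polys M"

lemma MT_RT: "p \<in> MT \<Longrightarrow> p \<in> RT"
  using nonunits_sub by (auto simp: polys_def)

lemmas RT_cl = subring_polys[OF subring]

lemma MT_cl:
  "0 \<in> MT" "\<And>p q. p \<in> MT \<Longrightarrow> q \<in> MT \<Longrightarrow> p + q \<in> MT"
  "\<And>p q. p \<in> MT \<Longrightarrow> q \<in> MT \<Longrightarrow> p - q \<in> MT"
  "\<And>p q. p \<in> MT \<Longrightarrow> q \<in> RT \<Longrightarrow> p * q \<in> MT"
  "\<And>p q. p \<in> RT \<Longrightarrow> q \<in> MT \<Longrightarrow> p * q \<in> MT"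
  "\<And>c p. c \<in> M \<Longrightarrow> p \<in> RT \<Longrightarrow> smult c p \<in> MT"
  "\<And>c p. c \<in> R \<Longrightarrow> p \<in> MT \<Longrightarrow> smult c p \<in> MT"
  "\<And>c n. c \<in> M \<Longrightarrow> monom c n \<in> MT"
  unfolding polys_def
  by (auto simp: zero_nonunit nonunits_mult nonunits_add nonunits_diff coeff_mult intro!: nonunits_sum)

lemma poly_in: "p \<in> polys R \<Longrightarrow> t \<in> R \<Longrightarrow> poly p t \<in> R"
  by (auto simp: poly_altdef polys_def intro!: subring_sum[OF subring] cl)

lemma poly_nonunit: "p \<in> polys (nonunits R) \<Longrightarrow> t \<in> R \<Longrightarrow> poly p t \<in> nonunits R"
  by (auto simp: poly_altdef polys_def intro!: nonunits_sum nonunits_mult(1) cl)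

text \<open>Over the residue field this says that polynomials have no zero divisors;
  \<open>i\<close> and \<open>j\<close> are the lowest degrees in which the reductions do not
  vanish.\<close>

lemma MT_mult:
  assumes "p \<in> RT" "q \<in> RT" "p * q \<in> MT"
  shows "p \<in> MT \<or> q \<in> MT"
proof (rule ccontr)
  assume "\<not> ?thesis"
  then have ex: "\<exists>i. coeff p i \<notin> M" "\<exists>i. coeff q i \<notin> M" by (auto simp: polys_def)
  define i where "i = (LEAST i. coeff p i \<notin> M)"
  define j where "j = (LEAST i. coeff q i \<notin> M)"
  have i: "coeff p i \<notin> M" "\<And>k. k < i \<Longrightarrow> coeff p k \<in> M"
    unfolding i_def using LeastI_ex[OF ex(1)] not_less_Least by auto
  have j: "coeff q j \<notin> M" "\<And>k. k < j \<Longrightarrow> coeff q k \<in> M"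
    unfolding j_def using LeastI_ex[OF ex(2)] not_less_Least by auto
  have R: "coeff p k \<in> R" "coeff q k \<in> R" for k using assms by (auto simp: polys_def)
  have "coeff (p * q) (i + j) = (\<Sum>k\<le>i + j. coeff p k * coeff q (i + j - k))"
    by (simp add: coeff_mult)
  also have "\<dots> = coeff p i * coeff q j + (\<Sum>k\<in>{..i + j} - {i}. coeff p k * coeff q (i + j - k))"
    by (subst sum.remove[of _ i]) auto
  finally have eq: "coeff p i * coeff q j = coeff (p * q) (i + j) - (\<Sum>k\<in>{..i + j} - {i}. coeff p k * coeff q (i + j - k))"
    by simp
  have "(\<Sum>k\<in>{..i + j} - {i}. coeff p k * coeff q (i + j - k)) \<in> M"
  proof (rule nonunits_sum)
    fix k assume k: "k \<in> {..i + j} - {i}"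
    show "coeff p k * coeff q (i + j - k) \<in> M"
    proof (cases "k < i")
      case True then show ?thesis using i R by (auto intro: nonunits_mult)
    next
      case False then have "i + j - k < j" using k by auto
      then show ?thesis using j R by (auto intro: nonunits_mult)
    qed
  qed
  then have "coeff p i * coeff q j \<in> M"
    unfolding eq using assms by (auto simp: polys_def intro!: nonunits_diff)
  then show False using units_mult R i j by blast
qed

lemma monic_not_MT: "lead_coeff p = 1 \<Longrightarrow> p \<notin> MT"
  using one_unit by (auto simp: polys_def) metis

text \<open>With truncated subtraction the bound on \<open>degree A\<close> cannot tell a constant
  quotient from 0, so the case of small \<open>Q\<close> is recorded separately;
  \<open>reduce\<close> relies on it.\<close>

lemma monic_division:
  assumes "P \<in> RT" "lead_coeff P = 1" "degree P \<ge> 1" "Q \<in> RT"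
  shows "\<exists>A\<in>RT. \<exists>B\<in>RT. Q = A * P + B \<and> degree B < degree P \<and> degree A \<le> degree Q - degree P
    \<and> (degree Q < degree P \<longrightarrow> A = 0)"
  using assms(4)
proof (induction "degree Q" arbitrary: Q rule: less_induct)
  case less
  show ?case
  proof (cases "degree Q < degree P")
    case True
    then show ?thesis using less.prems by (intro bexI[of _ 0] bexI[of _ Q]) (auto simp: RT_cl)
  next
    case False
    define S where "S = monom (lead_coeff Q) (degree Q - degree P)"
    define Q' where "Q' = Q - S * P"
    have S: "S \<in> RT" unfolding S_def using less.prems by (auto intro!: RT_cl simp: polys_coeff)
    have Q': "Q' \<in> RT" unfolding Q'_def using less.prems S assms by (auto intro!: RT_cl)
    have "Q \<noteq> 0" using False assms(3) by auto
    then have dS: "degree S = degree Q - degree P" unfolding S_def by (simp add: degree_monom_eq)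
    have S0: "S \<noteq> 0" using \<open>Q \<noteq> 0\<close> by (simp add: S_def)
    have P0: "P \<noteq> 0" using assms(3) by auto
    have dSP: "degree (S * P) = degree Q" using degree_mult_eq[OF S0 P0] dS False by simp
    have "lead_coeff (S * P) = lead_coeff Q"
      unfolding lead_coeff_mult using assms(2) \<open>Q \<noteq> 0\<close> dS by (simp add: S_def)
    then have "coeff Q' (degree Q) = 0" unfolding Q'_def using dSP by simp
    moreover have "degree Q' \<le> degree Q" unfolding Q'_def using dSP by (simp add: degree_diff_le)
    ultimately have "degree Q' < degree Q"
      using False assms(3) by (metis eq_zero_or_degree_less degree_0 le_neq_implies_less le_less_trans not_less zero_less_one less_le_trans)
    from less.hyps[OF this Q'] obtain A B where AB: "A \<in> RT" "B \<in> RT" "Q' = A * P + B"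
      "degree B < degree P" "degree A \<le> degree Q' - degree P" by auto
    have "Q = (A + S) * P + B" using AB(3) unfolding Q'_def by (simp add: algebra_simps)
    moreover have "degree (A + S) \<le> degree Q - degree P"
      using AB(5) dS \<open>degree Q' < degree Q\<close> by (intro degree_add_le) auto
    ultimately show ?thesis using AB S False by (intro bexI[of _ "A + S"] bexI[of _ B]) (auto intro!: RT_cl)
  qed
qed

end

section \<open>Regular pairs of parameters\<close>

text \<open>The powers of the ideal (x, y), the 0-th power being the whole ring.\<close>

primrec mpow :: "'a::field set \<Rightarrow> 'a \<Rightarrow> 'a \<Rightarrow> nat \<Rightarrow> 'a set" where
  "mpow R x y 0 = R"
| "mpow R x y (Suc n) = {x * a + y * b | a b. a \<in> mpow R x y n \<and> b \<in> mpow R x y n}"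

lemma mpow_commute: "mpow R x y n = mpow R y x n"
  by (induction n) (auto; metis add.commute)+

lemma mpow_SucI: "a \<in> mpow R x y n \<Longrightarrow> b \<in> mpow R x y n \<Longrightarrow> x * a + y * b \<in> mpow R x y (Suc n)"
  by auto

lemma mpow_SucE:
  assumes "c \<in> mpow R x y (Suc n)"
  obtains a b where "a \<in> mpow R x y n" "b \<in> mpow R x y n" "c = x * a + y * b"
  using assms by auto

text \<open>The pair is a regular sequence: y is a nonzerodivisor modulo x. In a domain this is
  symmetric, see \<open>regseq_sym\<close>.\<close>

locale regseq = quasi_local +
  fixes x y :: "'a"
  assumes xR: "x \<in> R" and yR: "y \<in> R" and x0: "x \<noteq> 0" and y0: "y \<noteq> 0"
    and reg: "a \<in> R \<Longrightarrow> b \<in> R \<Longrightarrow> x * a = y * b \<Longrightarrow> \<exists>c\<in>R. b = x * c"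
begin

lemma reg': 
  assumes "a \<in> R" "b \<in> R" "x * a = y * b"
  shows "\<exists>c\<in>R. a = y * c"
proof -
  obtain c where "c \<in> R" "b = x * c" using reg assms by blast
  with assms x0 have "a = y * c" by simp
  with \<open>c \<in> R\<close> show ?thesis by blast
qed

lemma regseq_sym: "regseq R y x"
  using reg' by unfold_locales (auto simp: xR yR x0 y0 intro: reg')

lemma reg_pow: "a \<in> R \<Longrightarrow> b \<in> R \<Longrightarrow> x ^ n * a = y * b \<Longrightarrow> \<exists>c\<in>R. a = y * c"
proof (induction n arbitrary: b)
  case 0
  then show ?case by auto
next
  case (Suc n)
  then have "x * (x ^ n * a) = y * b" "x ^ n * a \<in> R" by (auto intro!: cl xR simp: mult.assoc)
  then obtain c where "c \<in> R" "x ^ n * a = y * c" using reg' Suc.prems by blast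
  then show ?case using Suc by blast
qed

lemma reg_pow2: "a \<in> R \<Longrightarrow> b \<in> R \<Longrightarrow> x ^ n * a = y ^ k * b \<Longrightarrow> \<exists>c\<in>R. a = y ^ k * c"
proof (induction k arbitrary: a)
  case 0
  then show ?case by auto
next
  case (Suc k)
  then have "x ^ n * a = y * (y ^ k * b)" "y ^ k * b \<in> R" by (auto intro!: cl yR simp: mult.assoc)
  then obtain c where c: "c \<in> R" "a = y * c" using reg_pow Suc.prems by blast
  then have "x ^ n * c = y ^ k * b" using Suc.prems(3) y0 by simp
  then obtain d where "d \<in> R" "c = y ^ k * d" using Suc c by blast
  then show ?case using c by auto
qed

text \<open>Depth two: powers of x and y again form a regular sequence, so an element of the field
  that both multiply into R lies in R.\<close>

lemma primary_div:
  assumes "x ^ n * e \<in> R" "y ^ n * e \<in> R"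
  shows "e \<in> R"
proof -
  have "x ^ n * (y ^ n * e) = y ^ n * (x ^ n * e)" by simp
  from reg_pow2[OF assms(2,1) this] obtain c where "c \<in> R" "y ^ n * e = y ^ n * c" by blast
  then show ?thesis using y0 by simp
qed

text \<open>The kernel of R[T] \<rightarrow> R[y/x] has its coefficients in (x, y). Clearing
  denominators makes the constant term of a relation divisible by y, and then a relation of lower
  degree splits off.\<close>

lemma quasi_regular:
  assumes "p \<in> RT" "poly p (y / x) = 0"
  shows "coeff p i \<in> span2 R x y"
proof -
  have "p \<in> polys (span2 R x y)"
    using assms
  proof (induction "degree p" arbitrary: p rule: less_induct)
    case less
    show ?case
    proof (cases "degree p = 0")
      case True
      then obtain c where "p = [:c:]" by (meson degree_eq_zeroE)
      then have "p = 0" using less.prems by simp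
      then show ?thesis by (simp add: polys_def span2_cl xR yR)
    next
      case False
      obtain c p' where p: "p = pCons c p'" by (cases p) auto
      have c: "c \<in> R" using less.prems(1) unfolding p polys_def by (auto dest: spec[of _ 0])
      have p': "p' \<in> RT" using less.prems(1) unfolding p polys_def by (auto dest: spec[of _ "Suc _"])
      have p'0: "p' \<noteq> 0" using False p by auto
      define n where "n = degree p'"
      have "x ^ n * poly p' (y / x) = (\<Sum>i\<le>n. coeff p' i * (x ^ n * (y / x) ^ i))"
        unfolding poly_altdef n_def by (simp add: sum_distrib_left mult_ac)
      also have "\<dots> = (\<Sum>i\<le>n. coeff p' i * (x ^ (n - i) * y ^ i))"
        by (rule sum.cong) (auto simp: power_divide x0 power_diff)
      also have "\<dots> \<in> R"
        by (rule subring_sum[OF subring]) (use p' in \<open>auto intro!: cl xR yR simp: polys_coeff\<close>)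
      finally have S: "x ^ n * poly p' (y / x) \<in> R" .
      have e: "c + y / x * poly p' (y / x) = 0" using less.prems(2) p by simp
      have "x * c = - (y * poly p' (y / x))"
        using arg_cong[OF e, of "\<lambda>z. x * z"] x0 by (simp add: algebra_simps eq_neg_iff_add_eq_0)
      then have "x ^ n * (x * c) = x ^ n * - (y * poly p' (y / x))" by (rule arg_cong)
      then have "x ^ Suc n * c = y * - (x ^ n * poly p' (y / x))" by (simp add: mult_ac)
      from reg_pow[OF c cl(5)[OF S] this] obtain c' where c': "c' \<in> R" "c = y * c'" by blast
      \<comment> \<open>Since c = y c' = (y/x)(x c'), the factor y/x cancels from the relation, and
        x c' joins the constant term of p'.\<close>
      define q where "q = p' + [:x * c':]"
      have "y / x * (poly p' (y / x) + x * c') = 0" using e c' x0 by (simp add: field_simps)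
      then have q0: "poly q (y / x) = 0" using x0 y0 by (simp add: q_def)
      have q: "q \<in> RT" unfolding q_def by (intro RT_cl p' cl xR c')
      have "degree q \<le> degree p'" unfolding q_def by (intro degree_add_le) auto
      then have "degree q < degree p" using p p'0 by simp
      then have "q \<in> polys (span2 R x y)" using less.hyps q q0 by blast
      moreover have "p' = q - [:x * c':]" by (simp add: q_def)
      moreover have "x * c' \<in> span2 R x y" "y * c' \<in> span2 R x y"
        using span2_cl(7)[OF xR yR] span2_cl(3,4)[OF xR yR] c' by auto
      ultimately show ?thesis
        unfolding p c'(2) polys_def 
        by (auto simp: coeff_pCons span2_cl(2)[OF xR yR] span2_cl(6)[OF xR yR] split: nat.splits)
    qed
  qed
  then show ?thesis by (simp add: polys_def)
qed

section \<open>Powers of the ideal (x, y)\<close>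

abbreviation "\<mu> \<equiv> mpow R x y"

lemma mpow_cl: 
  "\<mu> n \<subseteq> R" "0 \<in> \<mu> n" "\<And>a b. a \<in> \<mu> n \<Longrightarrow> b \<in> \<mu> n \<Longrightarrow> a + b \<in> \<mu> n"
  "\<And>a b. a \<in> \<mu> n \<Longrightarrow> b \<in> R \<Longrightarrow> a * b \<in> \<mu> n" "\<And>a b. a \<in> \<mu> n \<Longrightarrow> b \<in> R \<Longrightarrow> b * a \<in> \<mu> n"
  "\<And>a b. a \<in> \<mu> n \<Longrightarrow> b \<in> \<mu> n \<Longrightarrow> a - b \<in> \<mu> n"
proof -
  show "\<mu> n \<subseteq> R" by (induction n) (auto intro!: cl xR yR)
  show "0 \<in> \<mu> n" by (induction n) (auto simp: cl intro!: exI[of _ 0])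
  show add: "a + b \<in> \<mu> n" if "a \<in> \<mu> n" "b \<in> \<mu> n" for a b
    using that
  proof (induction n arbitrary: a b)
    case (Suc n)
    obtain a1 a2 b1 b2 where *: "a = x * a1 + y * a2" "b = x * b1 + y * b2"
      "a1 \<in> \<mu> n" "a2 \<in> \<mu> n" "b1 \<in> \<mu> n" "b2 \<in> \<mu> n" using Suc.prems by auto
    have "a + b = x * (a1 + b1) + y * (a2 + b2)" unfolding * by (simp add: algebra_simps)
    then show ?case using Suc.IH * mpow_SucI by metis
  qed (auto intro: cl)
  show mult: "a * b \<in> \<mu> n" if "a \<in> \<mu> n" "b \<in> R" for a b
    using that
  proof (induction n arbitrary: a)
    case (Suc n)
    obtain a1 a2 where *: "a = x * a1 + y * a2" "a1 \<in> \<mu> n" "a2 \<in> \<mu> n" using Suc.prems by auto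
    have "a * b = x * (a1 * b) + y * (a2 * b)" unfolding * by (simp add: algebra_simps)
    then show ?case using Suc * mpow_SucI by metis
  qed (auto intro: cl)
  then show "b * a \<in> \<mu> n" if "a \<in> \<mu> n" "b \<in> R" for a b
    using that by (simp add: mult.commute)
  show "a - b \<in> \<mu> n" if "a \<in> \<mu> n" "b \<in> \<mu> n" for a b
    using add[OF that(1) mult[OF that(2), of "-1"]] cl by simp
qed

lemma mpow_Suc_subset: "\<mu> (Suc n) \<subseteq> \<mu> n"
proof
  fix c assume "c \<in> \<mu> (Suc n)"
  then obtain a b where "a \<in> \<mu> n" "b \<in> \<mu> n" "c = x * a + y * b" by (rule mpow_SucE)
  then show "c \<in> \<mu> n" using mpow_cl(3,5) xR yR by simp
qed

lemma mpow_antimono: "m \<le> n \<Longrightarrow> \<mu> n \<subseteq> \<mu> m"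
  by (rule lift_Suc_antimono_le) (use mpow_Suc_subset in auto)

text \<open>Every monomial of degree n + 1 other than the pure power of y contains x; isolating that
  one term makes regularity of the pair applicable.\<close>

lemma mpow_decomp: "a \<in> \<mu> (Suc n) \<Longrightarrow> \<exists>b\<in>\<mu> n. \<exists>d\<in>R. a = x * b + y ^ Suc n * d"
proof (induction n arbitrary: a)
  case 0
  then show ?case by auto
next
  case (Suc n)
  from Suc.prems obtain b c where bc: "b \<in> \<mu> (Suc n)" "c \<in> \<mu> (Suc n)" "a = x * b + y * c"
    by (rule mpow_SucE)
  then obtain e d where e: "e \<in> \<mu> n" "d \<in> R" "c = x * e + y ^ Suc n * d" using Suc.IH by blast
  have "y * e \<in> \<mu> (Suc n)" using mpow_SucI[OF mpow_cl(2) e(1)] by simp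
  moreover have "a = x * (b + y * e) + y ^ Suc (Suc n) * d"
    unfolding bc e by (simp add: algebra_simps)
  ultimately show ?case using bc e mpow_cl(3) by blast
qed

lemma mpow_gen: "x ^ n \<in> \<mu> n" "y ^ n \<in> \<mu> n"
  by (induction n) (use mpow_SucI[OF _ mpow_cl(2)] mpow_SucI[OF mpow_cl(2)] in \<open>force simp: cl\<close>)+

text \<open>The class of x is a nonzerodivisor in the associated graded ring: by
  \<open>mpow_decomp\<close> the only term not visibly divisible by x is y^(n+1) d, and regularity
  forces x to divide d.\<close>

lemma mpow_x_cancel:
  assumes "e \<in> R" "x * e \<in> \<mu> (Suc n)"
  shows "e \<in> \<mu> n"
proof -
  obtain b d where b: "b \<in> \<mu> n" "d \<in> R" "x * e = x * b + y ^ Suc n * d"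
    using mpow_decomp[OF assms(2)] by blast
  have "y ^ Suc n * d = x * (e - b)" using b(3) by (simp add: algebra_simps)
  moreover have "e - b \<in> R" using assms(1) b(1) mpow_cl(1) by (auto intro!: cl)
  ultimately obtain c where c: "c \<in> R" "d = x * c"
    using regseq.reg_pow[OF regseq_sym b(2)] by blast
  then have "x * e = x * (b + y ^ Suc n * c)" using b(3) by (simp add: algebra_simps)
  then have "e = b + y ^ Suc n * c" using x0 mult_left_cancel by blast
  moreover have "y ^ Suc n * c \<in> \<mu> n"
    using mpow_cl(4)[OF mpow_gen(2) c(1)] mpow_Suc_subset by blast
  ultimately show ?thesis using b mpow_cl(3) by simp
qed

lemma mpow_xpow_cancel: "e \<in> R \<Longrightarrow> x ^ k * e \<in> \<mu> (n + k) \<Longrightarrow> e \<in> \<mu> n"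
proof (induction k)
  case (Suc k)
  have "x * (x ^ k * e) \<in> \<mu> (Suc (n + k))" using Suc.prems by (simp add: mult_ac)
  then have "x ^ k * e \<in> \<mu> (n + k)"
    by (rule mpow_x_cancel[rotated]) (auto intro!: cl xR Suc.prems)
  then show ?case using Suc by blast
qed simp

text \<open>An element of the n-th power is a form of degree n in x and y with coefficients in R;
  putting T = y/x dehomogenises it.\<close>

lemma mpow_poly: "a \<in> \<mu> n \<longleftrightarrow> (\<exists>p\<in>RT. degree p \<le> n \<and> a = x ^ n * poly p (y / x))"
proof
  assume "a \<in> \<mu> n"
  then show "\<exists>p\<in>RT. degree p \<le> n \<and> a = x ^ n * poly p (y / x)"
  proof (induction n arbitrary: a)
    case 0
    then show ?case by (intro bexI[of _ "[:a:]"]) (auto simp: RT_cl)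
  next
    case (Suc n)
    then obtain b c where bc: "b \<in> \<mu> n" "c \<in> \<mu> n" "a = x * b + y * c" by (metis mpow_SucE)
    from Suc.IH[OF bc(1)] Suc.IH[OF bc(2)]
    obtain p q where pq: "p \<in> RT" "degree p \<le> n" "b = x ^ n * poly p (y / x)"
      "q \<in> RT" "degree q \<le> n" "c = x ^ n * poly q (y / x)" by blast
    have "a = x ^ Suc n * poly (p + pCons 0 q) (y / x)"
      unfolding bc pq using x0 by (simp add: field_simps)
    moreover have "degree (p + pCons 0 q) \<le> Suc n"
      using pq by (intro degree_add_le) (auto intro: order.trans[OF degree_pCons_le])
    moreover have "p + pCons 0 q \<in> RT" using pq by (auto intro!: RT_cl cl)
    ultimately show ?case by blast
  qed
next
  assume "\<exists>p\<in>RT. degree p \<le> n \<and> a = x ^ n * poly p (y / x)"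
  then obtain p where "p \<in> RT" "degree p \<le> n" "a = x ^ n * poly p (y / x)" by blast
  then show "a \<in> \<mu> n"
  proof (induction n arbitrary: a p)
    case 0
    then obtain c where "p = [:c:]" by (metis degree_0_id le_zero_eq)
    with 0 show ?case by (auto simp: polys_def dest: spec[of _ 0])
  next
    case (Suc n)
    obtain c p' where p: "p = pCons c p'" by (cases p) auto
    have c: "c \<in> R" using Suc.prems(1) unfolding p polys_def by (auto dest: spec[of _ 0])
    have p': "p' \<in> RT" using Suc.prems(1) unfolding p polys_def by (auto dest: spec[of _ "Suc _"])
    have "degree p' \<le> n" using Suc.prems(2) p by (auto split: if_splits)
    then have "x ^ n * poly p' (y / x) \<in> \<mu> n" using Suc.IH p' by blast
    moreover have "x ^ n * c \<in> \<mu> n" using mpow_cl(4)[OF mpow_gen(1) c] .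
    moreover have "a = x * (x ^ n * c) + y * (x ^ n * poly p' (y / x))"
      using Suc.prems(3) x0 unfolding p by (simp add: distrib_left)
    ultimately show ?case using mpow_SucI by metis
  qed
qed

text \<open>Pigeonhole: a monomial of degree 2K in x and y contains x^K or y^K.\<close>

lemma mpow_subset_ideal:
  assumes J: "\<And>a b. a \<in> J \<Longrightarrow> b \<in> J \<Longrightarrow> a + b \<in> J" "\<And>a b. a \<in> J \<Longrightarrow> b \<in> R \<Longrightarrow> a * b \<in> J"
    and K: "x ^ K \<in> J" "y ^ K \<in> J"
  shows "\<mu> (K + K) \<subseteq> J"
proof -
  \<comment> \<open>Generalised to partially expanded products, so that unfolding one layer of
    \<open>a\<close> moves a single factor into the monomial.\<close>
  have "x ^ i * y ^ j * a \<in> J" if "a \<in> \<mu> n" "i + j + n \<ge> K + K" for a i j n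
    using that
  proof (induction n arbitrary: a i j)
    case 0
    then consider "i \<ge> K" | "j \<ge> K" by force
    then show ?case
    proof cases
      case 1
      have "x ^ K * (x ^ (i - K) * y ^ j * a) \<in> J"
        using 0 by (intro J(2)[OF K(1)]) (auto intro!: cl xR yR)
      moreover have "x ^ K * x ^ (i - K) = x ^ i" using 1 by (simp flip: power_add)
      ultimately show ?thesis by (simp add: mult.assoc[symmetric])
    next
      case 2
      have "y ^ K * (y ^ (j - K) * x ^ i * a) \<in> J"
        using 0 by (intro J(2)[OF K(2)]) (auto intro!: cl xR yR)
      moreover have "y ^ K * y ^ (j - K) = y ^ j" using 2 by (simp flip: power_add)
      ultimately show ?thesis by (simp add: mult.assoc[symmetric] mult.commute[of "x ^ i"])
    qed
  next
    case (Suc n)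
    then obtain b c where bc: "b \<in> \<mu> n" "c \<in> \<mu> n" "a = x * b + y * c" by (metis mpow_SucE)
    have "x ^ i * y ^ j * a = x ^ Suc i * y ^ j * b + x ^ i * y ^ Suc j * c"
      unfolding bc by (simp add: algebra_simps)
    then show ?case using Suc.IH[OF bc(1), of "Suc i" j] Suc.IH[OF bc(2), of i "Suc j"] Suc.prems J(1)
      by simp
  qed
  from this[of _ "K + K" 0 0] show ?thesis by auto
qed

end

text \<open>\<open>sep\<close> is the conclusion of Krull's intersection theorem.
  \<open>coprime_rep\<close> is the trace of unique factorisation in dimension two, where coprime
  elements generate an ideal containing a power of the maximal ideal.\<close>

locale regular_pair = regseq +
  assumes M_span: "nonunits R = span2 R x y"
    and sep: "a \<in> R \<Longrightarrow> a \<noteq> 0 \<Longrightarrow> \<exists>n. a \<notin> mpow R x y n"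
    and coprime_rep: "\<exists>a\<in>R. \<exists>b\<in>R. \<exists>n. b \<noteq> 0 \<and> z = a / b \<and> x ^ n \<in> span2 R a b \<and> y ^ n \<in> span2 R a b"
begin

lemma regular_pair_sym: "regular_pair R y x"
proof -
  interpret s: regseq R y x by (rule regseq_sym)
  show ?thesis
  proof unfold_locales
    show "nonunits R = span2 R y x" using M_span span2_commute by metis
    show "\<exists>n. a \<notin> mpow R y x n" if "a \<in> R" "a \<noteq> 0" for a using sep[OF that] mpow_commute by metis
    show "\<exists>a\<in>R. \<exists>b\<in>R. \<exists>n. b \<noteq> 0 \<and> z = a / b \<and> y ^ n \<in> span2 R a b \<and> x ^ n \<in> span2 R a b" for z
      using coprime_rep[of z] by blast
  qed
qed

lemma xM: "x \<in> M" and yM: "y \<in> M"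
  unfolding M_span using span2_cl xR yR by auto

section \<open>The ring R[y/x] and the order of an element\<close>

abbreviation "t \<equiv> y / x"

text \<open>By quasi-regularity, R[y/x] modulo the extended maximal ideal is a polynomial ring over
  the residue field; so membership in \<open>MT\<close> can be read off the value at
  \<open>t\<close>.\<close>

lemma poly_t_MT: "p \<in> RT \<Longrightarrow> q \<in> MT \<Longrightarrow> poly p t = poly q t \<Longrightarrow> p \<in> MT"
proof -
  assume *: "p \<in> RT" "q \<in> MT" "poly p t = poly q t"
  have "coeff (p - q) i \<in> M" for i
    unfolding M_span by (rule quasi_regular) (use * MT_RT in \<open>auto intro!: RT_cl\<close>)
  then have "p - q \<in> MT" by (simp add: polys_def)
  then show "p \<in> MT" using MT_cl(2)[of "p - q" q] * by simp
qed

lemma poly_t_nonzero: "p \<in> RT \<Longrightarrow> p \<notin> MT \<Longrightarrow> poly p t \<noteq> 0"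
  using poly_t_MT[of p 0] MT_cl(1) by auto

lemma poly_t_x: "p \<in> RT \<Longrightarrow> q \<in> RT \<Longrightarrow> poly p t = x ^ Suc k * poly q t \<Longrightarrow> p \<in> MT"
  by (rule poly_t_MT[of _ "smult (x ^ Suc k) q"])
    (auto intro!: MT_cl(6) nonunits_mult(1) xM cl(7) xR)

text \<open>In R[y/x] the maximal ideal becomes principal, generated by x. The degree may grow by
  one, as y v = x (v t); \<open>order_rep\<close> needs exactly this bound.\<close>

lemma MT_x: "p \<in> MT \<Longrightarrow> \<exists>q\<in>RT. degree q \<le> Suc (degree p) \<and> poly p t = x * poly q t"
proof (induction p)
  case 0
  then show ?case by (auto intro!: bexI[of _ 0] simp: RT_cl)
next
  case (pCons c p)
  have c: "c \<in> M" using pCons.prems by (auto simp: polys_def dest: spec[of _ 0])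
  have "p \<in> MT" using pCons.prems by (auto simp: polys_def dest: spec[of _ "Suc _"])
  then obtain q where q: "q \<in> RT" "degree q \<le> Suc (degree p)" "poly p t = x * poly q t" using pCons.IH by blast
  obtain u v where uv: "u \<in> R" "v \<in> R" "c = x * u + y * v" using c unfolding M_span by (rule span2E)
  show ?case
  proof (cases "p = 0")
    case True
    then show ?thesis using uv x0
      by (intro bexI[of _ "[:u, v:]"]) (auto intro!: RT_cl simp: field_simps)
  next
    case False
    have "degree ([:u, v:] + pCons 0 q) \<le> Suc (degree (pCons c p))"
      using q False by (intro degree_add_le) (auto intro: order.trans[OF degree_pCons_le])
    moreover have "poly (pCons c p) t = x * poly ([:u, v:] + pCons 0 q) t"
      using uv q x0 by (simp add: field_simps)
    moreover have "[:u, v:] + pCons 0 q \<in> RT" using uv q by (auto intro!: RT_cl cl)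
    ultimately show ?thesis by blast
  qed
qed

text \<open>\<open>r\<close> is the order of \<open>a\<close> at the maximal ideal: were
  \<open>p\<close> in \<open>MT\<close>, another factor x would split off and put \<open>a\<close>
  into the next power.\<close>

lemma order_rep:
  assumes "a \<in> R" "a \<noteq> 0"
  obtains r p where "p \<in> RT" "p \<notin> MT" "degree p \<le> r" "a = x ^ r * poly p t"
proof -
  define n where "n = (LEAST n. a \<notin> \<mu> n)"
  have n: "a \<notin> \<mu> n" "\<And>m. m < n \<Longrightarrow> a \<in> \<mu> m"
    unfolding n_def using LeastI_ex[OF sep[OF assms]] not_less_Least by auto
  have "n \<noteq> 0"
  proof
    assume "n = 0"
    then show False using n(1) assms(1) by simp
  qed
  then obtain r where r: "n = Suc r" by (cases n) auto
  then obtain p where p: "p \<in> RT" "degree p \<le> r" "a = x ^ r * poly p t"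
    using n(2)[of r] mpow_poly by blast
  have "p \<notin> MT"
  proof
    assume "p \<in> MT"
    then obtain q where q: "q \<in> RT" "degree q \<le> Suc (degree p)" "poly p t = x * poly q t" using MT_x by blast
    then have "a = x ^ Suc r * poly q t" using p by simp
    moreover have "degree q \<le> Suc r" using q(2) p(2) by linarith
    ultimately have "a \<in> \<mu> (Suc r)" using mpow_poly[of a "Suc r"] q(1) by blast
    then show False using n r by simp
  qed
  then show ?thesis using that p by blast
qed

lemma frac_rep:
  assumes "f \<noteq> 0"
  obtains r s p q where "p \<in> RT" "p \<notin> MT" "q \<in> RT" "q \<notin> MT" "f * (x ^ s * poly q t) = x ^ r * poly p t"
proof -
  obtain a b where ab: "a \<in> R" "b \<in> R" "b \<noteq> 0" "f = a / b" using coprime_rep[of f] by blast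
  then have "a \<noteq> 0" using assms by auto
  from order_rep[OF ab(1) this] order_rep[OF ab(2,3)] that ab show ?thesis
    by (metis nonzero_eq_divide_eq)
qed

end

section \<open>Domination and Abhyankar's factorization step\<close>

definition dominates :: "'a::field set \<Rightarrow> 'a set \<Rightarrow> bool" where
  "dominates B A \<longleftrightarrow> A \<subseteq> B \<and> nonunits A \<subseteq> nonunits B"

lemma dominatesD:
  assumes "dominates B A"
  shows "A \<subseteq> B" "\<And>a. a \<in> A \<Longrightarrow> a \<in> B" "\<And>a. a \<in> nonunits A \<Longrightarrow> a \<in> nonunits B"
    "\<And>a. a \<in> A \<Longrightarrow> a \<in> nonunits B \<Longrightarrow> a \<in> nonunits A"
  using assms by (auto simp: dominates_def nonunits_def)

context regular_pair
begin

lemma not_comparable: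
  "y / x \<notin> R" "x / y \<notin> R"
proof -
  show "y / x \<notin> R"
  proof
    assume "y / x \<in> R"
    with reg[OF this cl(2)] x0 obtain c where "c \<in> R" "1 = x * c" by auto
    then have "1 \<in> M" using nonunits_mult(1)[OF xM] by metis
    then show False using one_unit by simp
  qed
  show "x / y \<notin> R"
  proof
    assume "x / y \<in> R"
    with reg'[OF cl(2) this] y0 obtain c where "c \<in> R" "1 = y * c" by auto
    then have "1 \<in> M" using nonunits_mult(1)[OF yM] by metis
    then show False using one_unit by simp
  qed
qed

end

text \<open>Neither quotient of the parameters u, v of B lies in B. Writing u / v = a / b over A
  with powers of x and y in (a, b), both a and b are therefore nonunits of B, and hence so are x and
  y.\<close>

lemma regular_pair_dominates:
  assumes A: "regular_pair A x y" and B: "regular_pair B u v" and sub: "A \<subseteq> B"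
  shows "dominates B A"
proof -
  interpret A: regular_pair A x y by fact
  interpret B: regular_pair B u v by fact
  obtain a b n where ab: "a \<in> A" "b \<in> A" "b \<noteq> 0" "u / v = a / b"
    "x ^ n \<in> span2 A a b" "y ^ n \<in> span2 A a b" using A.coprime_rep[of "u / v"] by blast
  have "a \<noteq> 0" using ab B.x0 B.y0 by auto
  have "a \<in> B.M" "b \<in> B.M"
  proof -
    show "a \<in> B.M"
    proof (rule ccontr)
      assume "a \<notin> B.M"
      then have "b * inverse a \<in> B" using B.unitD ab sub by (auto intro!: B.cl)
      moreover have "b * inverse a = v / u" using arg_cong[OF ab(4), of inverse] by (simp add: field_simps)
      ultimately show False using B.not_comparable by simp
    qed
    show "b \<in> B.M"
    proof (rule ccontr)
      assume "b \<notin> B.M"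
      then have "a * inverse b \<in> B" using B.unitD ab sub by (auto intro!: B.cl)
      moreover have "a * inverse b = u / v" using ab(4) by (simp add: field_simps)
      ultimately show False using B.not_comparable by simp
    qed
  qed
  then have "span2 A a b \<subseteq> B.M"
    using B.span2_nonunits sub unfolding span2_def by blast
  then have "x \<in> B.M" "y \<in> B.M" using B.units_power ab A.xR A.yR sub by blast+
  then have "span2 A x y \<subseteq> B.M"
    using B.span2_nonunits sub unfolding span2_def by blast
  then show ?thesis using A.M_span sub by (simp add: dominates_def)
qed

text \<open>If \<open>B\<close> contained neither quotient of the parameters of \<open>A\<close>, then \<open>y / x\<close> would be
  residually transcendental over \<open>B\<close>. This puts \<open>B\<close> into the order valuation ring of \<open>A\<close>, whence
  \<open>B = A + m\<^sup>n B\<close> for all \<open>n\<close> and \<open>B = A\<close> by separatedness.\<close>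

theorem regular_pair_factorization:
  assumes A: "regular_pair A x y" and B: "regular_pair B u v" and dom: "dominates B A"
    and ne: "A \<noteq> B"
  shows "y / x \<in> B \<or> x / y \<in> B"
proof (rule ccontr)
  interpret A: regular_pair A x y by fact
  interpret B: regular_pair B u v by fact
  note D = dominatesD[OF dom]
  assume no: "\<not> ?thesis"
  \<comment> \<open>The quotient is reduced over B. Then x and y have the common factor g = x / a =
    y / b, which turns out to be a unit.\<close>
  obtain a b n where ab: "b \<in> B" "a \<in> B" "a \<noteq> 0" "y / x = b / a"
    "u ^ n \<in> span2 B b a" "v ^ n \<in> span2 B b a" using B.coprime_rep[of "y / x"] by blast
  have b0: "b \<noteq> 0" using ab A.x0 A.y0 by auto
  have aM: "a \<in> B.M"
  proof (rule ccontr)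
    assume "a \<notin> B.M"
    then have "b * inverse a \<in> B" using B.unitD ab by (auto intro!: B.cl)
    moreover have "b * inverse a = y / x" using ab(4) by (simp add: field_simps)
    ultimately show False using no by simp
  qed
  have bM: "b \<in> B.M"
  proof (rule ccontr)
    assume "b \<notin> B.M"
    then have "a * inverse b \<in> B" using B.unitD ab by (auto intro!: B.cl)
    moreover have "a * inverse b = x / y" using arg_cong[OF ab(4), of inverse] by (simp add: field_simps)
    ultimately show False using no by simp
  qed
  \<comment> \<open>Depth two of B, transferred from u, v to the pair a, b.\<close>
  have prim: "e \<in> B" if "a * e \<in> B" "b * e \<in> B" for e
  proof (rule B.primary_div)
    have "c * e \<in> B" if "c \<in> span2 B b a" for c
    proof -
      from that obtain p q where "p \<in> B" "q \<in> B" "c = b * p + a * q" by (rule span2E)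
      then have "c * e = b * e * p + a * e * q" by (simp add: algebra_simps)
      then show ?thesis using \<open>a * e \<in> B\<close> \<open>b * e \<in> B\<close> \<open>p \<in> B\<close> \<open>q \<in> B\<close> by (auto intro!: B.cl)
    qed
    then show "u ^ n * e \<in> B" "v ^ n * e \<in> B" using ab by auto
  qed
  define g where "g = x / a"
  have g: "x = a * g" "y = b * g" using ab A.x0 by (auto simp: g_def field_simps)
  have gB: "g \<in> B" by (rule prim) (use g D A.xR A.yR in auto)
  interpret C: regseq B a b
  proof unfold_locales
    fix c d assume "c \<in> B" "d \<in> B" "a * c = b * d"
    then have "b * (d / a) = c" using ab by (simp add: field_simps)
    then have "d / a \<in> B" using \<open>c \<in> B\<close> \<open>d \<in> B\<close> ab(3) prim[of "d / a"] by simp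
    then show "\<exists>c\<in>B. d = a * c" using ab(3) by (intro bexI[of _ "d / a"]) auto
  qed (use ab b0 in auto)
  have xkM: "x ^ Suc k \<in> B.M" for k
    using B.nonunits_mult(1)[OF D(3)[OF A.xM] B.cl(7)[OF D(2)[OF A.xR]]] by simp
  have AB: "A.RT \<subseteq> B.RT" by (rule polys_mono) fact
  have span_M: "span2 B a b \<subseteq> B.M" by (rule B.span2_nonunits) fact+
  have unit_coeff: "\<exists>i. coeff p i \<in> A \<and> coeff p i \<notin> B.M" if "p \<in> A.RT" "p \<notin> A.MT" for p
    using that D(4) by (fastforce simp: polys_def)
  \<comment> \<open>As b / a = y / x, quasi-regularity of a, b in B concerns the same value t. It
    compares the two sides of a relation coefficientwise modulo (a, b).\<close>
  have key: "f * coeff q i - coeff p i \<in> span2 B a b"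
    if "f \<in> B" "q \<in> B.RT" "p \<in> B.RT" "f * poly q A.t = poly p A.t" for f p q i
  proof -
    have "coeff (smult f q - p) i \<in> span2 B a b"
      using that ab(4) by (intro C.quasi_regular B.RT_cl) auto
    then show ?thesis by simp
  qed
  \<comment> \<open>Elements of B have nonnegative order in the order valuation of A, and nonunits
    of B have positive order.\<close>
  have rep: "\<exists>k p q. p \<in> A.RT \<and> p \<notin> A.MT \<and> q \<in> A.RT \<and> q \<notin> A.MT \<and>
      f * poly q A.t = x ^ k * poly p A.t \<and> (f \<in> B.M \<longrightarrow> k > 0)" if "f \<in> B" "f \<noteq> 0" for f
  proof -
    obtain r s p q where pq: "p \<in> A.RT" "p \<notin> A.MT" "q \<in> A.RT" "q \<notin> A.MT"
      "f * (x ^ s * poly q A.t) = x ^ r * poly p A.t" using A.frac_rep[OF \<open>f \<noteq> 0\<close>] by metis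
    have *: False if "h \<in> B.M" "h * poly q A.t = poly p A.t" for h
    proof -
      obtain i where i: "coeff p i \<in> A" "coeff p i \<notin> B.M" using unit_coeff pq by blast
      have "h * coeff q i - coeff p i \<in> B.M"
        using key[OF _ _ _ that(2)] that(1) pq AB B.nonunits_sub span_M by blast
      moreover have "h * coeff q i \<in> B.M"
        using that(1) pq AB by (auto intro!: B.nonunits_mult(1) D(2) polys_coeff)
      ultimately have "coeff p i \<in> B.M" using B.nonunits_diff by fastforce
      then show False using i by simp
    qed
    have rs: "s \<le> r"
    proof (rule ccontr)
      assume "\<not> s \<le> r"
      then obtain k where k: "s = r + Suc k" using less_iff_Suc_add by (metis not_le add_Suc_right)
      then have "x ^ r * (f * x ^ Suc k * poly q A.t) = x ^ r * poly p A.t"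
        using pq(5) by (simp add: power_add mult_ac)
      then have "(f * x ^ Suc k) * poly q A.t = poly p A.t" using A.x0 by simp
      moreover have "f * x ^ Suc k \<in> B.M"
        using B.nonunits_mult(2)[OF xkM \<open>f \<in> B\<close>] .
      ultimately show False using * by blast
    qed
    then obtain k where k: "r = s + k" using le_Suc_ex by blast
    then have "x ^ s * (f * poly q A.t) = x ^ s * (x ^ k * poly p A.t)"
      using pq(5) by (simp add: power_add mult_ac)
    then have e: "f * poly q A.t = x ^ k * poly p A.t" using A.x0 by simp
    moreover have "k > 0" if "f \<in> B.M" using *[OF that] e by (cases k) auto
    ultimately show ?thesis using pq by blast
  qed
  have rep_M: "\<exists>k p q. p \<in> A.RT \<and> p \<notin> A.MT \<and> q \<in> A.RT \<and> q \<notin> A.MT \<and>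
      f * poly q A.t = x ^ Suc k * poly p A.t" if "f \<in> B.M" "f \<noteq> 0" for f
  proof -
    obtain k p q where *: "p \<in> A.RT" "p \<notin> A.MT" "q \<in> A.RT" "q \<notin> A.MT"
      "f * poly q A.t = x ^ k * poly p A.t" "k > 0"
      using rep[OF B.nonunits_sub[OF \<open>f \<in> B.M\<close>] \<open>f \<noteq> 0\<close>] \<open>f \<in> B.M\<close> by blast
    moreover obtain l where "k = Suc l" using *(6) by (cases k) auto
    ultimately show ?thesis by blast
  qed
  \<comment> \<open>Otherwise x = a g would be a product of two elements of positive order, although
    x has order one.\<close>
  have "g \<notin> B.M"
  proof
    assume "g \<in> B.M"
    have "g \<noteq> 0" using g A.x0 by auto
    obtain k p q where 1: "p \<in> A.RT" "p \<notin> A.MT" "q \<in> A.RT" "q \<notin> A.MT"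
      "g * poly q A.t = x ^ Suc k * poly p A.t"
      using rep_M[OF \<open>g \<in> B.M\<close> \<open>g \<noteq> 0\<close>] by blast
    obtain l p' q' where 2: "p' \<in> A.RT" "p' \<notin> A.MT" "q' \<in> A.RT" "q' \<notin> A.MT"
      "a * poly q' A.t = x ^ Suc l * poly p' A.t"
      using rep_M[OF aM ab(3)] by blast
    have "x * (poly q A.t * poly q' A.t) = (g * poly q A.t) * (a * poly q' A.t)"
      using g by (simp add: mult_ac)
    also have "\<dots> = x * (x ^ Suc (k + l) * (poly p A.t * poly p' A.t))"
      unfolding 1 2 by (simp add: power_add mult_ac)
    finally have "poly (q * q') A.t = x ^ Suc (k + l) * poly (p * p') A.t" using A.x0 by simp
    then have "q * q' \<in> A.MT" by (rule A.poly_t_x[rotated 2]) (auto intro!: A.RT_cl 1 2)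
    then show False using A.MT_mult 1 2 by blast
  qed
  then have gi: "inverse g \<in> B" "g \<noteq> 0" using B.unitD gB by auto
  have ab_eq: "a = x * inverse g" "b = y * inverse g" using g gi by auto
  have span_eq: "span2 B a b \<subseteq> span2 B x y"
  proof
    fix c assume "c \<in> span2 B a b"
    then obtain p q where "p \<in> B" "q \<in> B" "c = a * p + b * q" by (rule span2E)
    then have "c = x * (inverse g * p) + y * (inverse g * q)" unfolding ab_eq by (simp add: mult_ac)
    then show "c \<in> span2 B x y" using gi \<open>p \<in> B\<close> \<open>q \<in> B\<close> by (auto intro!: span2I B.cl)
  qed
  have xB: "x \<in> B" and yB: "y \<in> B" using D A.xR A.yR by auto
  note S = B.span2_cl[OF xB yB]
  \<comment> \<open>B = A + (x, y) B: comparing coefficients at a unit coefficient of q expresses f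
    modulo (x, y) by an element of A.\<close>
  have approx: "\<exists>d\<in>A. f - d \<in> span2 B x y" if fB: "f \<in> B" for f
  proof (cases "f = 0")
    case True
    then show ?thesis using S A.cl by (intro bexI[of _ 0]) auto
  next
    case False
    obtain k p q where pq: "p \<in> A.RT" "p \<notin> A.MT" "q \<in> A.RT" "q \<notin> A.MT"
      "f * poly q A.t = x ^ k * poly p A.t" using rep[OF fB False] by blast
    have "f * poly q A.t = poly (smult (x ^ k) p) A.t" using pq by simp
    then have *: "f * coeff q i - x ^ k * coeff p i \<in> span2 B x y" for i
      using key[OF fB, of q "smult (x ^ k) p" i] pq AB span_eq A.RT_cl(7)[OF A.cl(7)[OF A.xR]]
      by auto
    obtain i where "coeff q i \<in> A" "coeff q i \<notin> B.M" using unit_coeff pq by blast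
    then have qi: "coeff q i \<noteq> 0" "inverse (coeff q i) \<in> A"
      using A.unitD D by blast+
    have "f - inverse (coeff q i) * (x ^ k * coeff p i)
      = inverse (coeff q i) * (f * coeff q i - x ^ k * coeff p i)"
      using qi by (simp add: field_simps)
    also have "\<dots> \<in> span2 B x y" using * qi D by (intro S(8)) auto
    finally show ?thesis
      using qi pq by (intro bexI[of _ "inverse (coeff q i) * (x ^ k * coeff p i)"])
        (auto intro!: A.cl A.xR polys_coeff)
  qed
  have approx_pow: "\<exists>d\<in>A. f - d \<in> mpow B x y n" if "f \<in> B" for f n
  proof -
    have step: "\<exists>e\<in>A. h - e \<in> mpow B x y (Suc n)" if "h \<in> mpow B x y n" for h n
      using that
    proof (induction n arbitrary: h)
      case 0
      then obtain d where d: "d \<in> A" "h - d \<in> span2 B x y" using approx by auto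
      from d(2) obtain p q where "p \<in> B" "q \<in> B" "h - d = x * p + y * q" by (rule span2E)
      then have "h - d \<in> mpow B x y (Suc 0)" by auto
      with d show ?case by blast
    next
      case (Suc n)
      then obtain p q where pq: "p \<in> mpow B x y n" "q \<in> mpow B x y n" "h = x * p + y * q"
        using mpow_SucE by metis
      obtain c d where cd: "c \<in> A" "p - c \<in> mpow B x y (Suc n)" "d \<in> A" "q - d \<in> mpow B x y (Suc n)"
        using Suc.IH pq by meson
      have "h - (x * c + y * d) = x * (p - c) + y * (q - d)" unfolding pq by (simp add: algebra_simps)
      also have "\<dots> \<in> mpow B x y (Suc (Suc n))" using mpow_SucI cd by metis
      finally show ?case using cd A.xR A.yR by (intro bexI[of _ "x * c + y * d"]) (auto intro!: A.cl)
    qed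
    show ?thesis
    proof (induction n)
      case 0
      then show ?case using that A.cl by (intro bexI[of _ 0]) auto
    next
      case (Suc n)
      then obtain d where d: "d \<in> A" "f - d \<in> mpow B x y n" by blast
      from step[OF d(2)] obtain e where "e \<in> A" "f - d - e \<in> mpow B x y (Suc n)" by blast
      then show ?case using d by (intro bexI[of _ "d + e"]) (auto intro!: A.cl simp: diff_diff_eq)
    qed
  qed
  interpret E: regseq B x y
  proof unfold_locales
    fix c d assume *: "c \<in> B" "d \<in> B" "x * c = y * d"
    then have "a * c = b * d" unfolding ab_eq using gi by (simp add: field_simps)
    then obtain e where "e \<in> B" "d = a * e" using C.reg * by blast
    then show "\<exists>c\<in>B. d = x * c" unfolding ab_eq using gi
      by (intro bexI[of _ "inverse g * e"]) (auto intro!: B.cl)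
  qed (use xB yB A.x0 A.y0 in auto)
  \<comment> \<open>An element of A in the n-th power of (x, y) B has order at least n already in A,
    since its initial form keeps a coefficient that is a unit of B.\<close>
  have contract: "e \<in> A.\<mu> n" if eA: "e \<in> A" "e \<in> mpow B x y n" for e n
  proof (cases "e = 0")
    case False
    obtain r p where p: "p \<in> A.RT" "p \<notin> A.MT" "degree p \<le> r" "e = x ^ r * poly p A.t"
      using A.order_rep[OF eA(1) False] by blast
    have "n \<le> r"
    proof (rule ccontr)
      assume "\<not> n \<le> r"
      then obtain k where k: "n = r + Suc k" using less_iff_Suc_add by (metis not_le add_Suc_right)
      from that(2) obtain q where q: "q \<in> B.RT" "e = x ^ n * poly q A.t" using E.mpow_poly by blast
      then have "x ^ r * poly p A.t = x ^ r * (x ^ Suc k * poly q A.t)"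
        using p(4) unfolding k by (simp add: power_add mult_ac)
      \<comment> \<open>With f = 0 and q = 0, \<open>key\<close> becomes plain quasi-regularity of
        a, b.\<close>
      then have "0 * poly 0 A.t = poly (p - smult (x ^ Suc k) q) A.t" using A.x0 by simp
      then have *: "0 * coeff 0 i - coeff (p - smult (x ^ Suc k) q) i \<in> B.M" for i
        using key[of 0 0 "p - smult (x ^ Suc k) q" i] span_M q p AB B.cl(7)[OF xB] B.cl(1)
        by (auto simp del: power_Suc intro!: B.RT_cl)
      obtain i where i: "coeff p i \<notin> B.M" using unit_coeff p by blast
      have "x ^ Suc k * coeff q i \<in> B.M"
        using B.nonunits_mult(1)[OF xkM polys_coeff[OF q(1)]] .
      then have "coeff p i \<in> B.M"
        using B.nonunits_diff[OF _ *[of i], of "x ^ Suc k * coeff q i"] by simp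
      with i show False by simp
    qed
    then show ?thesis using A.mpow_antimono A.mpow_poly p by blast
  qed (simp add: A.mpow_cl)
  have "f \<in> A" if fB: "f \<in> B" for f
  proof -
    obtain a0 b0 N where r: "a0 \<in> A" "b0 \<in> A" "b0 \<noteq> 0" "f = a0 / b0"
      "x ^ N \<in> span2 A a0 b0" "y ^ N \<in> span2 A a0 b0" using A.coprime_rep[of f] by blast
    \<comment> \<open>J = m a0 + b0 A, where m is the maximal ideal of A. One extra factor x or y
      puts the coefficient of a0 into m, and the pigeonhole of \<open>mpow_subset_ideal\<close>
      doubles the exponent, whence 2 (N + 1). Once a0 - b0 d is in J, a0 (1 - p) is a multiple of b0
      with 1 - p a unit, so f is in A.\<close>
    define J where "J = {a0 * p + b0 * q | p q. p \<in> A.M \<and> q \<in> A}"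
    have JI: "a0 * p + b0 * q \<in> J" if "p \<in> A.M" "q \<in> A" for p q using that by (auto simp: J_def)
    have "A.\<mu> (Suc N + Suc N) \<subseteq> J"
    proof (rule A.mpow_subset_ideal)
      fix c d
      {
        assume "c \<in> J" "d \<in> J"
        then obtain p q p' q' where *: "c = a0 * p + b0 * q" "d = a0 * p' + b0 * q'"
          "p \<in> A.M" "q \<in> A" "p' \<in> A.M" "q' \<in> A" unfolding J_def by blast
        have "c + d = a0 * (p + p') + b0 * (q + q')" unfolding * by (simp add: algebra_simps)
        then show "c + d \<in> J" using * by (auto intro!: JI A.nonunits_add A.cl)
      next
        assume "c \<in> J" "d \<in> A"
        then obtain p q where *: "c = a0 * p + b0 * q" "p \<in> A.M" "q \<in> A" unfolding J_def by blast
        have "c * d = a0 * (p * d) + b0 * (q * d)" unfolding * by (simp add: algebra_simps)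
        then show "c * d \<in> J" using * \<open>d \<in> A\<close> by (auto intro!: JI A.nonunits_mult(1) A.cl)
      }
      have *: "w * c \<in> J" if "w \<in> A.M" "c \<in> span2 A a0 b0" for w c
      proof -
        from that(2) obtain p q where "p \<in> A" "q \<in> A" "c = a0 * p + b0 * q" by (rule span2E)
        then have "w * c = a0 * (w * p) + b0 * (w * q)" by (simp add: algebra_simps)
        then show ?thesis using that(1) \<open>p \<in> A\<close> \<open>q \<in> A\<close> A.nonunits_sub
          by (auto intro!: JI A.nonunits_mult(1) A.cl)
      qed
      show "x ^ Suc N \<in> J" "y ^ Suc N \<in> J" using *[OF A.xM r(5)] *[OF A.yM r(6)] by auto
    qed
    moreover obtain d where d: "d \<in> A" "f - d \<in> mpow B x y (Suc N + Suc N)"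
      using approx_pow[OF fB] by blast
    have "a0 - b0 * d = b0 * (f - d)" using r by (simp add: field_simps)
    moreover have "b0 * (f - d) \<in> mpow B x y (Suc N + Suc N)"
      by (rule E.mpow_cl(5)[OF d(2)]) (use r D in auto)
    moreover have "a0 - b0 * d \<in> A" using r d by (auto intro!: A.cl)
    ultimately have "a0 - b0 * d \<in> J"
      using contract by (metis subsetD)
    then obtain p q where pq: "p \<in> A.M" "q \<in> A" "a0 - b0 * d = a0 * p + b0 * q" by (auto simp: J_def)
    then have "1 - p \<notin> A.M" "1 - p \<in> A"
      using A.unit_diff_nonunit[OF A.cl(2) A.one_unit] A.nonunits_sub by (auto intro: A.cl)
    then have u: "1 - p \<noteq> 0" "inverse (1 - p) \<in> A" using A.unitD[of "1 - p"] by blast+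
    have "a0 * (1 - p) = b0 * (d + q)" using pq(3) by (simp add: algebra_simps)
    then have "b0 * (f * (1 - p)) = b0 * (d + q)" using r by simp
    then have "f * (1 - p) = d + q" using r mult_left_cancel by blast
    then have "f = (d + q) * inverse (1 - p)" using u by (metis mult.assoc mult.right_neutral right_inverse)
    then show "f \<in> A" using u d pq by (auto intro!: A.cl)
  qed
  then show False using ne D by auto
qed

section \<open>Quadratic transforms\<close>

text \<open>Modulo x the element is a unit times y^j, so its order is at most j. This bounds the
  order of strict transforms from above.\<close>

lemma (in regseq) unit_pow_notin_mpow:
  assumes "c \<in> R" "c \<notin> M" "e \<in> R" "x \<in> M" "y \<in> M"
  shows "c * y ^ j + x * e \<notin> \<mu> (Suc j)"
proof
  assume "c * y ^ j + x * e \<in> \<mu> (Suc j)"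
  then obtain b d where b: "b \<in> \<mu> j" "d \<in> R" "c * y ^ j + x * e = x * b + y ^ Suc j * d"
    using mpow_decomp by blast
  then have bR: "b \<in> R" using mpow_cl(1) by blast
  have "y ^ j * (c - y * d) = x * (b - e)" using b(3) by (simp add: algebra_simps)
  moreover have "c - y * d \<in> R" "b - e \<in> R" using assms b bR yR by (auto intro!: cl)
  ultimately obtain c' where "c' \<in> R" "c - y * d = x * c'"
    using regseq.reg_pow[OF regseq_sym] by blast
  then have "c = y * d + x * c'" by (simp add: algebra_simps)
  then have "c \<in> M" using assms(4,5) b(2) \<open>c' \<in> R\<close> by (auto intro!: nonunits_add nonunits_mult(1))
  then show False using assms by simp
qed

text \<open>Dividing a pair by a common power of x keeps it primary: the relation for x^n loses the
  factor x^r, which leaves a power of x in the new ideal, and a' = c w^j + x e with c a unit makes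
  w^j a multiple of x modulo a'.\<close>

lemma coprime_transform:
  assumes "quasi_local B" "A \<subseteq> B" "x \<in> B" "w \<in> B" "x \<noteq> 0"
    and n: "x ^ n \<in> span2 A a b" and a: "a = x ^ r * a'" and b: "b = x ^ r * b'"
    and a'B: "a' \<in> B" and b'B: "b' \<in> B"
    and F: "a' = c * w ^ j + x * e" "c \<in> B" "c \<notin> nonunits B" "e \<in> B"
  shows "\<exists>N. x ^ N \<in> span2 B a' b' \<and> w ^ N \<in> span2 B a' b'"
proof -
  interpret B: quasi_local B by fact
  note I = B.span2_cl[OF a'B b'B]
  obtain u v where uv: "u \<in> A" "v \<in> A" "x ^ n = a * u + b * v" using n by (rule span2E)
  have uvI: "a' * u + b' * v \<in> span2 B a' b'" using uv assms(2) by (auto intro!: span2I)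
  have eq: "x ^ n = x ^ r * (a' * u + b' * v)" unfolding uv a b by (simp add: algebra_simps)
  have "\<exists>k. x ^ k \<in> span2 B a' b'"
  proof (cases "r \<le> n")
    case True
    then have "x ^ n = x ^ r * x ^ (n - r)" by (simp flip: power_add)
    then have "x ^ (n - r) = a' * u + b' * v" using eq assms(5) by simp
    then show ?thesis using uvI by metis
  next
    case False
    then have "x ^ r = x ^ n * x ^ (r - n)" by (simp flip: power_add)
    then have "x ^ n * 1 = x ^ n * (x ^ (r - n) * (a' * u + b' * v))"
      using eq by (metis mult.assoc mult.right_neutral)
    then have "1 = x ^ (r - n) * (a' * u + b' * v)" using assms(5) mult_left_cancel power_not_zero by blast
    moreover have "x ^ (r - n) * (a' * u + b' * v) \<in> span2 B a' b'"
      by (rule I(8)[OF uvI]) (auto intro!: B.cl assms)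
    ultimately have "x ^ 0 \<in> span2 B a' b'" by simp
    then show ?thesis by blast
  qed
  then obtain k where k: "x ^ k \<in> span2 B a' b'" by blast
  have c: "c \<noteq> 0" "inverse c \<in> B" using B.unitD F by auto
  then have wj: "w ^ j = a' * inverse c + x * (- (inverse c * e))" unfolding F by (simp add: algebra_simps)
  define \<gamma> where "\<gamma> = - (inverse c * e)"
  have \<gamma>: "\<gamma> \<in> B" using c F by (auto simp: \<gamma>_def intro!: B.cl)
  have "\<exists>p\<in>B. (w ^ j) ^ k = a' * p + x ^ k * \<gamma> ^ k" for k
  proof (induction k)
    case 0
    then show ?case using B.cl by (intro bexI[of _ 0]) auto
  next
    case (Suc k)
    then obtain p where p: "p \<in> B" "(w ^ j) ^ k = a' * p + x ^ k * \<gamma> ^ k" by blast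
    have "(w ^ j) ^ Suc k = a' * (inverse c * (w ^ j) ^ k) + x * \<gamma> * (a' * p + x ^ k * \<gamma> ^ k)"
      unfolding p(2)[symmetric] power_Suc by (subst wj) (simp add: \<gamma>_def algebra_simps)
    also have "\<dots> = a' * (inverse c * (w ^ j) ^ k + x * \<gamma> * p) + x ^ Suc k * \<gamma> ^ Suc k"
      by (simp add: algebra_simps)
    finally show ?case
      using c \<gamma> assms(3,4) p(1) by (intro bexI[of _ "inverse c * (w ^ j) ^ k + x * \<gamma> * p"] B.cl)
  qed
  then obtain p where p: "p \<in> B" "(w ^ j) ^ k = a' * p + x ^ k * \<gamma> ^ k" by blast
  have "(w ^ j) ^ k \<in> span2 B a' b'"
    unfolding p by (intro I(5) I(7)) (use I k p \<gamma> in \<open>auto intro!: B.cl\<close>)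
  then have "w ^ (j * k) \<in> span2 B a' b'" by (simp add: power_mult)
  then have "w ^ (j * k + k) \<in> span2 B a' b'" "x ^ (j * k + k) \<in> span2 B a' b'"
    unfolding power_add using I(7)[of "w ^ (j * k)" "w ^ k"] I(8)[OF k, of "x ^ (j * k)"] assms(3,4)
    by (auto intro!: B.cl)
  then show ?thesis by blast
qed

text \<open>The localisation of A[t] at the centre of S. For t = y / x it is the local ring of the
  point of the blow-up of A on which S is centred.\<close>

definition qtransform :: "'a::field set \<Rightarrow> 'a \<Rightarrow> 'a set \<Rightarrow> 'a set" where
  "qtransform A t S = {poly p t / poly q t | p q. p \<in> polys A \<and> q \<in> polys A \<and> poly q t \<notin> nonunits S}"

text \<open>The last clause describes the exceptional curve x = 0: a polynomial with nonzero
  reduction vanishes at the point to an order j not exceeding its degree. Hence orders of strict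
  transforms do not increase.\<close>

definition is_qtransform :: "'a::field set \<Rightarrow> 'a \<Rightarrow> 'a \<Rightarrow> 'a set \<Rightarrow> 'a \<Rightarrow> bool" where
  "is_qtransform A x y B w \<longleftrightarrow> regular_pair A x y \<and> regular_pair B x w \<and> dominates B A \<and> y / x \<in> B \<and>
    (\<forall>p\<in>polys A. p \<notin> polys (nonunits A) \<longrightarrow>
      (\<exists>j\<le>degree p. \<exists>c\<in>B. \<exists>e\<in>B. c \<notin> nonunits B \<and> poly p (y / x) = c * w ^ j + x * e))"

text \<open>A monic lift of the minimal polynomial, over the residue field of A, of the residue of t
  in that of S.\<close>

definition minimal_poly :: "'a::field set \<Rightarrow> 'a \<Rightarrow> 'a set \<Rightarrow> 'a poly \<Rightarrow> bool" where
  "minimal_poly A t S P \<longleftrightarrow> P \<in> polys A \<and> lead_coeff P = 1 \<and> poly P t \<in> nonunits S \<and>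
    (\<forall>Q\<in>polys A. poly Q t \<in> nonunits S \<longrightarrow> degree Q < degree P \<longrightarrow> Q \<in> polys (nonunits A))"

section \<open>The quadratic transform along a dominating local ring\<close>

locale qt = regular_pair +
  fixes S P
  assumes qlS: "quasi_local S" and domS: "dominates S R" and tS: "y / x \<in> S"
    and minP: "minimal_poly R (y / x) S P"
begin

sublocale S: quasi_local S by (rule qlS)

lemmas DS = dominatesD[OF domS]

lemma P: "P \<in> RT" "lead_coeff P = 1" "poly P t \<in> S.M"
  "\<And>Q. Q \<in> RT \<Longrightarrow> poly Q t \<in> S.M \<Longrightarrow> degree Q < degree P \<Longrightarrow> Q \<in> MT"
  using minP by (auto simp: minimal_poly_def)

lemma P_MT: "P \<notin> MT" using monic_not_MT P by blast

lemma degP: "degree P \<ge> 1"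
proof (rule ccontr)
  assume "\<not> ?thesis"
  then obtain c where "P = [:c:]" by (metis degree_0_id not_less_eq_eq le_zero_eq One_nat_def)
  then have "poly P t = 1" using P(2) by simp
  then show False using P(3) S.one_unit by simp
qed

definition w where "w = poly P t"
definition T where "T = qtransform R t S"

lemma poly_S: "p \<in> RT \<Longrightarrow> poly p t \<in> S"
  using S.poly_in[OF _ tS] polys_mono[OF DS(1)] by blast

lemma MT_S: "p \<in> MT \<Longrightarrow> poly p t \<in> S.M"
  using S.poly_nonunit[OF _ tS] polys_mono[of M S.M] DS(3) by blast

lemma T_I: "p \<in> RT \<Longrightarrow> q \<in> RT \<Longrightarrow> poly q t \<notin> S.M \<Longrightarrow> poly p t / poly q t \<in> T"
  by (auto simp: T_def qtransform_def)

lemma T_E: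
  assumes "a \<in> T"
  obtains p q where "p \<in> RT" "q \<in> RT" "poly q t \<notin> S.M" "a = poly p t / poly q t" "poly q t \<noteq> 0"
    "inverse (poly q t) \<in> S"
proof -
  obtain p q where "p \<in> RT" "q \<in> RT" "poly q t \<notin> S.M" "a = poly p t / poly q t"
    using assms by (auto simp: T_def qtransform_def)
  moreover from this have "poly q t \<noteq> 0" "inverse (poly q t) \<in> S" using S.unitD poly_S by auto
  ultimately show ?thesis using that by blast
qed

lemma poly_T: "p \<in> RT \<Longrightarrow> poly p t \<in> T"
  using T_I[of p 1] RT_cl S.one_unit by auto

lemma R_T: "a \<in> R \<Longrightarrow> a \<in> T"
  using poly_T[of "[:a:]"] by (auto intro: RT_cl)

lemma t_T: "t \<in> T"
  using poly_T[of "[:0, 1:]"] by (auto intro!: RT_cl cl)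

lemma w_T: "w \<in> T" using poly_T P by (simp add: w_def)

lemma T_S: "a \<in> T \<Longrightarrow> a \<in> S"
  by (erule T_E) (metis divide_inverse poly_S S.cl(4))

lemma subring_T: "subring T"
proof -
  have "a + b \<in> T \<and> a * b \<in> T" if ab: "a \<in> T" "b \<in> T" for a b
  proof -
    obtain p q where 1: "p \<in> RT" "q \<in> RT" "poly q t \<notin> S.M" "a = poly p t / poly q t" "poly q t \<noteq> 0"
      using T_E[OF ab(1)] by metis
    obtain p' q' where 2: "p' \<in> RT" "q' \<in> RT" "poly q' t \<notin> S.M" "b = poly p' t / poly q' t" "poly q' t \<noteq> 0"
      using T_E[OF ab(2)] by metis
    have qq: "poly (q * q') t \<notin> S.M" using S.units_mult[OF poly_S poly_S] 1 2 by auto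
    have "a + b = poly (p * q' + p' * q) t / poly (q * q') t" using 1 2 by (simp add: add_frac_eq)
    moreover have "a * b = poly (p * p') t / poly (q * q') t" using 1 2 by simp
    ultimately show ?thesis using qq 1 2 by (auto simp del: poly_mult poly_add intro!: T_I RT_cl)
  qed
  moreover have "- a \<in> T" if a: "a \<in> T" for a
  proof -
    obtain p q where 1: "p \<in> RT" "q \<in> RT" "poly q t \<notin> S.M" "a = poly p t / poly q t" "poly q t \<noteq> 0"
      using T_E[OF a] by metis
    then show ?thesis using T_I[of "- p" q] RT_cl by auto
  qed
  ultimately show ?thesis using R_T cl by (auto simp: subring_def)
qed

lemma nonunits_T: "nonunits T = T \<inter> S.M"
proof -
  have inv: "inverse a \<in> T" if a: "a \<in> T" "a \<notin> S.M" for a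
  proof -
    obtain p q where 1: "p \<in> RT" "q \<in> RT" "poly q t \<notin> S.M" "a = poly p t / poly q t" "poly q t \<noteq> 0"
      "inverse (poly q t) \<in> S"
      using T_E[OF a(1)] by metis
    have "poly p t \<notin> S.M"
    proof
      assume "poly p t \<in> S.M"
      then have "poly p t * inverse (poly q t) \<in> S.M" using 1 by (intro S.nonunits_mult(1))
      then show False using a 1 by (simp add: divide_inverse)
    qed
    then show ?thesis using T_I[of q p] 1 by simp
  qed
  show ?thesis
  proof (intro equalityI subsetI IntI)
    fix a assume "a \<in> nonunits T"
    then have a: "a \<in> T" "a = 0 \<or> inverse a \<notin> T" by (auto simp: nonunits_def)
    then show "a \<in> T" "a \<in> S.M" using inv S.zero_nonunit by blast+
  next
    fix a assume "a \<in> T \<inter> S.M"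
    then show "a \<in> nonunits T" using T_S[of "inverse a"] by (auto simp: nonunits_def)
  qed
qed

lemma quasi_local_T: "quasi_local T"
  by unfold_locales (use subring_T subringD(3) S.nonunits_add in \<open>auto simp: nonunits_T\<close>)

lemma dominates_ST: "dominates S T"
  using T_S by (auto simp: dominates_def nonunits_T)

lemma dominates_TR: "dominates T R"
  using R_T DS(3) nonunits_sub by (auto simp: dominates_def nonunits_T)

sublocale T: quasi_local T by (rule quasi_local_T)

lemma x_TM: "x \<in> T.M" and w_TM: "w \<in> T.M"
  using dominatesD(3)[OF dominates_TR] xM w_T P by (auto simp: nonunits_T w_def)

text \<open>Division by P leaves a remainder in \<open>MT\<close>, which is a multiple of x. Hence
  the centre of S on R[t] is generated by x and w; the falling degree of \<open>A\<close> feeds the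
  induction in \<open>poly_order\<close>.\<close>

lemma reduce:
  assumes "Q \<in> RT" "poly Q t \<in> S.M"
  shows "\<exists>A\<in>RT. \<exists>B\<in>RT. poly Q t = w * poly A t + x * poly B t \<and>
      (Q \<notin> MT \<longrightarrow> A \<notin> MT \<and> degree A < degree Q)"
proof -
  obtain A B where AB: "A \<in> RT" "B \<in> RT" "Q = A * P + B" "degree B < degree P"
    "degree A \<le> degree Q - degree P" "degree Q < degree P \<longrightarrow> A = 0"
    using monic_division[OF P(1,2) degP assms(1)] by blast
  have "poly B t = poly Q t - poly A t * poly P t" using AB by simp
  also have "\<dots> \<in> S.M" using assms(2) P(3) poly_S AB by (intro S.nonunits_diff S.nonunits_mult(2)) auto
  finally have B: "B \<in> MT" using P(4) AB by blast
  then obtain q where q: "q \<in> RT" "poly B t = x * poly q t" using MT_x by blast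
  have "A \<notin> MT \<and> degree A < degree Q" if "Q \<notin> MT"
  proof
    show A: "A \<notin> MT" using that AB B P(1) by (auto intro!: MT_cl(2) MT_cl(4))
    then have "degree Q \<ge> degree P" using AB MT_cl(1) by force
    then show "degree A < degree Q" using AB(5) degP by simp
  qed
  moreover have "poly Q t = w * poly A t + x * poly q t" using AB q by (simp add: w_def)
  ultimately show ?thesis using AB q by (intro bexI[of _ A] bexI[of _ q]) auto
qed

lemma T_span: "nonunits T = span2 T x w"
proof
  show "span2 T x w \<subseteq> nonunits T" by (rule T.span2_nonunits[OF x_TM w_TM])
  show "nonunits T \<subseteq> span2 T x w"
  proof
    fix a assume "a \<in> nonunits T"
    then have a: "a \<in> T" "a \<in> S.M" by (auto simp: nonunits_T)
    obtain p q where 1: "p \<in> RT" "q \<in> RT" "poly q t \<notin> S.M" "a = poly p t / poly q t" "poly q t \<noteq> 0"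
      using T_E[OF a(1)] by metis
    have "poly p t = a * poly q t" using 1 by simp
    then have "poly p t \<in> S.M" using S.nonunits_mult(1)[OF a(2) poly_S[OF 1(2)]] by simp
    then obtain A B where "A \<in> RT" "B \<in> RT" "poly p t = w * poly A t + x * poly B t"
      using reduce[OF 1(1)] by blast
    then have "a = x * (poly B t / poly q t) + w * (poly A t / poly q t)"
      using 1 by (simp add: add_divide_distrib)
    moreover have "x * (poly B t / poly q t) + w * (poly A t / poly q t) \<in> span2 T x w"
      using 1 \<open>A \<in> RT\<close> \<open>B \<in> RT\<close> by (intro span2I T_I)
    ultimately show "a \<in> span2 T x w" by metis
  qed
qed

lemma unit_T_MT: "q \<in> RT \<Longrightarrow> poly q t \<notin> S.M \<Longrightarrow> q \<notin> MT"
  using MT_S by blast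

text \<open>Modulo x the transform is a localisation of a polynomial ring over the residue field,
  and w is the nonzero class of P in it.\<close>

lemma regseq_T: "regseq T x w"
proof unfold_locales
  show "x \<in> T" "w \<in> T" "x \<noteq> 0" "w \<noteq> 0"
    using R_T xR w_T x0 poly_t_nonzero[OF P(1) P_MT] by (auto simp: w_def)
  fix c d assume cd: "c \<in> T" "d \<in> T" "x * c = w * d"
  obtain p q where 1: "p \<in> RT" "q \<in> RT" "poly q t \<notin> S.M" "c = poly p t / poly q t" "poly q t \<noteq> 0"
    using T_E[OF cd(1)] by metis
  obtain p' q' where 2: "p' \<in> RT" "q' \<in> RT" "poly q' t \<notin> S.M" "d = poly p' t / poly q' t" "poly q' t \<noteq> 0"
    using T_E[OF cd(2)] by metis
  have "poly (P * p' * q) t = x ^ Suc 0 * poly (p * q') t"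
    using cd(3) 1 2 by (simp add: w_def field_simps)
  then have "P * p' * q \<in> MT" by (rule poly_t_x[rotated 2]) (auto intro!: RT_cl 1 2 P)
  then have "P * p' \<in> MT" using MT_mult[OF RT_cl(6)[OF P(1) 2(1)] 1(2)] unit_T_MT 1 by blast
  then have "p' \<in> MT" using MT_mult[OF P(1) 2(1)] P_MT by blast
  then obtain p'' where "p'' \<in> RT" "poly p' t = x * poly p'' t" using MT_x by blast
  then show "\<exists>e\<in>T. d = x * e" using 2 T_I by (intro bexI[of _ "poly p'' t / poly q' t"]) auto
qed

text \<open>Each division by w lowers the degree of the remaining factor, so w splits off at most
  \<open>degree p\<close> times before that factor becomes a unit.\<close>

lemma poly_order:
  "p \<in> RT \<Longrightarrow> p \<notin> MT \<Longrightarrow> \<exists>j\<le>degree p. \<exists>c\<in>T. \<exists>e\<in>T. c \<notin> T.M \<and> poly p t = c * w ^ j + x * e"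
proof (induction "degree p" arbitrary: p rule: less_induct)
  case less
  show ?case
  proof (cases "poly p t \<in> S.M")
    case False
    then show ?thesis using less.prems poly_T T.cl
      by (intro exI[of _ 0] conjI bexI[of _ "poly p t"] bexI[of _ 0]) (auto simp: nonunits_T)
  next
    case True
    then obtain A B where AB: "A \<in> RT" "B \<in> RT" "poly p t = w * poly A t + x * poly B t"
      "A \<notin> MT" "degree A < degree p" using reduce less.prems by blast
    then obtain j c e where *: "j \<le> degree A" "c \<in> T" "e \<in> T" "c \<notin> T.M" "poly A t = c * w ^ j + x * e"
      using less.hyps by blast
    have "poly p t = c * w ^ Suc j + x * (w * e + poly B t)"
      unfolding AB(3) *(5) by (simp add: algebra_simps)
    moreover have "w * e + poly B t \<in> T" using w_T * AB poly_T by (auto intro!: T.cl)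
    ultimately show ?thesis using * AB(5) by (intro exI[of _ "Suc j"]) auto
  qed
qed

theorem regular_pair_T: "regular_pair T x w"
proof -
  interpret W: regseq T x w by (rule regseq_T)
  show ?thesis
  proof unfold_locales
    show "nonunits T = span2 T x w" by (rule T_span)
  next
    fix a assume a: "a \<in> T" "a \<noteq> 0"
    obtain p q where 1: "p \<in> RT" "q \<in> RT" "poly q t \<notin> S.M" "a = poly p t / poly q t" "poly q t \<noteq> 0"
      using T_E[OF a(1)] by metis
    \<comment> \<open>The factor x^(degree p) clears the denominators of p(t), so that the order can
      be taken in R; the power x^r is removed again by \<open>mpow_xpow_cancel\<close>.\<close>
    have ne: "x ^ degree p * poly p t \<noteq> 0" using a(2) 1 x0 by auto
    have "x ^ degree p * poly p t \<in> R" using mpow_poly[of _ "degree p"] mpow_cl(1)[of "degree p"] 1(1) by blast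
    then obtain r p' where p': "p' \<in> RT" "p' \<notin> MT" "x ^ degree p * poly p t = x ^ r * poly p' t"
      using order_rep ne by metis
    obtain j c e where j: "c \<in> T" "e \<in> T" "c \<notin> T.M" "poly p' t = c * w ^ j + x * e"
      using poly_order p' by blast
    have "a \<notin> mpow T x w (Suc j + r)"
    proof
      assume "a \<in> mpow T x w (Suc j + r)"
      then have "(x ^ degree p * poly q t) * a \<in> mpow T x w (Suc j + r)"
        using 1 poly_T R_T xR by (intro W.mpow_cl(5)) (auto intro!: T.cl)
      moreover have "(x ^ degree p * poly q t) * a = x ^ r * poly p' t" using 1 p'(3) by simp
      ultimately have "poly p' t \<in> mpow T x w (Suc j)"
        using W.mpow_xpow_cancel[OF poly_T[OF p'(1)]] by metis
      then show False unfolding j(4) using W.unit_pow_notin_mpow j x_TM w_TM by blast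
    qed
    then show "\<exists>n. a \<notin> mpow T x w n" by blast
  next
    fix z
    obtain a b n where ab: "a \<in> R" "b \<in> R" "b \<noteq> 0" "z = a / b" "x ^ n \<in> span2 R a b"
      using coprime_rep[of z] by blast
    show "\<exists>a\<in>T. \<exists>b\<in>T. \<exists>n. b \<noteq> 0 \<and> z = a / b \<and> x ^ n \<in> span2 T a b \<and> w ^ n \<in> span2 T a b"
    proof (cases "a = 0")
      case True
      then show ?thesis using T.span2_cl(4)[of 0 1] T.cl ab
        by (intro bexI[of _ 0] bexI[of _ 1] exI[of _ 0]) auto
    next
      case False
      obtain r p where p: "p \<in> RT" "p \<notin> MT" "a = x ^ r * poly p t" using order_rep[OF ab(1) False] by metis
      obtain s q where q: "q \<in> RT" "q \<notin> MT" "b = x ^ s * poly q t" using order_rep[OF ab(2,3)] by metis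
      have RT: "R \<subseteq> T" using R_T by blast
      have xk: "x ^ k * poly p t \<in> T" if "p \<in> RT" for p k
        using that poly_T R_T xR by (auto intro!: T.cl)
      \<comment> \<open>Numerator and denominator are divided by the smaller of the two powers of x;
        the one that loses all of it has the shape required by
        \<open>coprime_transform\<close>.\<close>
      show ?thesis
      proof (cases "r \<le> s")
        case True
        define b' where "b' = x ^ (s - r) * poly q t"
        have b': "b = x ^ r * b'" using True q by (simp add: b'_def mult.assoc[symmetric] flip: power_add)
        obtain j c e where j: "c \<in> T" "e \<in> T" "c \<notin> T.M" "poly p t = c * w ^ j + x * e"
          using poly_order p by blast
        have "\<exists>N. x ^ N \<in> span2 T (poly p t) b' \<and> w ^ N \<in> span2 T (poly p t) b'"
          by (rule coprime_transform[OF quasi_local_T RT _ w_T x0 ab(5) p(3) b' poly_T[OF p(1)] _ j(4) j(1,3,2)])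
            (use R_T xR xk q in \<open>auto simp: b'_def\<close>)
        moreover have "b' \<noteq> 0" "z = poly p t / b'" using ab b' p x0 by auto
        moreover have "b' \<in> T" unfolding b'_def by (rule xk) fact
        ultimately show ?thesis using poly_T[OF p(1)] by blast
      next
        case False
        define a' where "a' = x ^ (r - s) * poly p t"
        have a': "a = x ^ s * a'" using False p by (simp add: a'_def mult.assoc[symmetric] flip: power_add)
        obtain j c e where j: "c \<in> T" "e \<in> T" "c \<notin> T.M" "poly q t = c * w ^ j + x * e"
          using poly_order q by blast
        have "\<exists>N. x ^ N \<in> span2 T (poly q t) a' \<and> w ^ N \<in> span2 T (poly q t) a'"
          by (rule coprime_transform[OF quasi_local_T RT _ w_T x0 ab(5)[unfolded span2_commute[of R a b]] q(3) a' poly_T[OF q(1)] _ j(4) j(1,3,2)])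
            (use R_T xR xk p in \<open>auto simp: a'_def\<close>)
        then have "\<exists>N. x ^ N \<in> span2 T a' (poly q t) \<and> w ^ N \<in> span2 T a' (poly q t)"
          by (simp add: span2_commute)
        moreover have "poly q t \<noteq> 0" "z = a' / poly q t" using ab a' q x0 by auto
        moreover have "a' \<in> T" unfolding a'_def by (rule xk) fact
        ultimately show ?thesis using poly_T[OF q(1)] by blast
      qed
    qed
  qed
qed

theorem is_qtransform_T: "is_qtransform R x y T w"
  unfolding is_qtransform_def
  using regular_pair_T regular_pair_axioms dominates_TR t_T poly_order by blast

end

section \<open>Infinite chains of quadratic transforms\<close>

text \<open>\<open>x'\<close> is the old parameter that generates the extended maximal ideal in B; a
  chain may change the chart at every step.\<close>

definition qstep :: "'a::field set \<Rightarrow> 'a \<Rightarrow> 'a \<Rightarrow> 'a set \<Rightarrow> 'a \<Rightarrow> 'a \<Rightarrow> bool" where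
  "qstep A x y B x' w \<longleftrightarrow> x' = x \<and> is_qtransform A x y B w \<or> x' = y \<and> is_qtransform A y x B w"

lemma is_qtransformD:
  assumes "is_qtransform A x y B w"
  shows "regular_pair A x y" "regular_pair B x w" "dominates B A" "y / x \<in> B"
    "\<And>p. p \<in> polys A \<Longrightarrow> p \<notin> polys (nonunits A) \<Longrightarrow>
      \<exists>j\<le>degree p. \<exists>c\<in>B. \<exists>e\<in>B. c \<notin> nonunits B \<and> poly p (y / x) = c * w ^ j + x * e"
  using assms by (auto simp: is_qtransform_def)

lemma qtransform_mpow:
  assumes q: "is_qtransform A x y B w" and a: "a \<in> mpow A x y r"
  shows "\<exists>a'\<in>B. a = x ^ r * a'"
proof -
  note Q = is_qtransformD[OF q]
  interpret A: regular_pair A x y by (rule Q)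
  interpret B: regular_pair B x w by (rule Q)
  obtain p where "p \<in> A.RT" "a = x ^ r * poly p (y / x)" using a A.mpow_poly by blast
  then show ?thesis using B.poly_in[OF _ Q(4)] polys_mono[OF dominatesD(1)[OF Q(3)]] by blast
qed

text \<open>Because r is the exact order of a, the polynomial representing a has nonzero reduction;
  so its transform a' vanishes on the exceptional curve to an order j at most r.\<close>

lemma qtransform_order:
  assumes q: "is_qtransform A x y B w" and a: "a \<in> mpow A x y r" "a \<notin> mpow A x y (Suc r)"
    and b: "b \<in> mpow A x y r" and n: "x ^ n \<in> span2 A a b"
  shows "\<exists>a'\<in>B. \<exists>b'\<in>B. a = x ^ r * a' \<and> b = x ^ r * b' \<and>
    (\<exists>j\<le>r. \<exists>c\<in>B. \<exists>e\<in>B. c \<notin> nonunits B \<and> a' = c * w ^ j + x * e) \<and>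
    (\<exists>N. x ^ N \<in> span2 B a' b' \<and> w ^ N \<in> span2 B a' b')"
proof -
  note Q = is_qtransformD[OF q]
  interpret A: regular_pair A x y by (rule Q)
  interpret B: regular_pair B x w by (rule Q)
  obtain p where p: "p \<in> A.RT" "degree p \<le> r" "a = x ^ r * poly p (y / x)" using a A.mpow_poly by blast
  have "p \<notin> A.MT"
  proof
    assume "p \<in> A.MT"
    then obtain p' where p': "p' \<in> A.RT" "degree p' \<le> Suc (degree p)" "poly p (y / x) = x * poly p' (y / x)"
      using A.MT_x by blast
    then have "a = x ^ Suc r * poly p' (y / x)" "degree p' \<le> Suc r" using p by auto
    then show False using a(2) A.mpow_poly[of a "Suc r"] p'(1) by blast
  qed
  then obtain j c e where j: "j \<le> degree p" "c \<in> B" "e \<in> B" "c \<notin> nonunits B"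
    "poly p (y / x) = c * w ^ j + x * e" using Q(5) p by blast
  obtain b' where b': "b' \<in> B" "b = x ^ r * b'" using qtransform_mpow[OF q b] by blast
  have pB: "poly p (y / x) \<in> B"
    using B.poly_in[OF _ Q(4)] polys_mono[OF dominatesD(1)[OF Q(3)]] p by blast
  have "\<exists>N. x ^ N \<in> span2 B (poly p (y / x)) b' \<and> w ^ N \<in> span2 B (poly p (y / x)) b'"
    by (rule coprime_transform[OF B.quasi_local_axioms dominatesD(1)[OF Q(3)] B.xR B.yR B.x0 n p(3)
          b'(2) pB b'(1) j(5,2,4,3)])
  moreover have "j \<le> r" using j p by simp
  ultimately show ?thesis
    using pB b' p(3) j by (intro bexI[of _ "poly p (y / x)"] bexI[of _ b']) blast+
qed

lemma qstep_regular:
  assumes "qstep A x y B x' w"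
  shows "regular_pair A x y" "regular_pair B x' w" "dominates B A" "x' \<in> nonunits A"
proof -
  show "regular_pair A x y" "regular_pair B x' w" "dominates B A"
    using assms by (auto simp: qstep_def is_qtransform_def dest: regular_pair.regular_pair_sym)
  then interpret regular_pair A x y by simp
  show "x' \<in> nonunits A" using assms xM yM by (auto simp: qstep_def)
qed

lemma qstep_order:
  assumes q: "qstep A x y B x' w" and a: "a \<in> mpow A x y r" "a \<notin> mpow A x y (Suc r)"
    and b: "b \<in> mpow A x y r" and n: "x ^ n \<in> span2 A a b" "y ^ n \<in> span2 A a b"
  obtains a' b' j c e N where "a' \<in> B" "b' \<in> B" "a = x' ^ r * a'" "b = x' ^ r * b'" "j \<le> r"
    "c \<in> B" "e \<in> B" "c \<notin> nonunits B" "a' = c * w ^ j + x' * e"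
    "x' ^ N \<in> span2 B a' b'" "w ^ N \<in> span2 B a' b'"
proof -
  have "\<exists>a'\<in>B. \<exists>b'\<in>B. a = x' ^ r * a' \<and> b = x' ^ r * b' \<and>
    (\<exists>j\<le>r. \<exists>c\<in>B. \<exists>e\<in>B. c \<notin> nonunits B \<and> a' = c * w ^ j + x' * e) \<and>
    (\<exists>N. x' ^ N \<in> span2 B a' b' \<and> w ^ N \<in> span2 B a' b')"
    using q unfolding qstep_def
  proof (elim disjE conjE)
    assume "x' = x" "is_qtransform A x y B w"
    then show ?thesis using qtransform_order a b n by blast
  next
    assume "x' = y" "is_qtransform A y x B w"
    moreover note a[unfolded mpow_commute[of A x y]] b[unfolded mpow_commute[of A x y]]
    ultimately show ?thesis using qtransform_order n(2) by blast
  qed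
  then show ?thesis using that by blast
qed

text \<open>Write \<open>z = a / b\<close> with \<open>(a, b)\<close> primary. The order of a strict transform does not
  increase, so it is eventually a constant \<open>r\<close>. If \<open>r > 0\<close>, then from this stage on one and the
  same \<open>X\<close> generates the extended maximal ideal at every step, and arbitrarily high powers of \<open>X\<close>
  divide \<open>a\<close> and \<open>b\<close>; but some power of \<open>X\<close> lies in \<open>(a, b)\<close>.\<close>

theorem qstep_chain_valuation:
  fixes A :: "nat \<Rightarrow> 'a::field set" and X Y :: "nat \<Rightarrow> 'a"
  assumes step: "\<And>i. qstep (A i) (X i) (Y i) (A (Suc i)) (X (Suc i)) (Y (Suc i))" and z: "z \<noteq> 0"
  shows "\<exists>i. z \<in> A i \<or> inverse z \<in> A i"
proof (rule ccontr)
  assume no: "\<not> ?thesis"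
  have rp: "regular_pair (A i) (X i) (Y i)" for i using qstep_regular[OF step] by blast
  have dom: "dominates (A (Suc i)) (A i)" for i using qstep_regular[OF step] by blast
  have mono: "A i \<subseteq> A j" and Mmono: "nonunits (A i) \<subseteq> nonunits (A j)" if "i \<le> j" for i j
    using lift_Suc_mono_le[of A, OF _ that] lift_Suc_mono_le[of "\<lambda>i. nonunits (A i)", OF _ that] dom
    unfolding dominates_def by blast+
  define C where "C z' i a b \<longleftrightarrow> a \<in> A i \<and> b \<in> A i \<and> a \<noteq> 0 \<and> b \<noteq> 0 \<and> z' = a / b \<and>
    (\<exists>n. X i ^ n \<in> span2 (A i) a b \<and> Y i ^ n \<in> span2 (A i) a b)" for z' i a b
  have C_swap: "C (inverse z') i b a" if "C z' i a b" for z' i a b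
    using that span2_commute[of "A i" a b] unfolding C_def by auto
  \<comment> \<open>z and its inverse are treated together, so that minimality of r applies to
    numerators and denominators alike.\<close>
  define Z where "Z = {z, inverse z}"
  have Z_inv: "inverse z' \<in> Z" if "z' \<in> Z" for z' using that by (auto simp: Z_def)
  have Z_no: "z' \<notin> A i" if "z' \<in> Z" for z' i using that no by (auto simp: Z_def)
  have C_M1: "b \<in> nonunits (A i)" if "C z' i a b" "z' \<in> Z" for z' i a b
  proof (rule ccontr)
    interpret regular_pair "A i" "X i" "Y i" by (rule rp)
    assume "b \<notin> nonunits (A i)"
    then have "a * inverse b \<in> A i" using that unitD[of b] unfolding C_def by (auto intro!: cl)
    then show False using that Z_no[of z' i] by (auto simp: C_def divide_inverse)
  qed
  have C_M: "a \<in> nonunits (A i)" "b \<in> nonunits (A i)" if "C z' i a b" "z' \<in> Z" for z' i a b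
    using C_M1 that C_swap Z_inv by blast+
  define Pr where "Pr r \<longleftrightarrow> (\<exists>z'\<in>Z. \<exists>i a b. C z' i a b \<and> a \<notin> mpow (A i) (X i) (Y i) (Suc r))" for r
  have ex: "\<exists>r. Pr r"
  proof -
    interpret regular_pair "A 0" "X 0" "Y 0" by (rule rp)
    obtain a b n where ab: "a \<in> A 0" "b \<in> A 0" "b \<noteq> 0" "z = a / b"
      "X 0 ^ n \<in> span2 (A 0) a b" "Y 0 ^ n \<in> span2 (A 0) a b" using coprime_rep[of z] by blast
    then have "a \<noteq> 0" using z by auto
    then obtain r where "a \<notin> mpow (A 0) (X 0) (Y 0) r" using sep ab by blast
    then have "a \<notin> mpow (A 0) (X 0) (Y 0) (Suc r)" using mpow_Suc_subset by blast
    moreover have "C z 0 a b" using ab \<open>a \<noteq> 0\<close> by (auto simp: C_def)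
    ultimately show ?thesis unfolding Pr_def Z_def by blast
  qed
  \<comment> \<open>The least order attained, at any stage, by a numerator or denominator of a
    primary representation of z.\<close>
  define r where "r = (LEAST r. Pr r)"
  have Pr: "Pr r" unfolding r_def by (rule LeastI_ex[OF ex])
  have min1: "a \<in> mpow (A i) (X i) (Y i) r" if "C z' i a b" "z' \<in> Z" for z' i a b
  proof (cases r)
    case 0
    then show ?thesis using that by (simp add: C_def)
  next
    case (Suc k)
    then have "\<not> Pr k" using not_less_Least[of k Pr] r_def by auto
    then show ?thesis using that Suc unfolding Pr_def by blast
  qed
  have min: "a \<in> mpow (A i) (X i) (Y i) r" "b \<in> mpow (A i) (X i) (Y i) r"
    if "C z' i a b" "z' \<in> Z" for z' i a b
    using min1 that C_swap Z_inv by blast+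
  obtain z' i0 a0 b0 where zi: "z' \<in> Z" "C z' i0 a0 b0" "a0 \<notin> mpow (A i0) (X i0) (Y i0) (Suc r)"
    using Pr unfolding Pr_def by blast
  have "r \<noteq> 0"
  proof
    assume "r = 0"
    interpret regular_pair "A i0" "X i0" "Y i0" by (rule rp)
    have "a0 \<in> span2 (A i0) (X i0) (Y i0)" using C_M(1)[OF zi(2,1)] M_span by simp
    then have "a0 \<in> mpow (A i0) (X i0) (Y i0) (Suc 0)" by (auto simp: span2_def)
    then show False using zi(3) \<open>r = 0\<close> by simp
  qed
  then obtain r' where r': "r = Suc r'" by (cases r) auto
  \<comment> \<open>\<open>G\<close>: the numerator has the minimal order r. \<open>G'\<close>: it
    moreover contains Y^r with a unit coefficient, as it does after one transform.\<close>
  define G where "G i a b \<longleftrightarrow> C z' i a b \<and> a \<notin> mpow (A i) (X i) (Y i) (Suc r)" for i a b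
  define G' where "G' i a b \<longleftrightarrow> G i a b \<and>
    (\<exists>c\<in>A i. \<exists>e\<in>A i. c \<notin> nonunits (A i) \<and> a = c * Y i ^ r + X i * e)" for i a b
  have step1: "\<exists>a' b'. a = X (Suc i) ^ r * a' \<and> b = X (Suc i) ^ r * b' \<and> G' (Suc i) a' b'"
    if g: "G i a b" for i a b
  proof -
    have Cab: "C z' i a b" and a: "a \<notin> mpow (A i) (X i) (Y i) (Suc r)" using g by (auto simp: G_def)
    obtain n where n: "X i ^ n \<in> span2 (A i) a b" "Y i ^ n \<in> span2 (A i) a b" using Cab by (auto simp: C_def)
    interpret B: regular_pair "A (Suc i)" "X (Suc i)" "Y (Suc i)" by (rule rp)
    obtain a' b' j c e N where *: "a' \<in> A (Suc i)" "b' \<in> A (Suc i)" "a = X (Suc i) ^ r * a'"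
      "b = X (Suc i) ^ r * b'" "j \<le> r" "c \<in> A (Suc i)" "e \<in> A (Suc i)" "c \<notin> B.M"
      "a' = c * Y (Suc i) ^ j + X (Suc i) * e"
      "X (Suc i) ^ N \<in> span2 (A (Suc i)) a' b'" "Y (Suc i) ^ N \<in> span2 (A (Suc i)) a' b'"
      using qstep_order[OF step min(1)[OF Cab zi(1)] a min(2)[OF Cab zi(1)] n] by blast
    have C': "C z' (Suc i) a' b'" using * Cab unfolding C_def by auto
    have nj: "a' \<notin> mpow (A (Suc i)) (X (Suc i)) (Y (Suc i)) (Suc j)"
      unfolding *(9) by (rule B.unit_pow_notin_mpow) (use * B.xM B.yM in auto)
    \<comment> \<open>The transform has order at most j by its shape and at least r by
      minimality.\<close>
    have "j = r"
    proof (rule ccontr)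
      assume "j \<noteq> r"
      then have "Suc j \<le> r" using * by simp
      then show False using nj min(1)[OF C' zi(1)] B.mpow_antimono by blast
    qed
    then show ?thesis using * C' nj unfolding G'_def G_def by blast
  qed
  have step2: "X (Suc i) / X i \<in> A (Suc i)" if g: "G' i a b" for i a b
  proof -
    interpret A: regular_pair "A i" "X i" "Y i" by (rule rp)
    interpret B: regular_pair "A (Suc i)" "X (Suc i)" "Y (Suc i)" by (rule rp)
    consider "X (Suc i) = X i" | "X (Suc i) = Y i" "is_qtransform (A i) (Y i) (X i) (A (Suc i)) (Y (Suc i))"
      using step[of i] by (auto simp: qstep_def)
    then show ?thesis
    proof cases
      case 1
      then show ?thesis using A.x0 B.cl by simp
    next
      case 2
      obtain c e where ce: "c \<in> A i" "e \<in> A i" "c \<notin> A.M" "a = c * Y i ^ r + X i * e"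
        using g by (auto simp: G'_def)
      have Gab: "G i a b" and Cab: "C z' i a b" using g by (auto simp: G'_def G_def)
      have s: "X i / Y i \<in> A (Suc i)" using is_qtransformD(4)[OF 2(2)] .
      \<comment> \<open>If X / Y were a nonunit, dividing a = c Y^r + X e by Y^r would leave c plus
        a nonunit, a unit of the next ring, against \<open>C_M\<close>. So a change of chart
        replaces X only by an associate.\<close>
      have "X i / Y i \<notin> B.M"
      proof
        assume sM: "X i / Y i \<in> B.M"
        have "X i * e = a - c * Y i ^ r" using ce by simp
        also have "\<dots> \<in> A.\<mu> r" using min(1)[OF Cab zi(1)] A.mpow_gen(2) ce
          by (intro A.mpow_cl(6) A.mpow_cl(5)) auto
        finally have "e \<in> A.\<mu> r'" using A.mpow_x_cancel[OF ce(2)] r' by blast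
        then obtain e' where e': "e' \<in> A (Suc i)" "e = Y i ^ r' * e'"
          using qtransform_mpow[OF 2(2)] mpow_commute[of "A i"] by metis
        obtain a' b' where a': "a = Y i ^ r * a'" "G' (Suc i) a' b'" using step1[OF Gab] 2(1) by metis
        have "Y i ^ r * a' = Y i ^ r * (c + X i / Y i * e')"
          using a' ce(4) e' r' A.y0 by (simp add: field_simps)
        then have "a' = c + X i / Y i * e'" using A.y0 by simp
        moreover have "c + X i / Y i * e' \<notin> B.M"
        proof (rule B.unit_add_nonunit)
          show "c \<in> A (Suc i)" "c \<notin> B.M" using dominatesD[OF dom[of i]] ce by auto
          show "X i / Y i * e' \<in> B.M" using B.nonunits_mult(1)[OF sM e'(1)] .
        qed
        ultimately show False using C_M(1)[OF _ zi(1)] a' by (auto simp: G'_def G_def)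
      qed
      then have "inverse (X i / Y i) \<in> A (Suc i)" using B.unitD s by blast
      then show ?thesis using 2 by simp
    qed
  qed
  obtain a b where ab: "G' (Suc i0) a b" using step1[of i0 a0 b0] zi by (auto simp: G_def)
  define i1 where "i1 = Suc i0"
  interpret A1: regular_pair "A i1" "X i1" "Y i1" by (rule rp)
  \<comment> \<open>Each step divides a and b by the r-th power of the current X. That X is a
    multiple of \<open>X i1\<close> and r > 0, so one more factor \<open>X i1\<close> comes out of
    both.\<close>
  have "\<exists>a' b' e. G' (i1 + n) a' b' \<and> X (i1 + n) / X i1 \<in> A (i1 + n) \<and> e \<in> A (i1 + n) \<and>
    a = X i1 ^ n * e * a' \<and> b = X i1 ^ n * e * b'" for n
  proof (induction n)
    case 0
    then show ?case using ab A1.x0 A1.cl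
      by (intro exI[of _ a] exI[of _ b] exI[of _ 1]) (auto simp: i1_def)
  next
    case (Suc n)
    let ?i = "i1 + n"
    interpret B: regular_pair "A (Suc ?i)" "X (Suc ?i)" "Y (Suc ?i)" by (rule rp)
    obtain a' b' e where *: "G' ?i a' b'" "X ?i / X i1 \<in> A ?i" "e \<in> A ?i"
      "a = X i1 ^ n * e * a'" "b = X i1 ^ n * e * b'" using Suc by blast
    obtain a'' b'' where 2: "a' = X (Suc ?i) ^ r * a''" "b' = X (Suc ?i) ^ r * b''" "G' (Suc ?i) a'' b''"
      using step1 *(1) unfolding G'_def by blast
    define h where "h = X (Suc ?i) / X i1"
    have "X ?i \<noteq> 0" using regular_pair.axioms(1)[OF rp[of ?i], THEN regseq.x0] .
    then have "h = X (Suc ?i) / X ?i * (X ?i / X i1)" by (simp add: h_def)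
    moreover have "X ?i / X i1 \<in> A (Suc ?i)" and e: "e \<in> A (Suc ?i)" using * mono[of ?i "Suc ?i"] by auto
    ultimately have h: "h \<in> A (Suc ?i)" using B.cl(4)[OF step2[OF *(1)]] by metis
    have X: "X (Suc ?i) ^ r = X i1 * h * X (Suc ?i) ^ r'" using A1.x0 by (simp add: h_def r')
    have "a = X i1 ^ Suc n * (e * h * X (Suc ?i) ^ r') * a''"
      "b = X i1 ^ Suc n * (e * h * X (Suc ?i) ^ r') * b''"
      unfolding * 2 X by (simp_all add: mult_ac)
    moreover have "e * h * X (Suc ?i) ^ r' \<in> A (Suc ?i)"
      using e h B.xR by (auto intro!: B.cl)
    ultimately show ?case using 2(3) h unfolding h_def add_Suc_right by blast
  qed
  note main = this
  have Cab: "C z' i1 a b" using ab by (auto simp: G'_def G_def i1_def)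
  then obtain N where "X i1 ^ N \<in> span2 (A i1) a b" by (auto simp: C_def)
  then obtain u v where uv: "u \<in> A i1" "v \<in> A i1" "X i1 ^ N = a * u + b * v" by (rule span2E)
  \<comment> \<open>One step beyond N: X^N lies in (a, b), while a and b are by then divisible by
    X^(N+1).\<close>
  let ?k = "i1 + Suc N"
  interpret K: regular_pair "A ?k" "X ?k" "Y ?k" by (rule rp)
  obtain a' b' e where *: "G' ?k a' b'" "e \<in> A ?k"
    "a = X i1 ^ Suc N * e * a'" "b = X i1 ^ Suc N * e * b'" using main[of "Suc N"] by blast
  have a'b': "a' \<in> A ?k" "b' \<in> A ?k" using * by (auto simp: G'_def G_def C_def)
  have uvk: "u \<in> A ?k" "v \<in> A ?k" using uv mono[of i1 ?k] by auto
  have "X i1 ^ N * 1 = X i1 ^ N * (X i1 * (e * (a' * u + b' * v)))"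
    using uv(3) unfolding * by (simp add: algebra_simps)
  then have "1 = X i1 * (e * (a' * u + b' * v))" using A1.x0 by simp
  moreover have "X i1 * (e * (a' * u + b' * v)) \<in> K.M"
    using A1.xM Mmono[of i1 ?k] a'b' uvk * by (intro K.nonunits_mult(1) K.cl) auto
  ultimately show False using K.one_unit by simp
qed

text \<open>The union of the chain is a valuation ring, and valuation rings are maximal under
  domination.\<close>

corollary qstep_chain_unique:
  fixes A :: "nat \<Rightarrow> 'a::field set" and X Y :: "nat \<Rightarrow> 'a"
  assumes step: "\<And>i. qstep (A i) (X i) (Y i) (A (Suc i)) (X (Suc i)) (Y (Suc i))"
    and R: "quasi_local R" "\<And>i. dominates R (A i)"
  shows "R = (\<Union>i. A i)"
proof
  interpret R: quasi_local R by fact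
  show "(\<Union>i. A i) \<subseteq> R" using R(2) by (auto simp: dominates_def)
  show "R \<subseteq> (\<Union>i. A i)"
  proof
    fix z assume z: "z \<in> R"
    show "z \<in> (\<Union>i. A i)"
    proof (rule ccontr)
      assume n: "z \<notin> (\<Union>i. A i)"
      interpret A: regular_pair "A 0" "X 0" "Y 0" using qstep_regular[OF step] by blast
      have "z \<noteq> 0" using n A.cl by auto
      then obtain i where "inverse z \<in> A i" using qstep_chain_valuation[of A X Y z] step n by auto
      then have "inverse z \<in> nonunits (A i)" using n by (auto simp: nonunits_def)
      then have "inverse z \<in> nonunits R" using R(2) by (auto simp: dominates_def)
      then show False using z \<open>z \<noteq> 0\<close> by (auto simp: nonunits_def)
    qed
  qed
qed

section \<open>Sequences of rings below a valuation ring\<close>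

lemma valuation_ring_quasi_local:
  assumes "valuation_ring V"
  shows "quasi_local V"
proof
  show sub: "subring V" using assms by (simp add: valuation_ring_def)
  note cl = subringD[OF sub]
  have *: False if "a \<in> nonunits V" "b \<in> nonunits V" "a + b \<notin> nonunits V" "a \<noteq> 0" "b \<noteq> 0" "a / b \<in> V" for a b
  proof -
    have ab: "inverse (a + b) \<in> V" "a + b \<noteq> 0" using that cl by (auto simp: nonunits_def)
    then have "(1 + a / b) * inverse (a + b) \<in> V" using that cl by auto
    moreover have "1 + a / b = (a + b) * inverse b" using that by (simp add: field_simps)
    ultimately have "(a + b) * inverse b * inverse (a + b) \<in> V" by metis
    moreover have "(a + b) * inverse b * inverse (a + b) = inverse b" using ab(2) by (simp add: mult.commute)
    ultimately have "inverse b \<in> V" by metis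
    then show False using that by (simp add: nonunits_def)
  qed
  show "a + b \<in> nonunits V" if ab: "a \<in> nonunits V" "b \<in> nonunits V" for a b
  proof (rule ccontr)
    assume n: "a + b \<notin> nonunits V"
    then have nz: "a \<noteq> 0" "b \<noteq> 0" using ab by auto
    then have "a / b \<in> V \<or> inverse (a / b) \<in> V" using assms unfolding valuation_ring_def
      by (metis divide_eq_0_iff)
    then show False using *[OF ab n nz] *[of b a] ab n nz by (auto simp: add.commute)
  qed
qed

lemma nonunits_restrict: "R \<subseteq> V \<Longrightarrow> a \<in> R \<Longrightarrow> a \<in> nonunits V \<Longrightarrow> a \<in> nonunits R"
  by (auto simp: nonunits_def)

lemmas qtI = qt.intro[OF _ qt_axioms.intro]

text \<open>Covers both kinds of members of Q*(D), see \<open>Qstar_point\<close>.\<close>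

definition surface_point :: "'a::field set \<Rightarrow> bool" where
  "surface_point R \<longleftrightarrow> quasi_local R \<and> (valuation_ring R \<or> (\<exists>u v. regular_pair R u v))"

lemma surface_point_factorization:
  assumes A: "regular_pair A x y" and R: "surface_point R" and dom: "dominates R A" and ne: "A \<noteq> R"
  shows "y / x \<in> R \<or> x / y \<in> R"
proof (cases "valuation_ring R")
  case True
  interpret regular_pair A x y by fact
  have "y / x \<noteq> 0" using x0 y0 by simp
  then have "y / x \<in> R \<or> inverse (y / x) \<in> R" using True unfolding valuation_ring_def by blast
  then show ?thesis by simp
next
  case False
  then obtain u v where "regular_pair R u v" using R by (auto simp: surface_point_def)
  then show ?thesis using regular_pair_factorization[OF A _ dom ne] by blast
qed

text \<open>The residue of t is transcendental over the residue field of A. A local V that dominates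
  A and satisfies this for t = y / x is the order valuation ring of A.\<close>

definition residually_transcendental :: "'a::field set \<Rightarrow> 'a \<Rightarrow> 'a set \<Rightarrow> bool" where
  "residually_transcendental A t V \<longleftrightarrow> t \<in> V \<and>
    (\<forall>Q\<in>polys A. Q \<notin> polys (nonunits A) \<longrightarrow> poly Q t \<notin> nonunits V)"

lemma polys_reflect: "p \<in> polys A \<Longrightarrow> 0 \<in> A \<Longrightarrow> reflect_poly p \<in> polys A"
  by (auto simp: polys_def coeff_reflect_poly)

lemma polys_reflectD:
  assumes "reflect_poly p \<in> polys A" "0 \<in> A"
  shows "p \<in> polys A"
  unfolding polys_def
proof (intro CollectI allI)
  fix i
  show "coeff p i \<in> A"
  proof (cases "i \<le> degree p")
    case True
    then have "coeff p i = coeff (reflect_poly p) (degree p - i)" by (simp add: coeff_reflect_poly)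
    then show ?thesis using assms by (simp add: polys_def)
  next
    case False
    then show ?thesis using assms by (simp add: coeff_eq_0)
  qed
qed

text \<open>A leading term with coefficient in M could be dropped without leaving the class, so in
  least degree the leading coefficient is a unit. \<open>\<Phi>\<close> is abstract because it also
  serves as a condition on infinitely many rings at once.\<close>

lemma (in quasi_local) least_monic:
  assumes ex: "\<exists>Q\<in>RT. Q \<notin> MT \<and> \<Phi> Q"
    and diff: "\<And>Q Q'. Q \<in> RT \<Longrightarrow> \<Phi> Q \<Longrightarrow> Q' \<in> MT \<Longrightarrow> \<Phi> (Q - Q')"
    and smult: "\<And>Q c. Q \<in> RT \<Longrightarrow> \<Phi> Q \<Longrightarrow> c \<in> R \<Longrightarrow> \<Phi> (smult c Q)"
  obtains P where "P \<in> RT" "lead_coeff P = 1" "\<Phi> P"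
    "\<And>Q. Q \<in> RT \<Longrightarrow> \<Phi> Q \<Longrightarrow> degree Q < degree P \<Longrightarrow> Q \<in> MT"
proof -
  define d where "d = (LEAST d. \<exists>Q\<in>RT. Q \<notin> MT \<and> \<Phi> Q \<and> degree Q = d)"
  have "\<exists>d. \<exists>Q\<in>RT. Q \<notin> MT \<and> \<Phi> Q \<and> degree Q = d" using ex by blast
  from LeastI_ex[OF this] obtain Q where Q: "Q \<in> RT" "Q \<notin> MT" "\<Phi> Q" "degree Q = d"
    unfolding d_def by blast
  have min: "Q' \<in> MT" if "Q' \<in> RT" "\<Phi> Q'" "degree Q' < d" for Q'
    using not_less_Least[OF that(3)[unfolded d_def]] that(1,2) by blast
  have lc: "lead_coeff Q \<in> R" using Q by (simp add: polys_coeff)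
  have "lead_coeff Q \<notin> M"
  proof
    assume l: "lead_coeff Q \<in> M"
    define m where "m = monom (lead_coeff Q) d"
    have m: "m \<in> MT" unfolding m_def using l by (rule MT_cl(8))
    have Qm: "Q - m \<in> RT" "\<Phi> (Q - m)" using Q m diff MT_RT by (auto intro: RT_cl)
    have nMT: "Q - m \<notin> MT" using Q(2) MT_cl(2)[OF _ m, of "Q - m"] by auto
    then have "Q - m \<noteq> 0" using MT_cl(1) by auto
    moreover have "coeff (Q - m) d = 0" using Q by (simp add: m_def)
    moreover have "degree (Q - m) \<le> d" using Q by (intro degree_diff_le) (auto simp: m_def degree_monom_le)
    ultimately have "degree (Q - m) < d" by (metis le_neq_implies_less leading_coeff_0_iff)
    then show False using min Qm nMT by blast
  qed
  then have u: "lead_coeff Q \<noteq> 0" "inverse (lead_coeff Q) \<in> R" using unitD[OF lc] by blast+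
  define P where "P = smult (inverse (lead_coeff Q)) Q"
  have "P \<in> RT" "lead_coeff P = 1" "\<Phi> P" "degree P = d"
    using Q u smult by (auto simp: P_def intro!: RT_cl)
  then show ?thesis using that min by blast
qed

section \<open>Transforms along a valuation ring\<close>

context regular_pair
begin

text \<open>If f = x^(r-s) p(t) / q(t) were in V with r < s, then p(t) would be a multiple of x in V
  and hence a nonunit, against transcendence.\<close>

lemma residually_transcendental_eq:
  assumes V: "quasi_local V" and dom: "dominates V R" and rt: "residually_transcendental R t V"
  shows "V \<subseteq> {poly p t / poly q t | p q. p \<in> RT \<and> q \<in> RT \<and> q \<notin> MT}"
proof
  interpret V: quasi_local V by fact
  note D = dominatesD[OF dom]
  have tV: "t \<in> V" using rt by (simp add: residually_transcendental_def)
  fix f assume f: "f \<in> V"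
  show "f \<in> {poly p t / poly q t | p q. p \<in> RT \<and> q \<in> RT \<and> q \<notin> MT}"
  proof (cases "f = 0")
    case True
    have "1 \<notin> MT" using monic_not_MT by simp
    then show ?thesis using True RT_cl by (intro CollectI exI[of _ 0] exI[of _ 1]) auto
  next
    case False
    then obtain r s p q where pq: "p \<in> RT" "p \<notin> MT" "q \<in> RT" "q \<notin> MT"
      "f * (x ^ s * poly q t) = x ^ r * poly p t" using frac_rep by metis
    have q0: "poly q t \<noteq> 0" using poly_t_nonzero pq by blast
    have "s \<le> r"
    proof (rule ccontr)
      assume "\<not> s \<le> r"
      then obtain k where k: "s = r + Suc k" using less_iff_Suc_add by (metis not_le add_Suc_right)
      have "x ^ r * (x * (x ^ k * f * poly q t)) = x ^ r * poly p t"
        using pq(5) unfolding k by (simp add: power_add mult_ac)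
      then have "poly p t = x * (x ^ k * f * poly q t)" using x0 by simp
      moreover have "x * (x ^ k * f * poly q t) \<in> V.M"
        using D(3)[OF xM] D(2)[OF xR] f V.poly_in[OF _ tV, of q] pq(3) polys_mono[OF D(1)]
        by (intro V.nonunits_mult(1) V.cl) auto
      ultimately show False using rt pq by (auto simp: residually_transcendental_def)
    qed
    then obtain k where k: "r = s + k" using le_Suc_ex by blast
    have "x ^ s * (f * poly q t) = x ^ s * (x ^ k * poly p t)"
      using pq(5) unfolding k by (simp add: power_add mult_ac)
    then have "f * poly q t = poly (smult (x ^ k) p) t" using x0 by simp
    then have "f = poly (smult (x ^ k) p) t / poly q t" using q0 by (simp add: eq_divide_eq)
    moreover have "smult (x ^ k) p \<in> RT" using pq xR by (auto intro!: RT_cl cl)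
    ultimately show ?thesis using pq by blast
  qed
qed

text \<open>Reversing the coefficients of Q exchanges x / y and y / x up to a power of the unit y /
  x.\<close>

lemma residually_transcendental_sym:
  assumes V: "quasi_local V" and dom: "dominates V R" and rt: "residually_transcendental R (y / x) V"
  shows "residually_transcendental R (x / y) V"
proof -
  interpret V: quasi_local V by fact
  have tV: "y / x \<in> V" using rt by (simp add: residually_transcendental_def)
  have "[:0, 1:] \<in> RT" "[:0, 1:] \<notin> MT" using monic_not_MT[of "[:0, 1:]"] by (auto intro!: RT_cl cl)
  then have "y / x \<notin> V.M" using rt by (auto simp: residually_transcendental_def)
  then have "x / y \<in> V" using V.unitD[OF tV] by simp
  moreover have "poly Q (x / y) \<notin> V.M" if Q: "Q \<in> RT" "Q \<notin> MT" for Q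
  proof
    assume "poly Q (x / y) \<in> V.M"
    then have "(y / x) ^ degree Q * poly Q (x / y) \<in> V.M" using tV by (auto intro!: V.nonunits_mult(2) V.cl)
    moreover have "poly (reflect_poly Q) (y / x) = (y / x) ^ degree Q * poly Q (x / y)"
      using poly_reflect_poly_nz[of "y / x" Q] x0 y0 by simp
    moreover have "reflect_poly Q \<in> RT" "reflect_poly Q \<notin> MT"
      using Q polys_reflect polys_reflectD cl zero_nonunit by blast+
    ultimately show False using rt by (auto simp: residually_transcendental_def)
  qed
  ultimately show ?thesis by (simp add: residually_transcendental_def)
qed

lemma minimal_poly_exists:
  assumes S: "quasi_local S" "dominates S R" "t \<in> S" and nt: "\<not> residually_transcendental R t S"
  shows "\<exists>P. minimal_poly R t S P"
proof -
  interpret S: quasi_local S by fact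
  note D = dominatesD[OF S(2)]
  have MS: "poly Q t \<in> S.M" if "Q \<in> MT" for Q
    using S.poly_nonunit[OF _ S(3)] polys_mono[of M S.M] D(3) that by blast
  show ?thesis
  proof (rule least_monic[of "\<lambda>Q. poly Q t \<in> S.M"])
    show "\<exists>Q\<in>RT. Q \<notin> MT \<and> poly Q t \<in> S.M" using nt S(3) unfolding residually_transcendental_def by blast
    show "poly (Q - Q') t \<in> S.M" if "poly Q t \<in> S.M" "Q' \<in> MT" for Q Q'
      using S.nonunits_diff[OF that(1) MS[OF that(2)]] by simp
    show "poly (smult c Q) t \<in> S.M" if "poly Q t \<in> S.M" "c \<in> R" for Q c
      using S.nonunits_mult(2)[OF that(1) D(2)[OF that(2)]] by simp
  qed (unfold minimal_poly_def, blast)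
qed

text \<open>Dividing P by the true minimal polynomial would factor it modulo M. The hypothesis
  \<open>irr\<close> does not mention S, so P can be carried from one ring to another.\<close>

lemma irreducible_minimal_poly:
  assumes S: "quasi_local S" "dominates S R" "t \<in> S" and P: "P \<in> RT" "lead_coeff P = 1" "poly P t \<in> nonunits S"
    and irr: "\<And>A B. A \<in> RT \<Longrightarrow> B \<in> RT \<Longrightarrow> degree A < degree P \<Longrightarrow> degree B < degree P \<Longrightarrow> P - A * B \<notin> MT"
  shows "minimal_poly R t S P"
proof (rule ccontr)
  assume "\<not> ?thesis"
  then obtain Q where Q: "Q \<in> RT" "poly Q t \<in> nonunits S" "degree Q < degree P" "Q \<notin> MT"
    using P by (auto simp: minimal_poly_def)
  have "\<not> residually_transcendental R t S" using Q by (auto simp: residually_transcendental_def)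
  then obtain P' where P': "minimal_poly R t S P'" using minimal_poly_exists S by blast
  interpret q: qt R x y S P' by (rule qtI) (use regular_pair_axioms S P' in auto)
  have "degree P' \<le> degree Q" using q.P(4)[OF Q(1,2)] Q(4) by linarith
  obtain A B where AB: "A \<in> RT" "B \<in> RT" "P = A * P' + B" "degree B < degree P'"
    "degree A \<le> degree P - degree P'"
    using monic_division[OF q.P(1,2) q.degP P(1)] by blast
  have "poly B t = poly P t - poly A t * poly P' t" using AB by simp
  also have "\<dots> \<in> q.S.M" using P(3) q.P(3) q.poly_S AB by (intro q.S.nonunits_diff q.S.nonunits_mult(2)) auto
  finally have "B \<in> MT" using q.P(4) AB by blast
  moreover have "P - A * P' = B" using AB by simp
  moreover have "degree A < degree P" using AB(5) q.degP \<open>degree P' \<le> degree Q\<close> Q(3) by simp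
  ultimately show False using irr[OF AB(1) q.P(1)] \<open>degree P' \<le> degree Q\<close> Q(3) by simp
qed

text \<open>By \<open>reduce\<close>, the elements of R[t] that are nonunits in S form the ideal
  generated by x and P(t), which no longer depends on S.\<close>

lemma minimal_poly_qtransform:
  assumes S: "quasi_local S" "dominates S R" "t \<in> S" "minimal_poly R t S P"
    and S': "quasi_local S'" "dominates S' R" "t \<in> S'" "minimal_poly R t S' P"
  shows "qtransform R t S = qtransform R t S'"
proof -
  interpret q: qt R x y S P by (rule qtI) (use regular_pair_axioms S in auto)
  interpret q': qt R x y S' P by (rule qtI) (use regular_pair_axioms S' in auto)
  have "poly Q t \<in> q'.S.M" if Q: "Q \<in> RT" "poly Q t \<in> q.S.M" for Q
  proof -
    obtain A B where AB: "A \<in> RT" "B \<in> RT" "poly Q t = q.w * poly A t + x * poly B t"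
      using q.reduce[OF Q] by blast
    show ?thesis unfolding AB(3) q.w_def
      using q'.P(3) q'.DS(3)[OF xM] q'.poly_S AB by (intro q'.S.nonunits_add q'.S.nonunits_mult(1)) auto
  qed
  moreover have "poly Q t \<in> q.S.M" if Q: "Q \<in> RT" "poly Q t \<in> q'.S.M" for Q
  proof -
    obtain A B where AB: "A \<in> RT" "B \<in> RT" "poly Q t = q'.w * poly A t + x * poly B t"
      using q'.reduce[OF Q] by blast
    show ?thesis unfolding AB(3) q'.w_def
      using q.P(3) q.DS(3)[OF xM] q.poly_S AB by (intro q.S.nonunits_add q.S.nonunits_mult(1)) auto
  qed
  ultimately show ?thesis unfolding qtransform_def by blast
qed

text \<open>P is minimal at V, hence irreducible modulo M. It stays minimal at S although V need not
  dominate S: a nonunit of V that lies in S is a nonunit of S.\<close>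

lemma transform_along_valuation:
  assumes V: "valuation_ring V" "dominates V R" "t \<in> V" "\<not> residually_transcendental R t V"
  shows "\<exists>B w. is_qtransform R x y B w \<and> dominates V B \<and>
    (\<forall>S. surface_point S \<and> S \<subseteq> V \<and> dominates S R \<and> S \<noteq> R \<longrightarrow> dominates S B)"
proof -
  have qV: "quasi_local V" using V valuation_ring_quasi_local by blast
  obtain P where P: "minimal_poly R t V P" using minimal_poly_exists qV V by blast
  interpret q: qt R x y V P by (rule qtI) (use regular_pair_axioms V qV P in auto)
  have irr: "P - A * B \<notin> MT" if AB: "A \<in> RT" "B \<in> RT" "degree A < degree P" "degree B < degree P" for A B
  proof
    assume m: "P - A * B \<in> MT"
    have "poly A t * poly B t = poly P t - poly (P - A * B) t" by simp
    also have "\<dots> \<in> q.S.M" using q.P(3) q.MT_S[OF m] by (rule q.S.nonunits_diff)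
    finally have "poly A t \<in> q.S.M \<or> poly B t \<in> q.S.M"
      using q.S.units_mult q.poly_S AB by blast
    then have "A \<in> MT \<or> B \<in> MT" using q.P(4) AB by blast
    then have "A * B \<in> MT" using AB MT_cl(4)[of A B] MT_cl(5)[of A B] by blast
    then have "P \<in> MT" using MT_cl(2)[OF m, of "A * B"] by simp
    then show False using q.P_MT by simp
  qed
  have "dominates S q.T" if S: "surface_point S" "S \<subseteq> V" "dominates S R" "S \<noteq> R" for S
  proof -
    have qS: "quasi_local S" using S by (simp add: surface_point_def)
    interpret S: quasi_local S by fact
    note D = dominatesD[OF S(3)]
    \<comment> \<open>If t is not in S, then x / y is a nonunit of S, and the reversed polynomial of
      the monic P takes there a value 1 + nonunit, a unit of S. But this value is (x/y)^(degree P)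
      P(t), a nonunit of V.\<close>
    have tS: "t \<in> S"
    proof (rule ccontr)
      assume nt: "t \<notin> S"
      then have s: "x / y \<in> S" using surface_point_factorization[OF regular_pair_axioms S(1,3)] S(4) by blast
      then have sM: "x / y \<in> S.M" using nt by (auto simp: nonunits_def)
      obtain c p where cp: "reflect_poly P = pCons c p" by (cases "reflect_poly P") auto
      have rP: "reflect_poly P \<in> S.RT" using polys_reflect[OF q.P(1) cl(1)] polys_mono[OF D(1)] by blast
      then have p: "p \<in> S.RT" unfolding cp polys_def by (auto dest: spec[of _ "Suc _"])
      have "c = 1" using arg_cong[OF cp, of "\<lambda>p. coeff p 0"] q.P(2) by simp
      then have eq: "poly (reflect_poly P) (x / y) = 1 + x / y * poly p (x / y)" unfolding cp by simp
      have "1 + x / y * poly p (x / y) \<notin> S.M"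
        using sM s p by (intro S.unit_add_nonunit S.cl S.one_unit S.nonunits_mult(1) S.poly_in)
      moreover have "1 + x / y * poly p (x / y) \<in> S" using s p by (intro S.cl S.poly_in)
      moreover have "poly (reflect_poly P) (x / y) = (x / y) ^ degree P * poly P t"
        using poly_reflect_poly_nz[of "x / y" P] x0 y0 by simp
      moreover have "(x / y) ^ degree P * poly P t \<in> q.S.M"
        using s S(2) q.P(3) by (auto intro!: q.S.nonunits_mult(2) q.S.cl)
      ultimately show False using eq nonunits_restrict[OF S(2)] by metis
    qed
    have "poly P t \<in> S" using S.poly_in[OF _ tS] q.P(1) polys_mono[OF D(1)] by blast
    then have "poly P t \<in> S.M" using nonunits_restrict[OF S(2)] q.P(3) by blast
    then have mS: "minimal_poly R t S P"
      using irreducible_minimal_poly[OF qS S(3) tS q.P(1,2)] irr by blast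
    interpret s: qt R x y S P by (rule qtI) (use regular_pair_axioms S qS tS mS in auto)
    have "q.T = s.T" unfolding q.T_def s.T_def
      by (rule minimal_poly_qtransform) (use V qV P S qS tS mS in auto)
    then show ?thesis using s.dominates_ST by simp
  qed
  then show ?thesis using q.is_qtransform_T q.dominates_ST by blast
qed

end

text \<open>\<open>St\<close> is an invariant under which a next transform can always be chosen. The
  resulting infinite chain is dominated by R and by R', so both equal its union.\<close>

lemma state_chain_unique:
  fixes St :: "'a::field set \<Rightarrow> 'a \<Rightarrow> 'a \<Rightarrow> bool"
  assumes init: "St A0 a0 b0"
    and step: "\<And>A x y. St A x y \<Longrightarrow> \<exists>B x' w. qstep A x y B x' w \<and> St B x' w"
    and R: "quasi_local R" "\<And>A x y. St A x y \<Longrightarrow> dominates R A"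
    and R': "quasi_local R'" "\<And>A x y. St A x y \<Longrightarrow> dominates R' A"
  shows "R = R'"
proof -
  have "\<exists>f. \<forall>n::nat. (case f n of (A, x, y) \<Rightarrow> St A x y) \<and>
    (case f n of (A, x, y) \<Rightarrow> case f (Suc n) of (B, x', w) \<Rightarrow> qstep A x y B x' w)"
  proof (rule dependent_nat_choice)
    show "\<exists>s. case s of (A, x, y) \<Rightarrow> St A x y" using init by auto
    show "\<exists>s'. (case s' of (A, x, y) \<Rightarrow> St A x y) \<and>
      (case s of (A, x, y) \<Rightarrow> case s' of (B, x', w) \<Rightarrow> qstep A x y B x' w)"
      if "case s of (A, x, y) \<Rightarrow> St A x y" for s and n :: nat
      using that step by (cases s) fastforce
  qed
  then obtain f where f: "\<And>n::nat. (case f n of (A, x, y) \<Rightarrow> St A x y)"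
    "\<And>n. case f n of (A, x, y) \<Rightarrow> case f (Suc n) of (B, x', w) \<Rightarrow> qstep A x y B x' w" by metis
  define A X Y where "A n = fst (f n)" and "X n = fst (snd (f n))" and "Y n = snd (snd (f n))" for n
  have St: "St (A n) (X n) (Y n)" for n using f(1)[of n] by (simp add: A_def X_def Y_def split_beta)
  have q: "qstep (A n) (X n) (Y n) (A (Suc n)) (X (Suc n)) (Y (Suc n))" for n
    using f(2)[of n] by (simp add: A_def X_def Y_def split_beta)
  show ?thesis using qstep_chain_unique[of A X Y] q R R' St by metis
qed

lemma no_bad_sequence_exceptional:
  fixes \<rho> :: "nat \<Rightarrow> 'a::field set"
  assumes V: "valuation_ring V" and A: "regular_pair A x y" and VA: "dominates V A"
    and rt: "residually_transcendental A (y / x) V"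
    and pt: "\<And>n. surface_point (\<rho> n)" and sub: "\<And>n. \<rho> n \<subseteq> V" and dom: "\<And>n. dominates (\<rho> n) A"
    and bad: "\<And>n. \<exists>X. finite X \<and> X \<subseteq> \<rho> n \<and> (\<forall>m>n. \<not> X \<subseteq> \<rho> m)"
    and inf: "infinite {n. y / x \<in> \<rho> n}"
  shows False
proof -
  interpret A: regular_pair A x y by fact
  have qV: "quasi_local V" using V valuation_ring_quasi_local by blast
  interpret V: quasi_local V by fact
  have q\<rho>: "quasi_local (\<rho> n)" for n using pt by (simp add: surface_point_def)
  have bad': "\<not> \<rho> n \<subseteq> \<rho> m" if "n < m" for n m using bad[of n] that by blast
  define N where "N = {n. y / x \<in> \<rho> n}"
  obtain n0 where n0: "n0 \<in> N" using inf unfolding N_def by (metis finite.emptyI equals0I)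
  obtain X where X: "finite X" "X \<subseteq> \<rho> n0" "\<And>m. m > n0 \<Longrightarrow> \<not> X \<subseteq> \<rho> m" using bad[of n0] by blast
  have poly\<rho>: "poly p A.t \<in> \<rho> m" if "p \<in> A.RT" "m \<in> N" for p m
    using quasi_local.poly_in[OF q\<rho>] polys_mono[OF dominatesD(1)[OF dom]] that unfolding N_def by blast
  have MT\<rho>: "poly p A.t \<in> nonunits (\<rho> m)" if "p \<in> A.MT" "m \<in> N" for p m
    using quasi_local.poly_nonunit[OF q\<rho>] polys_mono[of A.M "nonunits (\<rho> m)"] dominatesD(3)[OF dom] that
    unfolding N_def by blast
  \<comment> \<open>Q vanishes at the centres of infinitely many members. Such a Q exists: the
    finite set X contains an f missing from infinitely many later members, and the denominator of f
    will do.\<close>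
  define \<Phi> where "\<Phi> Q \<longleftrightarrow> infinite {m \<in> N. poly Q A.t \<in> nonunits (\<rho> m)}" for Q
  have "\<exists>Q\<in>A.RT. Q \<notin> A.MT \<and> \<Phi> Q"
  proof -
    have "infinite (N - {..n0})" using inf unfolding N_def by simp
    moreover have "N - {..n0} \<subseteq> (\<Union>f\<in>X. {m \<in> N. m > n0 \<and> f \<notin> \<rho> m})"
    proof
      fix m assume m: "m \<in> N - {..n0}"
      then have "\<not> X \<subseteq> \<rho> m" using X(3) by auto
      then show "m \<in> (\<Union>f\<in>X. {m \<in> N. m > n0 \<and> f \<notin> \<rho> m})" using m by auto
    qed
    ultimately have "\<not> finite (\<Union>f\<in>X. {m \<in> N. m > n0 \<and> f \<notin> \<rho> m})" using finite_subset by blast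
    then obtain f where f: "f \<in> X" "infinite {m \<in> N. m > n0 \<and> f \<notin> \<rho> m}" using X(1) by blast
    have "f \<in> V" using f X(2) sub by blast
    then obtain p q where pq: "p \<in> A.RT" "q \<in> A.RT" "q \<notin> A.MT" "f = poly p A.t / poly q A.t"
      using A.residually_transcendental_eq[OF qV VA rt] by blast
    have "{m \<in> N. m > n0 \<and> f \<notin> \<rho> m} \<subseteq> {m \<in> N. poly q A.t \<in> nonunits (\<rho> m)}"
    proof safe
      fix m assume m: "m \<in> N" "f \<notin> \<rho> m"
      interpret m: quasi_local "\<rho> m" by (rule q\<rho>)
      show "poly q A.t \<in> m.M"
      proof (rule ccontr)
        assume "poly q A.t \<notin> m.M"
        then have "poly p A.t * inverse (poly q A.t) \<in> \<rho> m"
          using m.unitD(2)[OF poly\<rho>[OF pq(2) m(1)]] poly\<rho>[OF pq(1) m(1)] by (auto intro!: m.cl)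
        then show False using m pq by (simp add: divide_inverse)
      qed
    qed
    then have "\<Phi> q" unfolding \<Phi>_def using f(2) finite_subset by blast
    then show ?thesis using pq by blast
  qed
  moreover have "\<Phi> (Q - Q')" if "Q \<in> A.RT" "\<Phi> Q" "Q' \<in> A.MT" for Q Q'
  proof -
    have "{m \<in> N. poly Q A.t \<in> nonunits (\<rho> m)} \<subseteq> {m \<in> N. poly (Q - Q') A.t \<in> nonunits (\<rho> m)}"
      using MT\<rho>[OF that(3)] quasi_local.nonunits_diff[OF q\<rho>] by auto
    then show ?thesis using that(2) unfolding \<Phi>_def using finite_subset by blast
  qed
  moreover have "\<Phi> (smult c Q)" if "Q \<in> A.RT" "\<Phi> Q" "c \<in> A" for Q c
  proof -
    have "{m \<in> N. poly Q A.t \<in> nonunits (\<rho> m)} \<subseteq> {m \<in> N. poly (smult c Q) A.t \<in> nonunits (\<rho> m)}"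
      using that(3) dominatesD(2)[OF dom] quasi_local.nonunits_mult(2)[OF q\<rho>] by auto
    then show ?thesis using that(2) unfolding \<Phi>_def using finite_subset by blast
  qed
  ultimately obtain P where P: "P \<in> A.RT" "lead_coeff P = 1" "\<Phi> P"
    "\<And>Q. Q \<in> A.RT \<Longrightarrow> \<Phi> Q \<Longrightarrow> degree Q < degree P \<Longrightarrow> Q \<in> A.MT"
    using A.least_monic[of \<Phi>] by blast
  have P_MT: "P \<notin> A.MT" using A.monic_not_MT P by blast
  \<comment> \<open>If P factored modulo the maximal ideal, a factor of lower degree would still
    vanish at infinitely many centres.\<close>
  have irr: "P - E * F \<notin> A.MT" if EF: "E \<in> A.RT" "F \<in> A.RT" "degree E < degree P" "degree F < degree P" for E F
  proof
    assume m: "P - E * F \<in> A.MT"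
    have "{m \<in> N. poly P A.t \<in> nonunits (\<rho> m)} \<subseteq>
      {m \<in> N. poly E A.t \<in> nonunits (\<rho> m)} \<union> {m \<in> N. poly F A.t \<in> nonunits (\<rho> m)}"
    proof safe
      fix k assume k: "k \<in> N" "poly P A.t \<in> nonunits (\<rho> k)" "poly F A.t \<notin> nonunits (\<rho> k)"
      interpret k: quasi_local "\<rho> k" by (rule q\<rho>)
      have "poly E A.t * poly F A.t = poly P A.t - poly (P - E * F) A.t" by simp
      also have "\<dots> \<in> k.M" using k(2) MT\<rho>[OF m k(1)] by (rule k.nonunits_diff)
      finally show "poly E A.t \<in> k.M" using k.units_mult poly\<rho> EF k by blast
    qed
    then have "\<Phi> E \<or> \<Phi> F" using P(3) unfolding \<Phi>_def by (meson finite_UnI finite_subset)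
    then have "E \<in> A.MT \<or> F \<in> A.MT" using P(4) EF by blast
    then have "E * F \<in> A.MT" using EF A.MT_cl(4)[of E F] A.MT_cl(5)[of E F] by blast
    then have "P \<in> A.MT" using A.MT_cl(2)[OF m, of "E * F"] by simp
    then show False using P_MT by simp
  qed
  \<comment> \<open>The members centred at the point P = 0 of the exceptional curve; they all
    dominate the same transform of A.\<close>
  define K where "K = {m \<in> N. poly P A.t \<in> nonunits (\<rho> m)}"
  have Kinf: "infinite K" using P(3) by (simp add: K_def \<Phi>_def)
  have K_next: "\<exists>k'\<in>K. k' > k" for k using Kinf by (meson infinite_nat_iff_unbounded)
  have Kmin: "minimal_poly A A.t (\<rho> k) P" if "k \<in> K" for k
    using A.irreducible_minimal_poly[OF q\<rho> dom _ P(1,2)] irr that unfolding K_def N_def by blast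
  obtain k1 k2 where k12: "k1 \<in> K" "k2 \<in> K" "k1 < k2" using K_next by blast
  \<comment> \<open>Y = 0 is the exceptional curve of A or its strict transform, on which V is
    centred: Y is a nonunit and X a unit of V. The first transform has parameters x and w, so x
    takes the place of Y.\<close>
  define St where "St B X Y \<longleftrightarrow> regular_pair B X Y \<and> (\<forall>k\<in>K. dominates (\<rho> k) B) \<and> Y \<in> V.M \<and> X \<in> V \<and> X \<notin> V.M"
    for B X Y
  have "\<rho> k1 = \<rho> k2"
  proof (rule state_chain_unique[of St])
    interpret q: qt A x y "\<rho> k1" P
      by (rule qtI) (use A q\<rho> dom k12 Kmin in \<open>auto simp: K_def N_def\<close>)
    have "dominates (\<rho> k) q.T" if "k \<in> K" for k
    proof -
      interpret k: qt A x y "\<rho> k" P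
        by (rule qtI) (use A q\<rho> dom that Kmin in \<open>auto simp: K_def N_def\<close>)
      have "q.T = k.T" unfolding q.T_def k.T_def
        by (rule A.minimal_poly_qtransform) (use q\<rho> dom that k12 Kmin in \<open>auto simp: K_def N_def\<close>)
      then show ?thesis using k.dominates_ST by simp
    qed
    moreover have "x \<in> V.M" using dominatesD(3)[OF VA A.xM] .
    moreover have "q.w \<in> V" using q.w_T q.T_S sub by blast
    moreover have "q.w \<notin> V.M" using rt P P_MT by (auto simp: q.w_def residually_transcendental_def)
    ultimately show "St q.T q.w x"
      unfolding St_def using regular_pair.regular_pair_sym[OF q.regular_pair_T] by blast
  next
    fix B X Y assume "St B X Y"
    then have St: "regular_pair B X Y" "\<And>k. k \<in> K \<Longrightarrow> dominates (\<rho> k) B" "Y \<in> V.M" "X \<in> V" "X \<notin> V.M"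
      by (auto simp: St_def)
    interpret B: regular_pair B X Y by fact
    have ne: "B \<noteq> \<rho> k" if "k \<in> K" for k
    proof
      assume "B = \<rho> k"
      moreover obtain k' where "k' \<in> K" "k < k'" using K_next by blast
      ultimately have "\<rho> k \<subseteq> \<rho> k'" using St(2) by (auto simp: dominates_def)
      then show False using bad' \<open>k < k'\<close> by blast
    qed
    have XY: "X / Y \<notin> V"
    proof
      assume "X / Y \<in> V"
      then have "Y * (X / Y) \<in> V.M" using St(3) by (rule V.nonunits_mult(1)[rotated])
      then show False using St(5) B.y0 by simp
    qed
    \<comment> \<open>X / Y is not even in V, so factorization leaves only Y / X. Every member is
      thus centred where the strict transform Y / X = 0 meets the new exceptional curve X =
      0.\<close>
    have s: "Y / X \<in> \<rho> k" "Y / X \<in> nonunits (\<rho> k)" if "k \<in> K" for k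
    proof -
      have n: "X / Y \<notin> \<rho> k" using XY sub by blast
      then show "Y / X \<in> \<rho> k"
        using surface_point_factorization[OF St(1) pt St(2)[OF that] ne[OF that]] by blast
      then show "Y / X \<in> nonunits (\<rho> k)" using n by (auto simp: nonunits_def)
    qed
    have mp: "minimal_poly B (Y / X) (\<rho> k) [:0, 1:]" if k: "k \<in> K" for k
      unfolding minimal_poly_def
    proof (intro conjI ballI impI)
      show "[:0, 1:] \<in> B.RT" by (intro B.RT_cl B.cl)
      show "poly [:0, 1:] (Y / X) \<in> nonunits (\<rho> k)" using s[OF k] by simp
      fix Q assume Q: "Q \<in> B.RT" "poly Q (Y / X) \<in> nonunits (\<rho> k)" "degree Q < degree [:0, 1 :: 'a:]"
      then obtain c where c: "Q = [:c:]" by (auto elim: degree_eq_zeroE)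
      then have "c \<in> B" "c \<in> nonunits (\<rho> k)" using Q by (auto simp: polys_def dest: spec[of _ 0])
      then have "c \<in> B.M" using dominatesD(4)[OF St(2)[OF k]] by blast
      then show "Q \<in> B.MT" using B.MT_cl(8)[of c 0] c by (simp add: monom_0)
    qed simp
    interpret q: qt B X Y "\<rho> k1" "[:0, 1:]"
      by (rule qtI) (use q\<rho> k12 St mp s in auto)
    have w: "q.w = Y / X" by (simp add: q.w_def)
    have "dominates (\<rho> k) q.T" if "k \<in> K" for k
    proof -
      interpret k: qt B X Y "\<rho> k" "[:0, 1:]"
        by (rule qtI) (use q\<rho> that St mp s in auto)
      have "q.T = k.T" unfolding q.T_def k.T_def
        by (rule B.minimal_poly_qtransform) (use q\<rho> that k12 St mp s in auto)
      then show ?thesis using k.dominates_ST by simp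
    qed
    moreover have "Y * inverse X \<in> V.M" using St V.unitD by (intro V.nonunits_mult(1)) auto
    ultimately have "St q.T X (Y / X)"
      unfolding St_def using q.regular_pair_T St w by (simp add: divide_inverse)
    moreover have "qstep B X Y q.T X (Y / X)" using q.is_qtransform_T w by (simp add: qstep_def)
    ultimately show "\<exists>B' x' w. qstep B X Y B' x' w \<and> St B' x' w" by blast
  qed (use q\<rho> k12 in \<open>auto simp: St_def\<close>)
  then show False using bad'[OF k12(3)] by blast
qed

theorem no_bad_sequence:
  fixes \<rho> :: "nat \<Rightarrow> 'a::field set"
  assumes V: "valuation_ring V" and D: "regular_pair D x y" and VD: "dominates V D"
    and pt: "\<And>n. surface_point (\<rho> n)" and sub: "\<And>n. \<rho> n \<subseteq> V" and dom: "\<And>n. dominates (\<rho> n) D"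
    and bad: "\<And>n. \<exists>X. finite X \<and> X \<subseteq> \<rho> n \<and> (\<forall>m>n. \<not> X \<subseteq> \<rho> m)"
  shows False
proof -
  have qV: "quasi_local V" using V valuation_ring_quasi_local by blast
  have q\<rho>: "quasi_local (\<rho> n)" for n using pt by (simp add: surface_point_def)
  have bad': "\<not> \<rho> n \<subseteq> \<rho> m" if "n < m" for n m using bad[of n] that by blast
  define St where "St A x y \<longleftrightarrow> regular_pair A x y \<and> dominates V A \<and> (\<forall>n. dominates (\<rho> n) A)" for A x y
  have ne: "\<rho> n \<noteq> A" if "St A x y" for A x y n
  proof
    assume "\<rho> n = A"
    then have "\<rho> n \<subseteq> \<rho> (Suc n)" using that by (auto simp: St_def dominates_def)
    then show False using bad'[of n "Suc n"] by simp
  qed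
  \<comment> \<open>If V is never the order valuation, the transforms along V can be continued for
    ever below all members, and \<open>state_chain_unique\<close> identifies \<rho> 0 with \<rho>
    1.\<close>
  have "\<exists>A x y. St A x y \<and> residually_transcendental A (y / x) V"
  proof (rule ccontr)
    assume no: "\<not> ?thesis"
    have St_sym: "St A y x" if "St A x y" for A x y
      using that regular_pair.regular_pair_sym by (auto simp: St_def)
    have *: "\<exists>B w. is_qtransform A x y B w \<and> St B x w" if St: "St A x y" "y / x \<in> V" for A x y
    proof -
      interpret regular_pair A x y using St by (simp add: St_def)
      obtain B w where B: "is_qtransform A x y B w" "dominates V B"
        "\<And>S. surface_point S \<Longrightarrow> S \<subseteq> V \<Longrightarrow> dominates S A \<Longrightarrow> S \<noteq> A \<Longrightarrow> dominates S B"
        using transform_along_valuation[OF V _ St(2)] St no unfolding St_def by blast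
      have "dominates (\<rho> n) B" for n
        using B(3)[OF pt sub _ ne[OF St(1)]] St by (auto simp: St_def)
      then have "St B x w" using B is_qtransformD(2)[OF B(1)] by (simp add: St_def)
      then show ?thesis using B(1) by blast
    qed
    have "\<rho> 0 = \<rho> 1"
    proof (rule state_chain_unique[of St D x y])
      show "St D x y" using D VD dom by (simp add: St_def)
      fix A x y assume St: "St A x y"
      interpret regular_pair A x y using St by (simp add: St_def)
      have "y / x \<noteq> 0" using x0 y0 by simp
      then have "y / x \<in> V \<or> inverse (y / x) \<in> V" using V unfolding valuation_ring_def by blast
      then show "\<exists>B x' w. qstep A x y B x' w \<and> St B x' w"
        using *[OF St] *[OF St_sym[OF St]] unfolding qstep_def by (auto; blast)
    qed (use q\<rho> in \<open>auto simp: St_def\<close>)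
    then show False using bad'[of 0 1] by simp
  qed
  then obtain A x y where St: "St A x y" and rt: "residually_transcendental A (y / x) V" by blast
  interpret regular_pair A x y using St by (simp add: St_def)
  have "y / x \<in> \<rho> n \<or> x / y \<in> \<rho> n" for n
    using surface_point_factorization[OF regular_pair_axioms pt] ne[OF St] St by (metis St_def)
  then have "UNIV = {n. y / x \<in> \<rho> n} \<union> {n. x / y \<in> \<rho> n}" by blast
  then consider "infinite {n. y / x \<in> \<rho> n}" | "infinite {n. x / y \<in> \<rho> n}"
    by (metis finite_UnI infinite_UNIV_nat)
  then show False
  proof cases
    case 1
    then show False
      using no_bad_sequence_exceptional[OF V regular_pair_axioms _ rt pt sub _ bad] St by (auto simp: St_def)
  next
    case 2
    have "residually_transcendental A (x / y) V"
      using residually_transcendental_sym[OF qV _ rt] St by (auto simp: St_def)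
    then show False
      using no_bad_sequence_exceptional[OF V regular_pair_sym _ _ pt sub _ bad 2] St by (auto simp: St_def)
  qed
qed

section \<open>Two-dimensional regular local rings\<close>

lemma ideal_in_one: "subring R \<Longrightarrow> ideal_in R I \<Longrightarrow> 1 \<in> I \<longleftrightarrow> I = R"
  unfolding ideal_in_def by (metis mult.right_neutral subringD(2) subsetI subset_antisym)

lemma proper_ideal_nonunits:
  assumes "ideal_in R I" "1 \<notin> I"
  shows "I \<subseteq> nonunits R"
proof
  fix a assume a: "a \<in> I"
  then have "a \<in> R" using assms by (auto simp: ideal_in_def)
  moreover have "a = 0 \<or> inverse a \<notin> R"
  proof (rule ccontr)
    assume n: "\<not> ?thesis"
    then have "inverse a * a \<in> I" using assms a unfolding ideal_in_def by blast
    then show False using n assms by simp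
  qed
  ultimately show "a \<in> nonunits R" by (simp add: nonunits_def)
qed

lemma nonunit_in_maximal_ideal:
  assumes R: "subring R" and a: "a \<in> nonunits R"
  obtains N where "maximal_ideal_in R N" "a \<in> N"
proof -
  note cl = subringD[OF R]
  define \<I> where "\<I> = {I. ideal_in R I \<and> a \<in> I \<and> 1 \<notin> I}"
  have "\<exists>N\<in>\<I>. \<forall>X\<in>\<I>. N \<subseteq> X \<longrightarrow> X = N"
  proof (rule subset_Zorn_nonempty)
    have aR: "a \<in> R" using a by (simp add: nonunits_def)
    define I where "I = {r * a | r. r \<in> R}"
    have "ideal_in R I"
      unfolding ideal_in_def
    proof (intro conjI ballI)
      show "I \<subseteq> R" using aR cl by (auto simp: I_def)
      show "0 \<in> I" using cl by (auto simp: I_def)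
      show "u + v \<in> I" if "u \<in> I" "v \<in> I" for u v
        using that cl(3) unfolding I_def by (auto; metis distrib_right)
      show "r * u \<in> I" if "r \<in> R" "u \<in> I" for r u
        using that cl(4) unfolding I_def by (auto; metis mult.assoc)
    qed
    moreover have "a \<in> I" unfolding I_def using cl(2) by force
    moreover have "1 \<notin> I"
    proof
      assume "1 \<in> I"
      then obtain r where r: "r \<in> R" "1 = r * a" by (auto simp: I_def)
      then have "a \<noteq> 0" by auto
      then have "inverse a = r" using r(2) by (simp add: field_simps)
      then show False using a r \<open>a \<noteq> 0\<close> by (simp add: nonunits_def)
    qed
    ultimately show "\<I> \<noteq> {}" unfolding \<I>_def by blast
  next
    fix \<C> assume C: "\<C> \<noteq> {}" "subset.chain \<I> \<C>"
    have sub: "\<C> \<subseteq> \<I>" and tot: "\<And>I J. I \<in> \<C> \<Longrightarrow> J \<in> \<C> \<Longrightarrow> I \<subseteq> J \<or> J \<subseteq> I"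
      using C(2) by (auto simp: subset_chain_def)
    have "ideal_in R (\<Union>\<C>)"
      unfolding ideal_in_def
    proof (intro conjI ballI)
      show "\<Union>\<C> \<subseteq> R" using sub by (auto simp: \<I>_def ideal_in_def)
      show "0 \<in> \<Union>\<C>" using sub C(1) by (auto simp: \<I>_def ideal_in_def)
      show "r * u \<in> \<Union>\<C>" if "r \<in> R" "u \<in> \<Union>\<C>" for r u
        using that sub by (auto simp: \<I>_def ideal_in_def)
      show "u + v \<in> \<Union>\<C>" if uv: "u \<in> \<Union>\<C>" "v \<in> \<Union>\<C>" for u v
      proof -
        obtain I J where IJ: "I \<in> \<C>" "u \<in> I" "J \<in> \<C>" "v \<in> J" using uv by blast
        then obtain K where K: "K \<in> \<C>" "u \<in> K" "v \<in> K" using tot[OF IJ(1,3)] by blast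
        then have "ideal_in R K" using sub by (auto simp: \<I>_def)
        then show ?thesis using K unfolding ideal_in_def by blast
      qed
    qed
    then show "\<Union>\<C> \<in> \<I>" using sub C(1) by (auto simp: \<I>_def)
  qed
  then obtain N where N: "N \<in> \<I>" "\<And>X. X \<in> \<I> \<Longrightarrow> N \<subseteq> X \<Longrightarrow> X = N" by blast
  have "maximal_ideal_in R N"
    unfolding maximal_ideal_in_def
  proof (intro conjI allI impI)
    show "ideal_in R N" "N \<noteq> R" using N(1) cl by (auto simp: \<I>_def)
    fix J assume J: "ideal_in R J \<and> N \<subseteq> J"
    then show "J = N \<or> J = R" using N(2)[of J] N(1) ideal_in_one[OF R, of J] by (auto simp: \<I>_def)
  qed
  then show ?thesis using that N(1) by (auto simp: \<I>_def)
qed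

lemma local_ring_nonunits:
  assumes "local_ring R"
  shows "max_ideal R = nonunits R" "quasi_local R"
proof -
  have R: "subring R" and uniq: "\<exists>!N. maximal_ideal_in R N" using assms by (auto simp: local_ring_def)
  have mx: "maximal_ideal_in R (max_ideal R)" unfolding max_ideal_def by (rule theI'[OF uniq])
  then have id: "ideal_in R (max_ideal R)" "1 \<notin> max_ideal R"
    using ideal_in_one[OF R] by (auto simp: maximal_ideal_in_def)
  show eq: "max_ideal R = nonunits R"
  proof
    show "max_ideal R \<subseteq> nonunits R" using proper_ideal_nonunits id by blast
    show "nonunits R \<subseteq> max_ideal R"
    proof
      fix a assume "a \<in> nonunits R"
      then obtain N where "maximal_ideal_in R N" "a \<in> N" using nonunit_in_maximal_ideal[OF R] by blast
      then show "a \<in> max_ideal R" using uniq mx by blast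
    qed
  qed
  show "quasi_local R" using R id(1) unfolding eq by unfold_locales (auto simp: ideal_in_def)
qed

lemma (in quasi_local) local_ring: "local_ring R"
proof -
  have id: "ideal_in R M"
    unfolding ideal_in_def
    using nonunits_sub zero_nonunit nonunits_add nonunits_mult(2) by blast
  have "maximal_ideal_in R N \<longleftrightarrow> N = M" for N
  proof
    assume N: "maximal_ideal_in R N"
    then have "N \<subseteq> M"
      using proper_ideal_nonunits ideal_in_one[OF subring] by (auto simp: maximal_ideal_in_def)
    then show "N = M" using N id ideal_in_one[OF subring id] one_unit by (auto simp: maximal_ideal_in_def)
  next
    assume N: "N = M"
    show "maximal_ideal_in R N"
      unfolding maximal_ideal_in_def N
    proof (intro conjI allI impI)
      show "M \<noteq> R" using ideal_in_one[OF subring id] one_unit by blast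
      fix J assume J: "ideal_in R J \<and> M \<subseteq> J"
      show "J = M \<or> J = R"
      proof (cases "1 \<in> J")
        case True
        then show ?thesis using ideal_in_one[OF subring] J by blast
      next
        case False
        then show ?thesis using proper_ideal_nonunits J by blast
      qed
    qed (rule id)
  qed
  then show ?thesis using subring by (simp add: local_ring_def)
qed

text \<open>Dimension two enters through this prime, the middle member of a chain; it is what makes
  the generators of the maximal ideal a regular sequence.\<close>

lemma prime_chain_proper_prime:
  assumes R: "quasi_local R" and pc: "prime_chain R 2"
  obtains q where "prime_ideal_in R q" "q \<noteq> {0}" "q \<noteq> nonunits R"
proof -
  interpret quasi_local R by fact
  obtain P where P: "\<And>i. i \<le> 2 \<Longrightarrow> prime_ideal_in R (P i)" "\<And>i. i < 2 \<Longrightarrow> P i \<subset> P (Suc i)"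
    using pc unfolding prime_chain_def by (metis (full_types))
  have lt: "P 0 \<subset> P 1" "P 1 \<subset> P 2" using P(2)[of 0] P(2)[of 1] by (auto simp: numeral_2_eq_2)
  have "0 \<in> P 0" using P(1)[of 0] by (auto simp: prime_ideal_in_def ideal_in_def)
  then have "P 1 \<noteq> {0}" using lt by auto
  moreover have "P 2 \<subseteq> M"
    using P(1)[of 2] proper_ideal_nonunits ideal_in_one[OF subring]
    by (auto simp: prime_ideal_in_def)
  then have "P 1 \<noteq> M" using lt by blast
  ultimately show ?thesis using that P(1)[of 1] by simp
qed

section \<open>Noetherian local rings with maximal ideal (x, y)\<close>

locale noetherian_pair = quasi_local +
  fixes x y :: 'a
  assumes noeth: "noetherian_ring R" and xR: "x \<in> R" and yR: "y \<in> R" and M_span: "nonunits R = span2 R x y"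
begin

lemma noetherian_pair_sym: "noetherian_pair R y x"
  by unfold_locales (simp_all add: noeth xR yR M_span span2_commute[of R x y])

lemma xM: "x \<in> M" and yM: "y \<in> M"
  unfolding M_span using span2_cl[OF xR yR] by auto

lemma ideal_span2: "a \<in> R \<Longrightarrow> b \<in> R \<Longrightarrow> ideal_in R (span2 R a b)"
  by (simp add: ideal_in_def span2_cl(1,2,5,8))

lemma ideal_sum: "ideal_in R I \<Longrightarrow> (\<And>g. g \<in> G \<Longrightarrow> f g \<in> I) \<Longrightarrow> sum f G \<in> I"
  by (induction G rule: infinite_finite_induct) (auto simp: ideal_in_def)

lemma ascending_chain:
  assumes I: "\<And>n::nat. ideal_in R (I n)" and mono: "\<And>n. I n \<subseteq> I (Suc n)"
  obtains N where "I (Suc N) \<subseteq> I N"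
proof -
  have le: "I m \<subseteq> I n" if "m \<le> n" for m n using lift_Suc_mono_le[of I, OF mono that] .
  have "ideal_in R (\<Union>n. I n)"
    unfolding ideal_in_def
  proof (intro conjI ballI)
    show "(\<Union>n. I n) \<subseteq> R" "0 \<in> (\<Union>n. I n)" using I unfolding ideal_in_def by blast+
    show "r * u \<in> (\<Union>n. I n)" if "r \<in> R" "u \<in> (\<Union>n. I n)" for r u
      using that I unfolding ideal_in_def by blast
    show "u + v \<in> (\<Union>n. I n)" if uv: "u \<in> (\<Union>n. I n)" "v \<in> (\<Union>n. I n)" for u v
    proof -
      obtain m n where "u \<in> I m" "v \<in> I n" using uv by blast
      then have "u \<in> I (max m n)" "v \<in> I (max m n)" using le[of m "max m n"] le[of n "max m n"] by auto
      then show ?thesis using I[of "max m n"] unfolding ideal_in_def by blast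
    qed
  qed
  then obtain G where G: "finite G" "G \<subseteq> R" "(\<Union>n. I n) = ideal_gen R G"
    using noeth unfolding noetherian_ring_def by blast
  have "g \<in> ideal_gen R G" if g: "g \<in> G" for g
  proof -
    have "(\<Sum>h\<in>G. (if h = g then 1 else 0) * h) = (\<Sum>h\<in>G. if h = g then g else 0)"
      by (rule sum.cong) auto
    also have "\<dots> = g" using G(1) g by simp
    finally have "g = (\<Sum>h\<in>G. (if h = g then 1 else 0) * h)" by simp
    then show ?thesis unfolding ideal_gen_def using cl(1,2)
      by (intro CollectI exI[of _ "\<lambda>h. if h = g then 1 else 0"]) auto
  qed
  then have "G \<subseteq> (\<Union>n. I n)" using G(3) by blast
  with G(1) have "\<exists>N. G \<subseteq> I N"
  proof (induction G)
    case (insert g G)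
    then obtain N m where "G \<subseteq> I N" "g \<in> I m" by blast
    then have "insert g G \<subseteq> I (max N m)" using le[of N "max N m"] le[of m "max N m"] by auto
    then show ?case by blast
  qed auto
  then obtain N where N: "G \<subseteq> I N" by blast
  have "ideal_gen R G \<subseteq> I N"
  proof
    fix a assume "a \<in> ideal_gen R G"
    then obtain c where c: "a = (\<Sum>g\<in>G. c g * g)" "\<forall>g\<in>G. c g \<in> R" by (auto simp: ideal_gen_def)
    show "a \<in> I N" unfolding c(1)
      by (rule ideal_sum[OF I]) (use I[of N] N c(2) in \<open>auto simp: ideal_in_def\<close>)
  qed
  then show ?thesis using that[of N] G(3) by blast
qed

text \<open>This replaces both Nakayama's lemma and Krull's intersection theorem: iterating the
  hypothesis gives \<open>c\<^sub>n = f e\<^sub>n + s c\<^sub>n\<^sub>+\<^sub>1\<close>, and the ideals \<open>(f, c\<^sub>n)\<close> stabilise.\<close>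

lemma descend:
  assumes p: "p \<subseteq> R" "f \<in> R" "s \<in> M" and st: "\<And>c. c \<in> p \<Longrightarrow> \<exists>e\<in>R. \<exists>d\<in>p. c = f * e + s * d"
    and "c0 \<in> p"
  shows "\<exists>d\<in>R. c0 = f * d"
proof -
  have "\<exists>c. \<forall>n. c n \<in> p \<and> (c 0 = c0) \<and> (\<exists>e\<in>R. c n = f * e + s * c (Suc n))"
  proof -
    obtain g where g: "\<And>c. c \<in> p \<Longrightarrow> g c \<in> p \<and> (\<exists>e\<in>R. c = f * e + s * g c)" using st by metis
    define c where "c n = (g ^^ n) c0" for n
    have cp: "c n \<in> p" for n by (induction n) (use g \<open>c0 \<in> p\<close> in \<open>auto simp: c_def\<close>)
    moreover have "c (Suc n) = g (c n)" for n by (simp add: c_def)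
    ultimately show ?thesis using g by (intro exI[of _ c]) (auto simp: c_def)
  qed
  then obtain c where c: "\<And>n. c n \<in> p" "c 0 = c0" "\<And>n. \<exists>e\<in>R. c n = f * e + s * c (Suc n)" by blast
  have cR: "c n \<in> R" for n using c p by blast
  have sR: "s \<in> R" using p nonunits_sub by blast
  have mono: "span2 R f (c n) \<subseteq> span2 R f (c (Suc n))" for n
  proof
    fix a assume "a \<in> span2 R f (c n)"
    then obtain u v where uv: "u \<in> R" "v \<in> R" "a = f * u + c n * v" by (rule span2E)
    obtain e where e: "e \<in> R" "c n = f * e + s * c (Suc n)" using c(3) by blast
    have "a = f * (u + e * v) + c (Suc n) * (s * v)" unfolding uv e(2) by (simp add: algebra_simps)
    then show "a \<in> span2 R f (c (Suc n))" using uv e sR by (auto intro!: span2I cl)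
  qed
  obtain N where N: "span2 R f (c (Suc N)) \<subseteq> span2 R f (c N)"
    using ascending_chain[of "\<lambda>n. span2 R f (c n)", OF ideal_span2[OF p(2) cR] mono] by blast
  \<comment> \<open>Combined with c N = f e + s c (Suc N), this puts (1 - s v) c (Suc N) into f R,
    and 1 - s v is a unit. Divisibility by f is then pulled back to c 0.\<close>
  have "c (Suc N) \<in> span2 R f (c N)" using N span2_cl(4)[OF p(2) cR] by blast
  then obtain u v where uv: "u \<in> R" "v \<in> R" "c (Suc N) = f * u + c N * v" by (rule span2E)
  obtain e where e: "e \<in> R" "c N = f * e + s * c (Suc N)" using c(3) by blast
  have "1 - s * v \<in> R" "1 - s * v \<notin> M"
    using unit_diff_nonunit[OF cl(2) one_unit nonunits_mult(1)[OF p(3) uv(2)]] sR uv by (auto intro!: cl)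
  then have i: "1 - s * v \<noteq> 0" "inverse (1 - s * v) \<in> R" using unitD[of "1 - s * v"] by blast+
  have "c (Suc N) = f * u + (f * e + s * c (Suc N)) * v" using uv(3) e(2) by metis
  then have "c (Suc N) * (1 - s * v) = f * (u + e * v)" by (simp add: algebra_simps)
  then have "c (Suc N) = f * ((u + e * v) * inverse (1 - s * v))"
    using i(1) by (metis mult.assoc mult.right_neutral right_inverse)
  moreover have "(u + e * v) * inverse (1 - s * v) \<in> R" using i uv(1,2) e(1) by (intro cl)
  ultimately have base: "\<exists>d\<in>R. c (Suc N) = f * d" by blast
  have pull: "\<exists>d\<in>R. c n = f * d" if "\<exists>d\<in>R. c (Suc n) = f * d" for n
  proof -
    from that obtain d where d: "d \<in> R" "c (Suc n) = f * d" by blast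
    obtain e where e: "e \<in> R" "c n = f * e + s * c (Suc n)" using c(3) by blast
    have "c n = f * (e + s * d)" using e d by (simp add: algebra_simps)
    moreover have "e + s * d \<in> R" using e(1) d(1) sR by (intro cl)
    ultimately show ?thesis by blast
  qed
  have "\<exists>d\<in>R. c (Suc N - k) = f * d" if "k \<le> Suc N" for k
    using that
  proof (induction k)
    case (Suc k)
    then have "Suc (Suc N - Suc k) = Suc N - k" by simp
    then show ?case using pull[of "Suc N - Suc k"] Suc by simp
  qed (use base in simp)
  from this[of "Suc N"] show ?thesis using c(2) by simp
qed

text \<open>Krull's intersection theorem for R / xR, whose maximal ideal is generated by y:
  \<open>descend\<close> with f = x and s = y on the intersection of the ideals (x, y^n).\<close>

lemma krull:
  assumes "c \<in> R" "\<And>n. c \<in> span2 R x (y ^ n)"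
  shows "\<exists>d\<in>R. c = x * d"
proof (rule descend[where p = "{c \<in> R. \<forall>n. c \<in> span2 R x (y ^ n)}" and s = y])
  \<comment> \<open>The annihilators of y^k modulo x. Once they are stationary at k and c = x e +
    y^(k+1) c', the element y^k c' lies in the intersection again.\<close>
  define K where "K k = {d \<in> R. \<exists>e\<in>R. y ^ k * d = x * e}" for k
  have idK: "ideal_in R (K k)" for k
    unfolding ideal_in_def
  proof (intro conjI ballI)
    show "K k \<subseteq> R" by (auto simp: K_def)
    show "0 \<in> K k" using cl by (auto simp: K_def)
    show "u + v \<in> K k" if uv: "u \<in> K k" "v \<in> K k" for u v
    proof -
      obtain e e' where "e \<in> R" "y ^ k * u = x * e" "e' \<in> R" "y ^ k * v = x * e'" using uv by (auto simp: K_def)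
      then have "y ^ k * (u + v) = x * (e + e')" "e + e' \<in> R" by (auto simp: algebra_simps intro: cl)
      then show ?thesis using uv cl unfolding K_def by blast
    qed
    show "r * u \<in> K k" if ru: "r \<in> R" "u \<in> K k" for r u
    proof -
      obtain e where "e \<in> R" "y ^ k * u = x * e" using ru by (auto simp: K_def)
      then have "y ^ k * (r * u) = x * (r * e)" "r * e \<in> R" using ru by (auto simp: algebra_simps intro: cl)
      then show ?thesis using ru cl unfolding K_def by blast
    qed
  qed
  have monoK: "K k \<subseteq> K (Suc k)" for k
  proof
    fix d assume "d \<in> K k"
    then obtain e where "d \<in> R" "e \<in> R" "y ^ k * d = x * e" by (auto simp: K_def)
    then have "y ^ Suc k * d = x * (y * e)" "y * e \<in> R" using yR by (auto simp: algebra_simps intro: cl)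
    then show "d \<in> K (Suc k)" using \<open>d \<in> R\<close> unfolding K_def by blast
  qed
  obtain k where k: "K (Suc k) \<subseteq> K k" using ascending_chain[of K] idK monoK by metis
  fix c assume "c \<in> {c \<in> R. \<forall>n. c \<in> span2 R x (y ^ n)}"
  then have c: "c \<in> R" "\<And>n. c \<in> span2 R x (y ^ n)" by auto
  obtain e c' where e: "e \<in> R" "c' \<in> R" "c = x * e + y ^ Suc k * c'" using c(2)[of "Suc k"] by (rule span2E)
  define d where "d = y ^ k * c'"
  have dR: "d \<in> R" using e yR by (auto simp: d_def intro!: cl)
  have "d \<in> span2 R x (y ^ n)" for n
  proof -
    obtain f g where f: "f \<in> R" "g \<in> R" "c = x * f + y ^ (Suc k + n) * g" using c(2) by (rule span2E)
    have "y ^ Suc k * (c' - y ^ n * g) = x * (f - e)"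
      using e(3) f(3) by (simp add: algebra_simps power_add)
    then have "c' - y ^ n * g \<in> K (Suc k)" using e f yR unfolding K_def by (auto intro!: cl)
    then obtain h where h: "h \<in> R" "y ^ k * (c' - y ^ n * g) = x * h" using k by (auto simp: K_def)
    have "d = x * h + y ^ n * (y ^ k * g)" using h(2) by (simp add: d_def algebra_simps)
    then show ?thesis using h f yR by (auto intro!: span2I cl)
  qed
  then show "\<exists>e\<in>R. \<exists>d\<in>{c \<in> R. \<forall>n. c \<in> span2 R x (y ^ n)}. c = x * e + y * d"
    using e dR by (intro bexI[of _ e] bexI[of _ d]) (auto simp: d_def)
qed (use assms xR yM in auto)

text \<open>The maximal ideal of R / xR is generated by y and its powers intersect in 0 by
  \<open>krull\<close>; so nonzero elements there are units times powers of y.\<close>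

lemma mod_x_power:
  assumes "c \<in> R" "\<not> (\<exists>d\<in>R. c = x * d)"
  obtains j u e where "u \<in> R" "u \<notin> M" "e \<in> R" "c = u * y ^ j + x * e"
proof -
  have ex: "\<exists>n. c \<notin> span2 R x (y ^ n)" using krull assms by blast
  define n where "n = (LEAST n. c \<notin> span2 R x (y ^ n))"
  have n: "c \<notin> span2 R x (y ^ n)" "\<And>m. m < n \<Longrightarrow> c \<in> span2 R x (y ^ m)"
    unfolding n_def using LeastI_ex[OF ex] not_less_Least by auto
  have "n \<noteq> 0"
  proof
    assume "n = 0"
    then have "c \<notin> span2 R x 1" using n(1) by simp
    then show False using span2_cl(8)[OF xR cl(2) span2_cl(4)[OF xR cl(2)] assms(1)] by simp
  qed
  then obtain j where j: "n = Suc j" by (cases n) auto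
  from n(2)[of j] obtain e u where e: "e \<in> R" "u \<in> R" "c = x * e + y ^ j * u"
    using j by (auto elim: span2E)
  have "u \<notin> M"
  proof
    assume "u \<in> M"
    then obtain a b where ab: "a \<in> R" "b \<in> R" "u = x * a + y * b" unfolding M_span by (rule span2E)
    have "c = x * (e + y ^ j * a) + y ^ n * b" unfolding e(3) ab(3) j by (simp add: algebra_simps)
    then have "c \<in> span2 R x (y ^ n)" using e ab yR by (auto intro!: span2I cl)
    then show False using n by simp
  qed
  then show ?thesis using that[of u e j] e by (simp add: algebra_simps)
qed

text \<open>An f in p with the least exponent of y modulo x divides the others modulo x, and
  saturation keeps the cofactor of x in p: p = f R + x p. Then \<open>descend\<close> gives p = f R.
  This is the substitute for factoriality.\<close>

lemma saturated_ideal_principal: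
  assumes p: "ideal_in R p" "p \<noteq> {0}" and sat: "\<And>d. d \<in> R \<Longrightarrow> x * d \<in> p \<Longrightarrow> d \<in> p"
  obtains f where "f \<in> p" "\<And>g. g \<in> p \<Longrightarrow> \<exists>d\<in>R. g = f * d"
proof -
  have pR: "p \<subseteq> R" and p0: "0 \<in> p" using p by (auto simp: ideal_in_def)
  have p_diff: "a - b * r \<in> p" if "a \<in> p" "b \<in> p" "r \<in> R" for a b r
  proof -
    have "(- r) * b \<in> p" using p(1) that cl unfolding ideal_in_def by blast
    then have "a + (- r) * b \<in> p" using p(1) that unfolding ideal_in_def by blast
    then show ?thesis by (simp add: mult.commute)
  qed
  define J where "J j g \<longleftrightarrow> g \<in> p \<and> (\<exists>u\<in>R. \<exists>e\<in>R. u \<notin> M \<and> g = u * y ^ j + x * e)" for j g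
  \<comment> \<open>Otherwise p = x p by saturation, and \<open>descend\<close> with f = 0 gives p =
    0.\<close>
  have "\<exists>g\<in>p. \<not> (\<exists>d\<in>R. g = x * d)"
  proof (rule ccontr)
    assume n: "\<not> ?thesis"
    have "\<exists>d\<in>R. c = 0 * d" if "c \<in> p" for c
      by (rule descend[OF pR cl(1) xM _ that]) (use n sat cl(1) in fastforce)
    then have "p = {0}" using p0 by auto
    then show False using p(2) by simp
  qed
  then have ex: "\<exists>j. \<exists>g. J j g" unfolding J_def using mod_x_power pR by (metis subsetD)
  define j where "j = (LEAST j. \<exists>g. J j g)"
  obtain f where f: "J j f" unfolding j_def using LeastI_ex[OF ex] by blast
  have min: "j \<le> k" if "J k g" for k g unfolding j_def by (rule Least_le) (use that in blast)
  obtain u e where fu: "f \<in> p" "u \<in> R" "e \<in> R" "u \<notin> M" "f = u * y ^ j + x * e" using f by (auto simp: J_def)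
  have ui: "u \<noteq> 0" "inverse u \<in> R" using unitD fu by auto
  have st: "\<exists>a\<in>R. \<exists>d\<in>p. g = f * a + x * d" if g: "g \<in> p" for g
  proof (cases "\<exists>d\<in>R. g = x * d")
    case True
    then obtain d where "d \<in> R" "g = x * d" by blast
    then show ?thesis using sat g cl(1) by (intro bexI[of _ 0] bexI[of _ d]) auto
  next
    case False
    then obtain k v e' where v: "v \<in> R" "v \<notin> M" "e' \<in> R" "g = v * y ^ k + x * e'"
      using mod_x_power g pR by (metis subsetD)
    then have "j \<le> k" using min g unfolding J_def by blast
    define a where "a = inverse u * v * y ^ (k - j)"
    have aR: "a \<in> R" using ui v yR by (auto simp: a_def intro!: cl)
    have "u * y ^ j * a = v * (y ^ j * y ^ (k - j))" using ui by (simp add: a_def mult_ac)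
    also have "y ^ j * y ^ (k - j) = y ^ k" using \<open>j \<le> k\<close> by (simp flip: power_add)
    finally have "u * y ^ j * a = v * y ^ k" .
    then have eq: "g - f * a = x * (e' - e * a)" unfolding v(4) fu(5) by (simp add: algebra_simps)
    moreover have "g - f * a \<in> p" using p_diff g fu aR by blast
    ultimately have "e' - e * a \<in> p" using sat v fu aR cl by metis
    moreover have "g = f * a + x * (e' - e * a)" using eq by (simp add: algebra_simps)
    ultimately show ?thesis using aR by blast
  qed
  have "\<exists>d\<in>R. g = f * d" if "g \<in> p" for g
    by (rule descend[OF pR _ xM st that]) (use fu pR in auto)
  then show ?thesis using that fu by blast
qed

text \<open>The prime q is saturated, hence q = f R with f = u y^j + x e and j > 0. For the least m
  with y^m in x R, the product y^(m-j) f equals x h with h in q, and cancelling f puts y^(m-j) into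
  x R.\<close>

lemma power_not_dvd:
  assumes q: "prime_ideal_in R q" "q \<noteq> {0}" "x \<notin> q"
  shows "\<not> (\<exists>d\<in>R. y ^ n = x * d)"
proof
  have id: "ideal_in R q" and q1: "1 \<notin> q"
    using q(1) ideal_in_one[OF subring, of q] by (auto simp: prime_ideal_in_def)
  have qR: "q \<subseteq> R" using id by (simp add: ideal_in_def)
  have qM: "q \<subseteq> M" using proper_ideal_nonunits id q1 by blast
  have sat: "d \<in> q" if "d \<in> R" "x * d \<in> q" for d
    using that q xR by (auto simp: prime_ideal_in_def)
  obtain f where f: "f \<in> q" "\<And>g. g \<in> q \<Longrightarrow> \<exists>d\<in>R. g = f * d"
    using saturated_ideal_principal[OF id q(2) sat] by blast
  have f0: "f \<noteq> 0"
  proof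
    assume "f = 0"
    then have "q \<subseteq> {0}" using f(2) by auto
    then show False using q(2) f(1) by auto
  qed
  have nox: "\<not> (\<exists>d\<in>R. f = x * d)"
  proof
    assume "\<exists>d\<in>R. f = x * d"
    then obtain d where d: "d \<in> R" "f = x * d" by blast
    then have "d \<in> q" using sat f(1) by simp
    then obtain d' where "d' \<in> R" "d = f * d'" using f(2) by blast
    then have "1 = x * d'" using d f0 by auto
    then show False using nonunits_mult(1)[OF xM \<open>d' \<in> R\<close>] one_unit by simp
  qed
  obtain j u e where u: "u \<in> R" "u \<notin> M" "e \<in> R" "f = u * y ^ j + x * e"
    using mod_x_power[OF subsetD[OF qR f(1)] nox] by metis
  have ui: "u \<noteq> 0" "inverse u \<in> R" using unitD u by auto
  assume "\<exists>d\<in>R. y ^ n = x * d"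
  then have ex: "\<exists>n. \<exists>d\<in>R. y ^ n = x * d" by blast
  define m where "m = (LEAST n. \<exists>d\<in>R. y ^ n = x * d)"
  obtain d where d: "d \<in> R" "y ^ m = x * d" using LeastI_ex[OF ex] unfolding m_def by blast
  have min: "\<not> (\<exists>d\<in>R. y ^ k = x * d)" if "k < m" for k using not_less_Least that unfolding m_def by blast
  have "j < m"
  proof (rule ccontr)
    assume "\<not> j < m"
    then have "y ^ j = y ^ m * y ^ (j - m)" by (simp flip: power_add)
    then have "f = x * (u * d * y ^ (j - m) + e)" using u d by (simp add: algebra_simps)
    then show False using nox u d yR by (metis cl(3,4,7))
  qed
  have "j \<noteq> 0"
  proof
    assume "j = 0"
    then have "f \<notin> M" using unit_add_nonunit[OF u(1,2) nonunits_mult(1)[OF xM u(3)]] u(4) by simp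
    then show False using f qM by blast
  qed
  have pow: "y ^ (m - j) * y ^ j = y ^ m" using \<open>j < m\<close> by (simp flip: power_add)
  have "y ^ (m - j) * f = u * (y ^ (m - j) * y ^ j) + x * (e * y ^ (m - j))"
    unfolding u(4) by (simp add: algebra_simps)
  then have eq: "y ^ (m - j) * f = x * (u * d + e * y ^ (m - j))"
    unfolding pow d(2) by (simp add: algebra_simps)
  define h where "h = u * d + e * y ^ (m - j)"
  have hR: "h \<in> R" unfolding h_def using u d yR by (auto intro!: cl)
  have "y ^ (m - j) * f \<in> q" using id f yR cl(7) unfolding ideal_in_def by blast
  then have "h \<in> q" using sat[OF hR] eq by (simp add: h_def)
  then obtain h' where h': "h' \<in> R" "h = f * h'" using f(2) by blast
  then have "f * y ^ (m - j) = f * (x * h')" using eq[folded h_def] by (simp add: mult_ac)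
  then have "y ^ (m - j) = x * h'" using f0 mult_left_cancel by blast
  moreover have "m - j < m" using \<open>j < m\<close> \<open>j \<noteq> 0\<close> by simp
  ultimately show False using min h' by blast
qed

lemma regseq:
  assumes q: "prime_ideal_in R q" "q \<noteq> {0}" "x \<notin> q"
  shows "regseq R x y"
proof unfold_locales
  have nd: "\<not> (\<exists>d\<in>R. y ^ n = x * d)" for n by (rule power_not_dvd[OF q])
  show "x \<in> R" "y \<in> R" by (rule xR, rule yR)
  show "x \<noteq> 0" using q by (auto simp: prime_ideal_in_def ideal_in_def)
  show "y \<noteq> 0" using nd[of 1] cl(1) by force
  fix a b assume ab: "a \<in> R" "b \<in> R" "x * a = y * b"
  show "\<exists>c\<in>R. b = x * c"
  proof (rule ccontr)
    assume "\<not> ?thesis"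
    then obtain j u e where u: "u \<in> R" "u \<notin> M" "e \<in> R" "b = u * y ^ j + x * e"
      using mod_x_power[OF ab(2)] by metis
    have ui: "u \<noteq> 0" "inverse u \<in> R" using unitD u by auto
    have "u * y ^ Suc j = x * (a - y * e)" using ab(3) unfolding u(4) by (simp add: algebra_simps)
    then have "inverse u * (u * y ^ Suc j) = inverse u * (x * (a - y * e))" by (rule arg_cong)
    then have "y ^ Suc j = x * (inverse u * (a - y * e))"
      using ui(1) by (simp add: mult.left_commute[of "inverse u" x] flip: mult.assoc)
    moreover have "inverse u * (a - y * e) \<in> R" using ui ab u yR by (auto intro!: cl)
    ultimately show False using nd[of "Suc j"] by blast
  qed
qed

text \<open>The elements that some power of x multiplies into (a, b) form a saturated ideal, proper
  by \<open>n\<close>; its generator is a common nonunit factor of a and b.\<close>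

lemma coprime_step:
  assumes a: "a \<in> R" and b: "b \<in> R" "b \<noteq> 0" and n: "\<And>n. x ^ n \<notin> span2 R a b"
  shows "\<exists>a'\<in>R. \<exists>b'\<in>R. \<exists>f\<in>M. a = f * a' \<and> b = f * b'"
proof -
  note I = span2_cl[OF a b(1)]
  define p where "p = {d \<in> R. \<exists>n. x ^ n * d \<in> span2 R a b}"
  have id: "ideal_in R p"
    unfolding ideal_in_def
  proof (intro conjI ballI)
    show "p \<subseteq> R" by (auto simp: p_def)
    show "0 \<in> p" using cl(1) I(2) by (auto simp: p_def)
    show "u + v \<in> p" if uv: "u \<in> p" "v \<in> p" for u v
    proof -
      obtain m n where mn: "x ^ m * u \<in> span2 R a b" "x ^ n * v \<in> span2 R a b" using uv by (auto simp: p_def)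
      have "x ^ (m + n) * (u + v) = x ^ n * (x ^ m * u) + x ^ m * (x ^ n * v)"
        by (simp add: algebra_simps power_add)
      also have "\<dots> \<in> span2 R a b" using I(5)[OF I(8)[OF mn(1)] I(8)[OF mn(2)]] cl(7)[OF xR] by blast
      finally show ?thesis using uv cl(3) unfolding p_def by blast
    qed
    show "r * u \<in> p" if ru: "r \<in> R" "u \<in> p" for r u
    proof -
      obtain m where m: "x ^ m * u \<in> span2 R a b" using ru by (auto simp: p_def)
      have "x ^ m * (r * u) = r * (x ^ m * u)" by simp
      also have "\<dots> \<in> span2 R a b" using I(8)[OF m ru(1)] .
      finally show ?thesis using ru cl(4) unfolding p_def by blast
    qed
  qed
  have ab: "a \<in> p" "b \<in> p" using a b I(3,4) by (auto simp: p_def intro: exI[of _ 0])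
  have "1 \<notin> p" using n by (auto simp: p_def)
  then have pM: "p \<subseteq> M" using proper_ideal_nonunits id by blast
  have sat: "d \<in> p" if d: "d \<in> R" "x * d \<in> p" for d
  proof -
    obtain m where "x ^ m * (x * d) \<in> span2 R a b" using d by (auto simp: p_def)
    then have "x ^ Suc m * d \<in> span2 R a b" by (simp add: mult_ac)
    then show ?thesis using d unfolding p_def by blast
  qed
  obtain f where f: "f \<in> p" "\<And>g. g \<in> p \<Longrightarrow> \<exists>d\<in>R. g = f * d"
    using saturated_ideal_principal[OF id _ sat] ab b(2) by blast
  then show ?thesis using ab pM by blast
qed

lemma regular_pair:
  assumes q: "prime_ideal_in R q" "q \<noteq> {0}" "x \<notin> q" and F: "quotient_field_of R"
  shows "regular_pair R x y"
proof -
  interpret r: regseq R x y by (rule regseq[OF q])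
  interpret s: noetherian_pair R y x by (rule noetherian_pair_sym)
  show ?thesis
  proof unfold_locales
    show "nonunits R = span2 R x y" by (rule M_span)
  next
    fix a assume a: "a \<in> R" "a \<noteq> 0"
    show "\<exists>n. a \<notin> mpow R x y n"
    proof (rule ccontr)
      assume "\<not> ?thesis"
      then have a_in: "a \<in> {a \<in> R. \<forall>n. a \<in> mpow R x y n}" using a by auto
      \<comment> \<open>The n-th power of (x, y) lies in (x, y^n), so \<open>krull\<close> extracts
        a factor x, and \<open>mpow_x_cancel\<close> keeps the quotient in all powers;
        \<open>descend\<close> with f = 0 concludes.\<close>
      have "\<exists>d\<in>R. a = 0 * d"
      proof (rule descend[OF _ cl(1) xM _ a_in])
        fix c assume "c \<in> {a \<in> R. \<forall>n. a \<in> mpow R x y n}"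
        then have c: "c \<in> R" "\<And>n. c \<in> mpow R x y n" by auto
        have "c \<in> span2 R x (y ^ n)" for n
        proof (cases n)
          case 0
          then show ?thesis using span2_cl(8)[OF xR cl(2) span2_cl(4)[OF xR cl(2)] c(1)] by simp
        next
          case (Suc k)
          obtain b d where bd: "b \<in> mpow R x y k" "d \<in> R" "c = x * b + y ^ Suc k * d"
            using r.mpow_decomp c by blast
          then show ?thesis using r.mpow_cl(1) Suc by (auto intro!: span2I)
        qed
        then obtain d where d: "d \<in> R" "c = x * d" using krull c by blast
        then have "d \<in> mpow R x y n" for n using r.mpow_x_cancel c(2)[of "Suc n"] by blast
        then show "\<exists>e\<in>R. \<exists>d\<in>{a \<in> R. \<forall>n. a \<in> mpow R x y n}. c = 0 * e + x * d"
          using d cl(1) by auto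
      qed auto
      then show False using a by simp
    qed
  next
    fix z
    show "\<exists>a\<in>R. \<exists>b\<in>R. \<exists>n. b \<noteq> 0 \<and> z = a / b \<and> x ^ n \<in> span2 R a b \<and> y ^ n \<in> span2 R a b"
    proof (rule ccontr)
      assume no: "\<not> ?thesis"
      \<comment> \<open>The denominators of z. If none gives a primary representation,
        \<open>coprime_step\<close> strips nonunit factors from them for ever, and their principal
        ideals, written \<open>span2 R 0 b\<close>, rise without end.\<close>
      define p where "p = {b \<in> R. b \<noteq> 0 \<and> z * b \<in> R}"
      have st: "\<exists>f\<in>M. \<exists>b'\<in>p. b = f * b'" if b: "b \<in> p" for b
      proof -
        define a where "a = z * b"
        have ab: "a \<in> R" "b \<in> R" "b \<noteq> 0" "z = a / b" using b by (auto simp: p_def a_def)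
        note I = span2_cl[OF ab(1,2)]
        have up: "x ^ (m + n) \<in> span2 R a b" "y ^ (m + n) \<in> span2 R a b"
          if "x ^ m \<in> span2 R a b" "y ^ n \<in> span2 R a b" for m n
          using I(7)[OF that(1), of "x ^ n"] I(8)[OF that(2), of "y ^ m"] cl(7) xR yR
          by (auto simp: power_add)
        have "(\<forall>n. x ^ n \<notin> span2 R a b) \<or> (\<forall>n. y ^ n \<notin> span2 R a b)"
          using no ab up by blast
        then have "\<exists>a'\<in>R. \<exists>b'\<in>R. \<exists>f\<in>M. a = f * a' \<and> b = f * b'"
          using coprime_step[OF ab(1,2,3)] s.coprime_step[OF ab(1,2,3)] by blast
        then obtain a' b' f where f: "a' \<in> R" "b' \<in> R" "f \<in> M" "a = f * a'" "b = f * b'" by blast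
        then have "f \<noteq> 0" "b' \<noteq> 0" using ab by auto
        then have "z * b' = a'" using ab(4) f by simp
        then have "b' \<in> p" using f \<open>b' \<noteq> 0\<close> by (simp add: p_def)
        then show ?thesis using f by blast
      qed
      obtain a0 b0 where "a0 \<in> R" "b0 \<in> R" "b0 \<noteq> 0" "z = a0 / b0" using F unfolding quotient_field_of_def by blast
      then have b0: "b0 \<in> p" by (simp add: p_def)
      obtain g f where gf: "\<And>b. b \<in> p \<Longrightarrow> g b \<in> p \<and> f b \<in> M \<and> b = f b * g b" using st by metis
      define c where "c n = (g ^^ n) b0" for n
      have cp: "c n \<in> p" for n by (induction n) (use gf b0 in \<open>auto simp: c_def\<close>)
      have cS: "c n = f (c n) * c (Suc n)" "f (c n) \<in> M" for n using gf[OF cp[of n]] by (auto simp: c_def)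
      have cR: "c n \<in> R" "c n \<noteq> 0" for n using cp[of n] by (auto simp: p_def)
      have mono: "span2 R 0 (c n) \<subseteq> span2 R 0 (c (Suc n))" for n
      proof
        fix d assume "d \<in> span2 R 0 (c n)"
        then obtain u v where "u \<in> R" "v \<in> R" "d = 0 * u + c n * v" by (rule span2E)
        then have "d = 0 * 0 + c (Suc n) * (f (c n) * v)" using cS(1)[of n] by (simp add: mult_ac)
        then show "d \<in> span2 R 0 (c (Suc n))"
          using cS(2) nonunits_sub \<open>v \<in> R\<close> cl(1,4) span2I by metis
      qed
      obtain N where N: "span2 R 0 (c (Suc N)) \<subseteq> span2 R 0 (c N)"
        using ascending_chain[of "\<lambda>n. span2 R 0 (c n)", OF ideal_span2[OF cl(1) cR(1)] mono] by blast
      have "c (Suc N) \<in> span2 R 0 (c N)" using N span2_cl(4)[OF cl(1) cR(1)] by blast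
      then obtain u v where uv: "v \<in> R" "c (Suc N) = 0 * u + c N * v" by (rule span2E)
      then have "c (Suc N) * 1 = c (Suc N) * (f (c N) * v)" using cS(1)[of N] by (simp add: mult_ac)
      then have "1 = f (c N) * v" using cR(2) mult_left_cancel by blast
      then show False using nonunits_mult(1)[OF cS(2) uv(1)] one_unit by metis
    qed
  qed
qed

end

theorem regular_local_regular_pair:
  assumes R: "regular_local R 2" and F: "quotient_field_of R"
  shows "\<exists>x y. regular_pair R x y"
proof -
  have lr: "local_ring R" and no: "noetherian_ring R" and kd: "prime_chain R 2"
    using R by (auto simp: regular_local_def krull_dim_eq_def)
  interpret quasi_local R by (rule local_ring_nonunits[OF lr])
  obtain G where G: "card G = 2" "G \<subseteq> R" "M = ideal_gen R G"
    using R local_ring_nonunits(1)[OF lr] by (auto simp: regular_local_def)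
  obtain x y where xy: "G = {x, y}" "x \<noteq> y" using G(1) by (auto simp: card_2_iff)
  have "M = span2 R x y"
  proof (intro equalityI subsetI)
    fix a assume "a \<in> M"
    then obtain c where "a = (\<Sum>g\<in>G. c g * g)" "\<forall>g\<in>G. c g \<in> R" unfolding G(3) ideal_gen_def by blast
    then have "a = x * c x + y * c y" "c x \<in> R" "c y \<in> R" using xy by (auto simp: mult.commute)
    then show "a \<in> span2 R x y" by (auto intro: span2I)
  next
    fix a assume "a \<in> span2 R x y"
    then obtain u v where uv: "u \<in> R" "v \<in> R" "a = x * u + y * v" by (rule span2E)
    define c where "c g = (if g = x then u else v)" for g
    have "a = (\<Sum>g\<in>G. c g * g)" "\<forall>g\<in>G. c g \<in> R" using xy uv by (auto simp: c_def mult.commute)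
    then show "a \<in> M" unfolding G(3) ideal_gen_def by blast
  qed
  then interpret noetherian_pair R x y by unfold_locales (use no G xy in auto)
  obtain q where q: "prime_ideal_in R q" "q \<noteq> {0}" "q \<noteq> M"
    using prime_chain_proper_prime[OF quasi_local_axioms kd] by blast
  have id: "ideal_in R q" "1 \<notin> q" using q(1) ideal_in_one[OF subring] by (auto simp: prime_ideal_in_def)
  have "x \<notin> q \<or> y \<notin> q"
  proof (rule ccontr)
    assume n: "\<not> ?thesis"
    have "M \<subseteq> q"
    proof
      fix a assume "a \<in> M"
      then obtain u v where uv: "u \<in> R" "v \<in> R" "a = x * u + y * v" unfolding M_span by (rule span2E)
      then have "u * x \<in> q" "v * y \<in> q" using n id(1) unfolding ideal_in_def by blast+
      then show "a \<in> q" using id(1) uv(3) unfolding ideal_in_def by (simp add: mult.commute)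
    qed
    then show False using q(3) proper_ideal_nonunits id by blast
  qed
  then show ?thesis
    using regular_pair[OF q(1,2) _ F] noetherian_pair.regular_pair[OF noetherian_pair_sym q(1,2) _ F] by blast
qed

section \<open>Valuation rings dominating a subring\<close>

text \<open>The degree reduction in Chevalley's extension theorem. The relation in 1/z reads 1 - b =
  p(1/z) / z with 1 - b a unit, so z^(n+1) is a unit times z^n p(1/z), and this replaces the top
  term of the relation in z.\<close>

lemma lower_relation_degree:
  assumes A: "subring A" and I: "\<And>a b. a \<in> I \<Longrightarrow> b \<in> I \<Longrightarrow> a + b \<in> I"
    "\<And>a b. a \<in> I \<Longrightarrow> b \<in> A \<Longrightarrow> a * b \<in> I" "0 \<in> I" "I \<subseteq> A"
    and unit: "\<And>i. i \<in> I \<Longrightarrow> 1 - i \<noteq> 0 \<and> inverse (1 - i) \<in> A"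
    and z: "z \<noteq> 0" and n: "m \<le> Suc n"
    and s: "s \<in> polys I" "degree s \<le> Suc n" "poly s z = 1"
    and s': "s' \<in> polys I" "degree s' \<le> m" "poly s' (inverse z) = 1"
  shows "\<exists>s\<in>polys I. degree s \<le> n \<and> poly s z = 1"
proof -
  obtain b p where p: "s' = pCons b p" by (cases s') auto
  have bI: "b \<in> I" using s'(1) unfolding p polys_def by (auto dest: spec[of _ 0])
  have pI: "p \<in> polys I" using s'(1) unfolding p polys_def by (auto dest: spec[of _ "Suc _"])
  have dp: "degree p \<le> n" using s'(2) n p by (cases "p = 0") auto
  note u = unit[OF bI]
  \<comment> \<open>\<open>reflect_poly\<close> reverses with respect to the actual degree of p; the
    monomial makes up the difference to n.\<close>
  define T where "T = monom 1 (n - degree p) * reflect_poly p"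
  have "reflect_poly p \<in> polys I" using pI I(3) by (rule polys_reflect)
  then have TI: "T \<in> polys I" unfolding T_def using I(3) by (auto simp: polys_def coeff_monom_mult)
  have "degree T \<le> degree (monom (1 :: 'a) (n - degree p)) + degree (reflect_poly p)"
    unfolding T_def by (rule degree_mult_le)
  also have "\<dots> \<le> n" using degree_monom_le[of "1 :: 'a" "n - degree p"] degree_reflect_poly_le[of p] dp by linarith
  finally have dT: "degree T \<le> n" .
  have "poly T z = z ^ (n - degree p) * (z ^ degree p * poly p (inverse z))"
    unfolding T_def using poly_reflect_poly_nz[OF z, of p] by (simp add: poly_monom)
  also have "\<dots> = z ^ n * poly p (inverse z)" using dp by (simp flip: power_add mult.assoc)
  also have "poly p (inverse z) = z * (1 - b)" using s'(3) z unfolding p by (simp add: field_simps)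
  finally have "poly T z = z ^ Suc n * (1 - b)" by (simp add: mult_ac)
  then have zT: "z ^ Suc n = inverse (1 - b) * poly T z" using u by (simp add: mult.commute)
  define c where "c = coeff s (Suc n)"
  define s1 where "s1 = s - monom c (Suc n)"
  have cI: "c \<in> I" using s(1) by (simp add: c_def polys_def)
  have s1I: "s1 \<in> polys I" using s(1) I(3) by (auto simp: s1_def c_def polys_def)
  have ds1: "degree s1 \<le> n"
  proof (rule degree_le, intro allI impI)
    fix i assume "n < i"
    then show "coeff s1 i = 0"
      using s(2) by (cases "i = Suc n") (auto simp: s1_def c_def coeff_eq_0)
  qed
  define r where "r = s1 + smult (c * inverse (1 - b)) T"
  have "c * inverse (1 - b) \<in> I" using I(2) cI u by blast
  then have "r \<in> polys I" unfolding r_def using s1I TI I(1,2,4) by (auto simp: polys_def subset_iff)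
  moreover have "degree r \<le> n" unfolding r_def using ds1 dT
    by (intro degree_add_le) (auto intro: order.trans[OF degree_smult_le])
  moreover have "poly r z = 1"
  proof -
    have "poly r z = poly s1 z + c * z ^ Suc n" unfolding r_def zT by (simp add: mult_ac)
    also have "\<dots> = poly s z" by (simp add: s1_def poly_monom)
    finally show ?thesis using s(3) by simp
  qed
  ultimately show ?thesis by blast
qed

text \<open>Chevalley's theorem for the ideal (x, y): a subring A that is maximal with 1 \<notin>
  (x, y) A is a valuation ring.\<close>

theorem valuation_ring_extension:
  assumes R: "subring R" "x \<in> R" "y \<in> R" "1 \<notin> span2 R x y"
  obtains V where "valuation_ring V" "R \<subseteq> V" "x \<in> nonunits V" "y \<in> nonunits V"
proof -
  define \<A> where "\<A> = {A. subring A \<and> R \<subseteq> A \<and> 1 \<notin> span2 A x y}"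
  have "\<exists>A\<in>\<A>. \<forall>X\<in>\<A>. A \<subseteq> X \<longrightarrow> X = A"
  proof (rule subset_Zorn_nonempty)
    show "\<A> \<noteq> {}" using R by (auto simp: \<A>_def)
    fix \<C> assume C: "\<C> \<noteq> {}" "subset.chain \<A> \<C>"
    have sub: "\<C> \<subseteq> \<A>" and tot: "\<And>I J. I \<in> \<C> \<Longrightarrow> J \<in> \<C> \<Longrightarrow> I \<subseteq> J \<or> J \<subseteq> I"
      using C(2) by (auto simp: subset_chain_def)
    have two: "\<exists>K\<in>\<C>. u \<in> K \<and> v \<in> K" if uv: "u \<in> \<Union>\<C>" "v \<in> \<Union>\<C>" for u v
      using uv tot by blast
    have sr: "subring K" if "K \<in> \<C>" for K using that sub by (auto simp: \<A>_def)
    have "subring (\<Union>\<C>)"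
      unfolding subring_def
    proof (intro conjI ballI)
      show "0 \<in> \<Union>\<C>" "1 \<in> \<Union>\<C>" using C(1) sr subringD(1,2) by blast+
      fix u assume u: "u \<in> \<Union>\<C>"
      then show "- u \<in> \<Union>\<C>" using sr subringD(5) by blast
      fix v assume v: "v \<in> \<Union>\<C>"
      obtain K where K: "K \<in> \<C>" "u \<in> K" "v \<in> K" using two[OF u v] by blast
      then show "u + v \<in> \<Union>\<C>" "u * v \<in> \<Union>\<C>" using subringD(3,4)[OF sr[OF K(1)]] by blast+
    qed
    moreover have "1 \<notin> span2 (\<Union>\<C>) x y"
    proof
      assume "1 \<in> span2 (\<Union>\<C>) x y"
      then obtain u v where uv: "u \<in> \<Union>\<C>" "v \<in> \<Union>\<C>" "1 = x * u + y * v" by (rule span2E)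
      obtain K where K: "K \<in> \<C>" "u \<in> K" "v \<in> K" using two[OF uv(1,2)] by blast
      then have "1 \<in> span2 K x y" using uv(3) span2I[of u K v x y] by simp
      then show False using K sub by (auto simp: \<A>_def)
    qed
    moreover have "R \<subseteq> \<Union>\<C>" using sub C(1) by (auto simp: \<A>_def)
    ultimately show "\<Union>\<C> \<in> \<A>" by (simp add: \<A>_def)
  qed
  then obtain A where A_in: "A \<in> \<A>" and A_max: "\<And>X. X \<in> \<A> \<Longrightarrow> A \<subseteq> X \<Longrightarrow> X = A" by blast
  then have A: "subring A" "R \<subseteq> A" "1 \<notin> span2 A x y" by (auto simp: \<A>_def)
  have mx: "X = A" if "subring X" "A \<subseteq> X" "1 \<notin> span2 X x y" for X
    using A_max[of X] that A(2) by (simp add: \<A>_def)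
  note cl = subringD[OF A(1)]
  have xA: "x \<in> A" and yA: "y \<in> A" using R A by auto
  define I where "I = span2 A x y"
  note I = subring_span2[OF A(1) xA yA, folded I_def]
  have I1: "1 \<notin> I" using A by (simp add: I_def)
  have ne: "1 - i \<noteq> 0" if "i \<in> I" for i using that I1 by auto
  \<comment> \<open>Inverting the elements 1 - j keeps the ideal (x, y) proper, so by maximality
    they are already units of A.\<close>
  have unit: "1 - i \<noteq> 0 \<and> inverse (1 - i) \<in> A" if i: "i \<in> I" for i
  proof
    define X where "X = {a * inverse (1 - j) | a j. a \<in> A \<and> j \<in> I}"
    have XI: "a * inverse (1 - j) \<in> X" if "a \<in> A" "j \<in> I" for a j using that by (auto simp: X_def)
    have mulI: "(1 - j) * (1 - k) = 1 - (j + k - j * k)" "j + k - j * k \<in> I" if "j \<in> I" "k \<in> I" for j k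
      using that I(1) by (auto simp: algebra_simps intro!: I(5,6,7))
    have "subring X"
      unfolding subring_def
    proof (intro conjI ballI)
      show "0 \<in> X" "1 \<in> X" using XI[OF cl(1) I(2)] XI[OF cl(2) I(2)] by auto
      fix u assume "u \<in> X"
      then obtain a j where u: "u = a * inverse (1 - j)" "a \<in> A" "j \<in> I" by (auto simp: X_def)
      show "- u \<in> X" using XI[OF cl(5)[OF u(2)] u(3)] u(1) by simp
      fix v assume "v \<in> X"
      then obtain b k where v: "v = b * inverse (1 - k)" "b \<in> A" "k \<in> I" by (auto simp: X_def)
      note m = mulI[OF u(3) v(3)]
      have jA: "j \<in> A" "k \<in> A" using u(3) v(3) I(1) by auto
      have "u + v = (a * (1 - k) + b * (1 - j)) * inverse ((1 - j) * (1 - k))"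
        using ne[OF u(3)] ne[OF v(3)] unfolding u(1) v(1) by (simp add: field_simps)
      moreover have "a * (1 - k) + b * (1 - j) \<in> A" using u(2) v(2) jA by (intro cl)
      ultimately show "u + v \<in> X" using XI m by simp
      have "u * v = (a * b) * inverse ((1 - j) * (1 - k))" unfolding u v by (simp add: mult_ac)
      moreover have "a * b \<in> A" using u v by (intro cl)
      ultimately show "u * v \<in> X" using XI m by simp
    qed
    moreover have "A \<subseteq> X"
    proof
      fix a assume "a \<in> A"
      then show "a \<in> X" using XI[OF _ I(2)] by simp
    qed
    moreover have "1 \<notin> span2 X x y"
    proof
      assume "1 \<in> span2 X x y"
      then obtain u v where uv: "u \<in> X" "v \<in> X" "1 = x * u + y * v" by (rule span2E)
      obtain a j where u: "u = a * inverse (1 - j)" "a \<in> A" "j \<in> I" using uv by (auto simp: X_def)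
      obtain b k where v: "v = b * inverse (1 - k)" "b \<in> A" "k \<in> I" using uv by (auto simp: X_def)
      have jA: "j \<in> A" "k \<in> A" using u(3) v(3) I(1) by auto
      have uj: "u * (1 - j) = a" "v * (1 - k) = b" using u v ne by auto
      have "(1 - j) * (1 - k) = (x * u + y * v) * ((1 - j) * (1 - k))" unfolding uv(3)[symmetric] by simp
      also have "\<dots> = x * (u * (1 - j) * (1 - k)) + y * (v * (1 - k) * (1 - j))"
        by (simp add: algebra_simps)
      also have "\<dots> \<in> I" unfolding uj I_def using u(2) v(2) jA by (intro span2I cl)
      finally have "1 - (j + k - j * k) \<in> I" using mulI(1)[OF u(3) v(3)] by simp
      then have "1 - (j + k - j * k) + (j + k - j * k) \<in> I" using mulI(2)[OF u(3) v(3)] by (rule I(5))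
      then show False using I1 by simp
    qed
    ultimately have "X = A" by (rule mx)
    moreover have "1 * inverse (1 - i) \<in> X" using XI[OF cl(2) i] .
    ultimately show "inverse (1 - i) \<in> A" by simp
  qed (use ne i in auto)
  \<comment> \<open>A[z] is strictly larger than A, so the extended ideal contains 1: this is a
    relation for z with coefficients in I.\<close>
  have one: "\<exists>s\<in>polys I. poly s z = 1" if z: "z \<notin> A" for z
  proof -
    define X where "X = {poly p z | p. p \<in> polys A}"
    note P = subring_polys[OF A(1)]
    have XI: "poly p z \<in> X" if "p \<in> polys A" for p using that by (auto simp: X_def)
    have "subring X"
      unfolding subring_def
    proof (intro conjI ballI)
      show "0 \<in> X" "1 \<in> X" using XI[OF P(1)] XI[OF P(2)] by auto
      fix u assume "u \<in> X"
      then obtain p where p: "u = poly p z" "p \<in> polys A" by (auto simp: X_def)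
      show "- u \<in> X" using XI[OF P(5)[OF p(2)]] p by simp
      fix v assume "v \<in> X"
      then obtain q where q: "v = poly q z" "q \<in> polys A" by (auto simp: X_def)
      show "u + v \<in> X" "u * v \<in> X" using XI[OF P(3)[OF p(2) q(2)]] XI[OF P(6)[OF p(2) q(2)]] p q by auto
    qed
    moreover have "A \<subseteq> X"
    proof
      fix a assume "a \<in> A"
      then show "a \<in> X" using XI[of "[:a:]"] P(9)[OF _ P(1)] by simp
    qed
    moreover have "z \<in> X" using XI[of "[:0, 1:]"] P(9)[OF cl(1) P(9)[OF cl(2) P(1)]] by simp
    then have "X \<noteq> A" using z by blast
    ultimately have "1 \<in> span2 X x y" using mx by blast
    then obtain u v where uv: "u \<in> X" "v \<in> X" "1 = x * u + y * v" by (rule span2E)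
    then obtain p q where pq: "u = poly p z" "p \<in> polys A" "v = poly q z" "q \<in> polys A" by (auto simp: X_def)
    have "smult x p + smult y q \<in> polys I"
      using pq unfolding polys_def I_def by (auto intro!: span2I)
    moreover have "poly (smult x p + smult y q) z = 1" using uv pq by simp
    ultimately show ?thesis by blast
  qed
  \<comment> \<open>Whichever of the two relations has the larger degree bound is shortened by the
    other; a relation of degree 0 would say 1 \<in> I.\<close>
  have descent: False
    if "z \<noteq> 0" "s \<in> polys I" "degree s \<le> n" "poly s z = 1" "s' \<in> polys I" "degree s' \<le> m" "poly s' (inverse z) = 1"
    for z s s' n m
    using that
  proof (induction "n + m" arbitrary: n m s s' z rule: less_induct)
    case less
    have deg0: False if p: "p \<in> polys I" "degree p \<le> 0" "poly p w = 1" for p w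
    proof -
      obtain c where "p = [:c:]" using p(2) by (auto elim: degree_eq_zeroE)
      then show False using p I1 by (auto simp: polys_def dest: spec[of _ 0])
    qed
    note L = lower_relation_degree[OF A(1) I(5,7,2,1) unit]
    show False
    proof (cases "m \<le> n")
      case True
      show False
      proof (cases n)
        case 0
        then show False using deg0 less.prems by blast
      next
        case (Suc k)
        then obtain r where "r \<in> polys I" "degree r \<le> k" "poly r z = 1"
          using L[of z m k s s'] less.prems True by auto
        then show False using less.hyps[of k m z r s'] less.prems Suc by simp
      qed
    next
      case False
      show False
      proof (cases m)
        case 0
        then show False using deg0 less.prems by blast
      next
        case (Suc k)
        then obtain r where "r \<in> polys I" "degree r \<le> k" "poly r (inverse z) = 1"
          using L[of "inverse z" n k s' s] less.prems False by auto
        then show False using less.hyps[of n k z s r] less.prems Suc by simp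
      qed
    qed
  qed
  have "valuation_ring A"
    unfolding valuation_ring_def
  proof (intro conjI allI impI A(1))
    fix z :: 'a assume z: "z \<noteq> 0"
    show "z \<in> A \<or> inverse z \<in> A"
    proof (rule ccontr)
      assume "\<not> ?thesis"
      then obtain s s' where "s \<in> polys I" "poly s z = 1" "s' \<in> polys I" "poly s' (inverse z) = 1"
        using one by meson
      then show False using descent[OF z _ order_refl _ _ order_refl] by blast
    qed
  qed
  moreover have "x \<in> nonunits A" "y \<in> nonunits A"
  proof -
    have *: False if "w \<in> I" "w \<noteq> 0" "inverse w \<in> A" for w
      using I(7)[OF that(1,3)] that(2) I1 by simp
    show "x \<in> nonunits A" "y \<in> nonunits A"
      using *[OF I(3)] *[OF I(4)] xA yA by (auto simp: nonunits_def)
  qed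
  ultimately show ?thesis using that A(2) by blast
qed

section \<open>Noetherian spaces and irreducible components\<close>

text \<open>Along such a sequence the closures of the tails never become stationary. Conversely,
  points picked from the differences of a descending chain of closed sets have complements of its
  members as separating neighbourhoods.\<close>

lemma noetherian_space_iff:
  "noetherian_space T \<longleftrightarrow>
    \<not> (\<exists>\<rho>::nat \<Rightarrow> 'b. \<forall>n. \<rho> n \<in> topspace T \<and> (\<exists>U. openin T U \<and> \<rho> n \<in> U \<and> (\<forall>m>n. \<rho> m \<notin> U)))"
proof
  assume N: "noetherian_space T"
  show "\<not> (\<exists>\<rho>::nat \<Rightarrow> 'b. \<forall>n. \<rho> n \<in> topspace T \<and> (\<exists>U. openin T U \<and> \<rho> n \<in> U \<and> (\<forall>m>n. \<rho> m \<notin> U)))"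
  proof
    assume "\<exists>\<rho>::nat \<Rightarrow> 'b. \<forall>n. \<rho> n \<in> topspace T \<and> (\<exists>U. openin T U \<and> \<rho> n \<in> U \<and> (\<forall>m>n. \<rho> m \<notin> U))"
    then obtain \<rho> :: "nat \<Rightarrow> 'b" where \<rho>: "\<And>n. \<rho> n \<in> topspace T"
      "\<And>n. \<exists>U. openin T U \<and> \<rho> n \<in> U \<and> (\<forall>m>n. \<rho> m \<notin> U)" by blast
    define C where "C n = T closure_of (\<rho> ` {n..})" for n
    have "\<forall>n. closedin T (C n) \<and> C (Suc n) \<subseteq> C n"
      unfolding C_def by (auto intro!: closure_of_mono)
    then obtain n where n: "\<forall>m\<ge>n. C m = C n" using N unfolding noetherian_space_def by blast
    have "\<rho> ` {n..} \<subseteq> C n" unfolding C_def using \<rho>(1) by (intro closure_of_subset) auto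
    then have "\<rho> n \<in> C (Suc n)" using n by (metis Suc_n_not_le_n atLeast_iff image_subset_iff le_cases order_refl)
    moreover obtain U where "openin T U" "\<rho> n \<in> U" "\<forall>m>n. \<rho> m \<notin> U" using \<rho>(2) by blast
    ultimately show False unfolding C_def in_closure_of by auto
  qed
next
  assume no: "\<not> (\<exists>\<rho>::nat \<Rightarrow> 'b. \<forall>n. \<rho> n \<in> topspace T \<and> (\<exists>U. openin T U \<and> \<rho> n \<in> U \<and> (\<forall>m>n. \<rho> m \<notin> U)))"
  show "noetherian_space T"
    unfolding noetherian_space_def
  proof (intro allI impI, rule ccontr)
    fix C :: "nat \<Rightarrow> 'b set"
    assume C: "\<forall>n. closedin T (C n) \<and> C (Suc n) \<subseteq> C n" and ns: "\<not> (\<exists>N. \<forall>n\<ge>N. C n = C N)"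
    have mono: "C n \<subseteq> C m" if "m \<le> n" for m n using lift_Suc_antimono_le[of C, OF _ that] C by blast
    have "\<exists>n\<ge>N. C n \<noteq> C N" for N using ns by blast
    \<comment> \<open>\<open>g\<close> jumps to a later member that differs, so the chain is strict
      along the iterates \<open>k\<close>.\<close>
    then obtain g where g: "\<And>N. g N \<ge> N" "\<And>N. C (g N) \<noteq> C N" by metis
    define k where "k n = (g ^^ n) 0" for n
    have k: "k (Suc n) = g (k n)" for n by (simp add: k_def)
    have kmono: "mono k" by (rule mono_iff_le_Suc[THEN iffD2]) (use g k in auto)
    have "\<exists>p. p \<in> C (k n) - C (k (Suc n))" for n
      using g(2)[of "k n"] mono[OF g(1)[of "k n"]] k by auto
    then obtain \<rho> where \<rho>: "\<And>n. \<rho> n \<in> C (k n) - C (k (Suc n))" by metis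
    have "\<rho> n \<in> topspace T \<and> (\<exists>U. openin T U \<and> \<rho> n \<in> U \<and> (\<forall>m>n. \<rho> m \<notin> U))" for n
    proof -
      have cl: "closedin T (C m)" for m using C by blast
      have "\<rho> n \<in> topspace T" using \<rho>[of n] closedin_subset[OF cl] by blast
      moreover have "\<rho> m \<notin> topspace T - C (k (Suc n))" if "m > n" for m
        using \<rho>[of m] mono[OF monoD[OF kmono Suc_leI[OF that]]] by blast
      ultimately show ?thesis using cl[of "k (Suc n)"] \<rho>[of n]
        by (intro conjI exI[of _ "topspace T - C (k (Suc n))"]) auto
    qed
    then show False using no by blast
  qed
qed

lemma irreducible_in_finite_union:
  assumes C: "irreducible_in T C" and F: "finite F" "\<And>I. I \<in> F \<Longrightarrow> closedin T I" "C \<subseteq> \<Union>F"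
  shows "\<exists>I\<in>F. C \<subseteq> I"
  using F
proof (induction F)
  case empty
  then show ?case using C by (auto simp: irreducible_in_def)
next
  case (insert I F)
  have "closedin T (\<Union>F)" using insert by (intro closedin_Union) auto
  then have "C \<subseteq> I \<or> C \<subseteq> \<Union>F" using C insert unfolding irreducible_in_def by auto
  then show ?case using insert by auto
qed

text \<open>Noetherian induction: a closed set that is not a finite union of irreducible closed sets
  could be shrunk for ever. The components are then among the pieces of the whole space.\<close>

lemma noetherian_space_finite_components:
  assumes N: "noetherian_space T"
  shows "finite (irreducible_components T)"
proof -
  define fin where "fin C \<longleftrightarrow> (\<exists>F. finite F \<and> (\<forall>I\<in>F. irreducible_in T I \<and> closedin T I) \<and> C = \<Union>F)" for C
  have "fin C" if C: "closedin T C" for C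
  proof (rule ccontr)
    assume nf: "\<not> fin C"
    have st: "\<exists>C'. (closedin T C' \<and> \<not> fin C') \<and> C' \<subset> C" if C: "closedin T C \<and> \<not> fin C" for C
    proof -
      have "fin {}" unfolding fin_def by (intro exI[of _ "{}"]) simp
      then have "C \<noteq> {}" using C by blast
      moreover have "\<not> irreducible_in T C" using C unfolding fin_def by (auto dest!: spec[of _ "{C}"])
      ultimately obtain A B where AB: "closedin T A" "closedin T B" "C \<subseteq> A \<union> B" "\<not> C \<subseteq> A" "\<not> C \<subseteq> B"
        using C closedin_subset unfolding irreducible_in_def by blast
      have cl: "closedin T (C \<inter> A)" "closedin T (C \<inter> B)" using C AB by auto
      have "\<not> (fin (C \<inter> A) \<and> fin (C \<inter> B))"
      proof
        assume f: "fin (C \<inter> A) \<and> fin (C \<inter> B)"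
        obtain F where F: "finite F" "\<forall>I\<in>F. irreducible_in T I \<and> closedin T I" "C \<inter> A = \<Union>F"
          using f unfolding fin_def by (elim conjE exE)
        obtain G where G: "finite G" "\<forall>I\<in>G. irreducible_in T I \<and> closedin T I" "C \<inter> B = \<Union>G"
          using f unfolding fin_def by (elim conjE exE)
        have "C = (C \<inter> A) \<union> (C \<inter> B)" using AB(3) by blast
        then have "C = \<Union>(F \<union> G)" using F(3) G(3) by simp
        moreover have "finite (F \<union> G)" "\<forall>I\<in>F \<union> G. irreducible_in T I \<and> closedin T I"
          using F G by auto
        ultimately have "fin C" unfolding fin_def by (intro exI[of _ "F \<union> G"] conjI)
        then show False using C by blast
      qed
      then show ?thesis using cl AB by blast
    qed
    obtain h where h: "\<And>C. closedin T C \<and> \<not> fin C \<Longrightarrow> (closedin T (h C) \<and> \<not> fin (h C)) \<and> h C \<subset> C"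
      using st by metis
    define f where "f n = (h ^^ n) C" for n
    have fn: "closedin T (f n) \<and> \<not> fin (f n)" for n
      by (induction n) (use h C nf in \<open>simp_all add: f_def\<close>)
    have f: "f (Suc n) \<subset> f n" for n using h[OF fn[of n]] by (simp add: f_def)
    have "\<forall>n. closedin T (f n) \<and> f (Suc n) \<subseteq> f n" using fn f by blast
    then obtain n where n: "\<forall>m\<ge>n. f m = f n" using N unfolding noetherian_space_def by blast
    have "n \<le> Suc n" by simp
    with n have "f (Suc n) = f n" by blast
    then show False using f[of n] by blast
  qed
  then obtain F where F: "finite F" "\<And>I. I \<in> F \<Longrightarrow> irreducible_in T I \<and> closedin T I" "topspace T = \<Union>F"
    unfolding fin_def using closedin_topspace by metis
  have "irreducible_components T \<subseteq> F"
  proof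
    fix C assume C: "C \<in> irreducible_components T"
    then have "irreducible_in T C" by (simp add: irreducible_components_def)
    moreover from this have "C \<subseteq> \<Union>F" unfolding irreducible_in_def F(3)[symmetric] by blast
    ultimately obtain I where I: "I \<in> F" "C \<subseteq> I" using irreducible_in_finite_union F by metis
    then have "I = C" using C F(2) by (auto simp: irreducible_components_def)
    then show "C \<in> F" using I by simp
  qed
  then show ?thesis using F(1) finite_subset by blast
qed

text \<open>Zorn's lemma applies because two members of a chain that violate the two inclusions lie
  in a common member violating both.\<close>

lemma point_in_irreducible_component:
  assumes p: "p \<in> topspace T"
  obtains C where "C \<in> irreducible_components T" "p \<in> C"
proof -
  have "\<exists>C\<in>{I. irreducible_in T I \<and> p \<in> I}. \<forall>X\<in>{I. irreducible_in T I \<and> p \<in> I}. C \<subseteq> X \<longrightarrow> X = C"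
  proof (rule subset_Zorn_nonempty)
    have "irreducible_in T {p}" using p by (auto simp: irreducible_in_def)
    then show "{I. irreducible_in T I \<and> p \<in> I} \<noteq> {}" by blast
    fix \<C> assume C: "\<C> \<noteq> {}" "subset.chain {I. irreducible_in T I \<and> p \<in> I} \<C>"
    have sub: "\<C> \<subseteq> {I. irreducible_in T I \<and> p \<in> I}" and tot: "\<And>I J. I \<in> \<C> \<Longrightarrow> J \<in> \<C> \<Longrightarrow> I \<subseteq> J \<or> J \<subseteq> I"
      using C(2) by (auto simp: subset_chain_def)
    have "irreducible_in T (\<Union>\<C>)"
      unfolding irreducible_in_def
    proof (intro conjI allI impI)
      show "\<Union>\<C> \<subseteq> topspace T" using sub by (auto simp: irreducible_in_def)
      show "\<Union>\<C> \<noteq> {}" using sub C(1) by auto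
      fix A B assume AB: "closedin T A \<and> closedin T B \<and> \<Union>\<C> \<subseteq> A \<union> B"
      show "\<Union>\<C> \<subseteq> A \<or> \<Union>\<C> \<subseteq> B"
      proof (rule ccontr)
        assume "\<not> ?thesis"
        then obtain I J where IJ: "I \<in> \<C>" "\<not> I \<subseteq> A" "J \<in> \<C>" "\<not> J \<subseteq> B" by blast
        then obtain K where K: "K \<in> \<C>" "\<not> K \<subseteq> A" "\<not> K \<subseteq> B" using tot[OF IJ(1,3)] by blast
        then have "irreducible_in T K" "K \<subseteq> A \<union> B" using sub AB by blast+
        then show False using AB K unfolding irreducible_in_def by blast
      qed
    qed
    then show "\<Union>\<C> \<in> {I. irreducible_in T I \<and> p \<in> I}" using sub C(1) by blast
  qed
  then obtain C where C: "irreducible_in T C" "p \<in> C"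
    "\<And>X. irreducible_in T X \<Longrightarrow> p \<in> X \<Longrightarrow> C \<subseteq> X \<Longrightarrow> X = C" by blast
  then have "C \<in> irreducible_components T" unfolding irreducible_components_def by blast
  then show ?thesis using that C by blast
qed

section \<open>The Zariski topology\<close>

text \<open>The generating sets form a basis, since imposing X and Y together amounts to imposing X
  \<union> Y.\<close>

lemma openin_zariski:
  "openin (zariski D) U \<longleftrightarrow>
    U \<subseteq> Ldom D \<and> (\<forall>R\<in>U. \<exists>X. finite X \<and> X \<subseteq> R \<and> {R' \<in> Ldom D. X \<subseteq> R'} \<subseteq> U)"
proof
  assume "openin (zariski D) U"
  then have "generate_topology_on {{R \<in> Ldom D. X \<subseteq> R} | X. finite X} U"
    by (simp add: zariski_def openin_topology_generated_by_iff)
  then show "U \<subseteq> Ldom D \<and> (\<forall>R\<in>U. \<exists>X. finite X \<and> X \<subseteq> R \<and> {R' \<in> Ldom D. X \<subseteq> R'} \<subseteq> U)"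
  proof (induction rule: generate_topology_on.induct)
    case (Int a b)
    have "\<exists>X. finite X \<and> X \<subseteq> R \<and> {R' \<in> Ldom D. X \<subseteq> R'} \<subseteq> a \<inter> b" if R: "R \<in> a \<inter> b" for R
    proof -
      obtain X where X: "finite X" "X \<subseteq> R" "{R' \<in> Ldom D. X \<subseteq> R'} \<subseteq> a" using Int R by blast
      obtain Y where Y: "finite Y" "Y \<subseteq> R" "{R' \<in> Ldom D. Y \<subseteq> R'} \<subseteq> b" using Int R by blast
      show ?thesis using X Y by (intro exI[of _ "X \<union> Y"]) auto
    qed
    then show ?case using Int by blast
  next
    case (UN K)
    have "\<exists>X. finite X \<and> X \<subseteq> R \<and> {R' \<in> Ldom D. X \<subseteq> R'} \<subseteq> \<Union>K" if R: "R \<in> \<Union>K" for R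
    proof -
      obtain k where "k \<in> K" "R \<in> k" using R by blast
      then show ?thesis using UN.IH[of k] by (meson Union_upper subset_trans)
    qed
    moreover have "\<Union>K \<subseteq> Ldom D" using UN.IH by (intro Union_least) simp
    ultimately show ?case by (intro conjI ballI)
  qed auto
next
  assume U: "U \<subseteq> Ldom D \<and> (\<forall>R\<in>U. \<exists>X. finite X \<and> X \<subseteq> R \<and> {R' \<in> Ldom D. X \<subseteq> R'} \<subseteq> U)"
  have "openin (zariski D) {R \<in> Ldom D. X \<subseteq> R}" if "finite X" for X
    unfolding zariski_def by (rule topology_generated_by_Basis) (use that in blast)
  then have "openin (zariski D) (\<Union>{{R \<in> Ldom D. X \<subseteq> R} | X. finite X \<and> {R \<in> Ldom D. X \<subseteq> R} \<subseteq> U})"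
    by (intro openin_Union) blast
  moreover have "\<Union>{{R \<in> Ldom D. X \<subseteq> R} | X. finite X \<and> {R \<in> Ldom D. X \<subseteq> R} \<subseteq> U} = U"
  proof (intro equalityI subsetI)
    fix R assume "R \<in> U"
    then obtain X where "finite X" "X \<subseteq> R" "{R' \<in> Ldom D. X \<subseteq> R'} \<subseteq> U" using U by blast
    moreover have "R \<in> Ldom D" using U \<open>R \<in> U\<close> by blast
    ultimately show "R \<in> \<Union>{{R \<in> Ldom D. X \<subseteq> R} | X. finite X \<and> {R \<in> Ldom D. X \<subseteq> R} \<subseteq> U}" by blast
  qed blast
  ultimately show "openin (zariski D) U" by simp
qed

lemma openin_zariski_basic: "finite X \<Longrightarrow> openin (zariski D) {R \<in> Ldom D. X \<subseteq> R}"
  unfolding openin_zariski by blast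

lemma topspace_zariski: "topspace (zariski D) = Ldom D"
proof
  show "topspace (zariski D) \<subseteq> Ldom D"
    using openin_topspace[of "zariski D"] unfolding openin_zariski by blast
  have "openin (zariski D) (Ldom D)" using openin_zariski_basic[of "{}"] by simp
  then show "Ldom D \<subseteq> topspace (zariski D)" by (rule openin_subset)
qed

text \<open>The obstruction of \<open>noetherian_space_iff\<close> with basic open sets as
  neighbourhoods. Neither D nor the subspace occurs in it, which makes passage to subspaces
  immediate.\<close>

definition bad_sequence :: "(nat \<Rightarrow> 'a set) \<Rightarrow> bool" where
  "bad_sequence \<rho> \<longleftrightarrow> (\<forall>n. \<exists>X. finite X \<and> X \<subseteq> \<rho> n \<and> (\<forall>m>n. \<not> X \<subseteq> \<rho> m))"

lemma zariski_noetherian_iff: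
  assumes S: "S \<subseteq> Ldom D"
  shows "noetherian_space (subtopology (zariski D) S) \<longleftrightarrow> \<not> (\<exists>\<rho>. range \<rho> \<subseteq> S \<and> bad_sequence \<rho>)"
proof -
  have top: "topspace (subtopology (zariski D) S) = S" using S by (auto simp: topspace_zariski)
  have eq: "(\<exists>U. openin (subtopology (zariski D) S) U \<and> \<rho> n \<in> U \<and> (\<forall>m>n. \<rho> m \<notin> U)) \<longleftrightarrow>
    (\<exists>X. finite X \<and> X \<subseteq> \<rho> n \<and> (\<forall>m>n. \<not> X \<subseteq> \<rho> m))" if \<rho>: "range \<rho> \<subseteq> S" for \<rho> :: "nat \<Rightarrow> _" and n
  proof
    assume "\<exists>U. openin (subtopology (zariski D) S) U \<and> \<rho> n \<in> U \<and> (\<forall>m>n. \<rho> m \<notin> U)"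
    then obtain W where W: "openin (zariski D) W" "\<rho> n \<in> W" "\<forall>m>n. \<rho> m \<notin> W \<inter> S"
      unfolding openin_subtopology by blast
    then obtain X where X: "finite X" "X \<subseteq> \<rho> n" "{R' \<in> Ldom D. X \<subseteq> R'} \<subseteq> W"
      unfolding openin_zariski by blast
    have "\<not> X \<subseteq> \<rho> m" if m: "m > n" for m
    proof
      assume "X \<subseteq> \<rho> m"
      moreover have "\<rho> m \<in> S" "\<rho> m \<in> Ldom D" using \<rho> S by auto
      ultimately have "\<rho> m \<in> W \<inter> S" using X(3) by auto
      then show False using W(3) m by blast
    qed
    then show "\<exists>X. finite X \<and> X \<subseteq> \<rho> n \<and> (\<forall>m>n. \<not> X \<subseteq> \<rho> m)" using X by blast
  next
    assume "\<exists>X. finite X \<and> X \<subseteq> \<rho> n \<and> (\<forall>m>n. \<not> X \<subseteq> \<rho> m)"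
    then obtain X where X: "finite X" "X \<subseteq> \<rho> n" "\<forall>m>n. \<not> X \<subseteq> \<rho> m" by blast
    have "openin (subtopology (zariski D) S) ({R \<in> Ldom D. X \<subseteq> R} \<inter> S)"
      using openin_zariski_basic[OF X(1)] by (auto simp: openin_subtopology)
    moreover have "\<rho> n \<in> S" "\<rho> n \<in> Ldom D" using \<rho> S by auto
    ultimately show "\<exists>U. openin (subtopology (zariski D) S) U \<and> \<rho> n \<in> U \<and> (\<forall>m>n. \<rho> m \<notin> U)"
      using X by (intro exI[of _ "{R \<in> Ldom D. X \<subseteq> R} \<inter> S"]) auto
  qed
  have "(\<forall>n. \<rho> n \<in> S \<and> (\<exists>U. openin (subtopology (zariski D) S) U \<and> \<rho> n \<in> U \<and> (\<forall>m>n. \<rho> m \<notin> U))) \<longleftrightarrow>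
    range \<rho> \<subseteq> S \<and> bad_sequence \<rho>" for \<rho> :: "nat \<Rightarrow> _"
  proof (cases "range \<rho> \<subseteq> S")
    case True
    then have "\<rho> n \<in> S" for n by auto
    then show ?thesis unfolding bad_sequence_def by (simp only: eq[OF True] True simp_thms)
  next
    case False
    then show ?thesis by blast
  qed
  then show ?thesis unfolding noetherian_space_iff top by (simp only: )
qed

lemma noetherian_subset:
  assumes "S' \<subseteq> Ldom D" "S \<subseteq> S'" "noetherian_space (subtopology (zariski D) S')"
  shows "noetherian_space (subtopology (zariski D) S)"
  using assms zariski_noetherian_iff[of S D] zariski_noetherian_iff[of S' D] by (meson subset_trans)

lemma bad_subsequence:
  assumes \<rho>: "bad_sequence \<rho>" and g: "strict_mono g"
  shows "bad_sequence (\<rho> \<circ> g)"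
  unfolding bad_sequence_def
proof
  fix n
  obtain X where X: "finite X" "X \<subseteq> \<rho> (g n)" "\<forall>m>g n. \<not> X \<subseteq> \<rho> m"
    using \<rho>[unfolded bad_sequence_def, THEN spec, of "g n"] by (elim exE conjE)
  have "\<not> X \<subseteq> \<rho> (g m)" if "m > n" for m using X(3) strict_monoD[OF g that] by blast
  then show "\<exists>X. finite X \<and> X \<subseteq> (\<rho> \<circ> g) n \<and> (\<forall>m>n. \<not> X \<subseteq> (\<rho> \<circ> g) m)"
    using X(1,2) by (intro exI[of _ X]) simp
qed

section \<open>The equivalences\<close>

lemma Ldom_iff:
  assumes D: "local_ring D"
  shows "R \<in> Ldom D \<longleftrightarrow> quasi_local R \<and> dominates R D"
proof
  assume R: "R \<in> Ldom D"
  then have "local_ring R" by (simp add: Ldom_def)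
  then have "quasi_local R" "max_ideal R = nonunits R" using local_ring_nonunits by auto
  then show "quasi_local R \<and> dominates R D"
    using R local_ring_nonunits(1)[OF D] by (auto simp: Ldom_def dominates_def)
next
  assume R: "quasi_local R \<and> dominates R D"
  then have "local_ring R" using quasi_local.local_ring by blast
  moreover have "nonunits R \<inter> D = nonunits D" using R by (auto simp: dominates_def nonunits_def)
  ultimately show "R \<in> Ldom D"
    using R local_ring_nonunits(1) D by (auto simp: Ldom_def dominates_def)
qed

context
  fixes D :: "'a::field set" and x y :: 'a
  assumes D: "regular_local D 2" and F: "quotient_field_of D" and xy: "regular_pair D x y"
begin

lemma local_D: "local_ring D" using D by (simp add: regular_local_def)

text \<open>A member of \<open>Qreg D\<close> inherits its quotient field from D, and it dominates D
  by \<open>regular_pair_dominates\<close>.\<close>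

lemma Qstar_point:
  assumes "R \<in> Qstar D"
  shows "surface_point R" "R \<in> Ldom D"
proof -
  have "surface_point R \<and> R \<in> Ldom D"
  proof (cases "R \<in> Qreg D")
    case True
    then have R: "regular_local R 2" "D \<subseteq> R" by (auto simp: Qreg_def)
    have "quotient_field_of R"
      unfolding quotient_field_of_def
    proof
      fix z
      obtain a b where "a \<in> D" "b \<in> D" "b \<noteq> 0" "z = a / b"
        using F[unfolded quotient_field_of_def, THEN spec, of z] by (elim bexE conjE)
      then show "\<exists>a\<in>R. \<exists>b\<in>R. b \<noteq> 0 \<and> z = a / b" using R(2) by (intro bexI[of _ a] bexI[of _ b]) auto
    qed
    then obtain u v where uv: "regular_pair R u v" using regular_local_regular_pair R by blast
    have "quasi_local R" using R(1) local_ring_nonunits(2)[of R] unfolding regular_local_def by blast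
    moreover have "dominates R D" using regular_pair_dominates xy uv R by blast
    ultimately show ?thesis using uv Ldom_iff[OF local_D] by (auto simp: surface_point_def)
  next
    case False
    then have "valuation_ring R" "R \<in> Ldom D" using assms by (auto simp: Qstar_def)
    then show ?thesis using valuation_ring_quasi_local by (auto simp: surface_point_def)
  qed
  then show "surface_point R" "R \<in> Ldom D" by auto
qed

text \<open>Infinitely many terms of a bad sequence lie below a single one of the finitely many V,
  and a subsequence of a bad sequence is bad.\<close>

lemma down_star_noetherian:
  assumes Vs: "finite Vs" "Vs \<subseteq> {V \<in> Qstar D. valuation_ring V}" and S: "S \<subseteq> down_star D Vs"
  shows "noetherian_space (subtopology (zariski D) S)"
proof -
  have SQ: "S \<subseteq> Qstar D" using S by (auto simp: down_star_def)
  then have SL: "S \<subseteq> Ldom D" using Qstar_point by blast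
  have False if \<rho>: "range \<rho> \<subseteq> S" "bad_sequence \<rho>" for \<rho> :: "nat \<Rightarrow> _"
  proof -
    have "\<exists>V\<in>Vs. \<rho> n \<subseteq> V" for n using \<rho>(1) S by (auto simp: down_star_def)
    then have "UNIV = (\<Union>V\<in>Vs. {n. \<rho> n \<subseteq> V})" by blast
    then have "\<exists>V\<in>Vs. infinite {n. \<rho> n \<subseteq> V}" using Vs(1) infinite_UNIV_nat by (metis finite_UN)
    then obtain V where V: "V \<in> Vs" "infinite {n. \<rho> n \<subseteq> V}" by blast
    obtain g :: "nat \<Rightarrow> nat" where g: "strict_mono g" "\<And>n. g n \<in> {n. \<rho> n \<subseteq> V}"
      using infinite_enumerate[OF V(2)] by blast
    have VQ: "V \<in> Qstar D" "valuation_ring V" using V Vs by auto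
    have "dominates V D" using Qstar_point(2)[OF VQ(1)] Ldom_iff[OF local_D] by blast
    moreover have "(\<rho> \<circ> g) n \<in> Qstar D" for n using \<rho>(1) SQ by auto
    then have "surface_point ((\<rho> \<circ> g) n)" "dominates ((\<rho> \<circ> g) n) D" for n
      using Qstar_point Ldom_iff[OF local_D] by blast+
    moreover have "(\<rho> \<circ> g) n \<subseteq> V" for n using g(2)[of n] by simp
    moreover have "\<exists>X. finite X \<and> X \<subseteq> (\<rho> \<circ> g) n \<and> (\<forall>m>n. \<not> X \<subseteq> (\<rho> \<circ> g) m)" for n
      using bad_subsequence[OF \<rho>(2) g(1)] unfolding bad_sequence_def by blast
    ultimately show False using no_bad_sequence[OF VQ(2) xy] by blast
  qed
  then show ?thesis using zariski_noetherian_iff[OF SL] by blast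
qed

lemma irreducible_below_valuation:
  assumes S: "S \<subseteq> Ldom D" and C: "irreducible_in (subtopology (zariski D) S) C"
  shows "\<exists>V\<in>Qstar D. valuation_ring V \<and> (\<forall>R\<in>C. R \<subseteq> V)"
proof -
  interpret D: regular_pair D x y by (rule xy)
  have CS: "C \<subseteq> S" "C \<noteq> {}" using C by (auto simp: irreducible_in_def)
  have ql: "quasi_local R" "dominates R D" if "R \<in> C" for R
    using that CS S Ldom_iff[OF local_D] by blast+
  have closed: "closedin (subtopology (zariski D) S) {R \<in> S. a \<notin> R}" for a
  proof -
    have "openin (subtopology (zariski D) S) ({R \<in> Ldom D. {a} \<subseteq> R} \<inter> S)"
      using openin_zariski_basic[of "{a}"] by (auto simp: openin_subtopology)
    moreover have "S - {R \<in> S. a \<notin> R} = {R \<in> Ldom D. {a} \<subseteq> R} \<inter> S" using S by auto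
    moreover have "topspace (subtopology (zariski D) S) = S" using S by (auto simp: topspace_zariski)
    ultimately show ?thesis unfolding closedin_def by auto
  qed
  \<comment> \<open>The rings omitting a given element form a closed set, and irreducibility forbids
    covering C by two of these. So sums and products, as well as a relation 1 = x u + y v, can be
    tested inside one member of C.\<close>
  have two: "\<exists>R\<in>C. a \<in> R \<and> b \<in> R" if ab: "a \<in> \<Union>C" "b \<in> \<Union>C" for a b
  proof (rule ccontr)
    assume "\<not> ?thesis"
    then have "C \<subseteq> {R \<in> S. a \<notin> R} \<union> {R \<in> S. b \<notin> R}" using CS(1) by auto
    then have "C \<subseteq> {R \<in> S. a \<notin> R} \<or> C \<subseteq> {R \<in> S. b \<notin> R}"
      using C closed[of a] closed[of b] unfolding irreducible_in_def by simp
    then show False using ab by auto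
  qed
  have sr: "subring R" if "R \<in> C" for R using ql[OF that] quasi_local.subring by blast
  have sub: "subring (\<Union>C)"
    unfolding subring_def
  proof (intro conjI ballI)
    show "0 \<in> \<Union>C" "1 \<in> \<Union>C" using CS(2) sr subringD(1,2) by blast+
    fix u assume u: "u \<in> \<Union>C"
    then show "- u \<in> \<Union>C" using sr subringD(5) by blast
    fix v assume v: "v \<in> \<Union>C"
    obtain R where R: "R \<in> C" "u \<in> R" "v \<in> R" using two[OF u v] by blast
    then show "u + v \<in> \<Union>C" "u * v \<in> \<Union>C" using subringD(3,4)[OF sr[OF R(1)]] by blast+
  qed
  have DC: "D \<subseteq> \<Union>C" using CS(2) ql(2) by (auto simp: dominates_def)
  have "1 \<notin> span2 (\<Union>C) x y"
  proof
    assume "1 \<in> span2 (\<Union>C) x y"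
    then obtain u v where uv: "u \<in> \<Union>C" "v \<in> \<Union>C" "1 = x * u + y * v" by (rule span2E)
    obtain R where R: "R \<in> C" "u \<in> R" "v \<in> R" using two[OF uv(1,2)] by blast
    interpret R: quasi_local R by (rule ql[OF R(1)])
    have "x \<in> R.M" "y \<in> R.M" using dominatesD(3)[OF ql(2)[OF R(1)]] D.xM D.yM by auto
    then have "x * u + y * v \<in> R.M" using R by (intro R.nonunits_add R.nonunits_mult(1))
    then show False using uv(3) R.one_unit by simp
  qed
  then obtain V where V: "valuation_ring V" "\<Union>C \<subseteq> V" "x \<in> nonunits V" "y \<in> nonunits V"
    using valuation_ring_extension[OF sub] DC D.xR D.yR by blast
  interpret V: quasi_local V by (rule valuation_ring_quasi_local[OF V(1)])
  have DV: "D \<subseteq> V" using DC V by blast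
  have "D.M \<subseteq> V.M"
  proof
    fix a assume "a \<in> D.M"
    then obtain u v where "u \<in> D" "v \<in> D" "a = x * u + y * v" unfolding D.M_span by (rule span2E)
    then show "a \<in> V.M" using V(3,4) DV by (auto intro!: V.nonunits_add V.nonunits_mult(1))
  qed
  then have "V \<in> Ldom D"
    using Ldom_iff[OF local_D] V.quasi_local_axioms DV by (simp add: dominates_def)
  then have "V \<in> Qstar D" using V(1) by (simp add: Qstar_def)
  then show ?thesis using V by blast
qed

lemma finite_components_below_valuations:
  assumes S: "S \<subseteq> Qstar D" and fin: "finite (irreducible_components (subtopology (zariski D) S))"
  shows "\<exists>Vs. finite Vs \<and> Vs \<subseteq> {V \<in> Qstar D. valuation_ring V} \<and> S \<subseteq> down_star D Vs"
proof -
  have SL: "S \<subseteq> Ldom D" using S Qstar_point by blast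
  define K where "K = irreducible_components (subtopology (zariski D) S)"
  have "\<forall>C\<in>K. \<exists>V. V \<in> Qstar D \<and> valuation_ring V \<and> (\<forall>R\<in>C. R \<subseteq> V)"
  proof
    fix C assume "C \<in> K"
    then have "irreducible_in (subtopology (zariski D) S) C" by (simp add: K_def irreducible_components_def)
    from irreducible_below_valuation[OF SL this]
    show "\<exists>V. V \<in> Qstar D \<and> valuation_ring V \<and> (\<forall>R\<in>C. R \<subseteq> V)" by (elim bexE conjE, intro exI conjI)
  qed
  then obtain v where v: "\<And>C. C \<in> K \<Longrightarrow> v C \<in> Qstar D \<and> valuation_ring (v C) \<and> (\<forall>R\<in>C. R \<subseteq> v C)"
    by metis
  have "S \<subseteq> down_star D (v ` K)"
  proof
    fix R assume R: "R \<in> S"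
    then have "R \<in> topspace (subtopology (zariski D) S)" using SL by (auto simp: topspace_zariski)
    then obtain C where "C \<in> K" "R \<in> C" unfolding K_def by (rule point_in_irreducible_component)
    then show "R \<in> down_star D (v ` K)" using v R S by (auto simp: down_star_def)
  qed
  moreover have "finite (v ` K)" "v ` K \<subseteq> {V \<in> Qstar D. valuation_ring V}" using fin v by (auto simp: K_def)
  ultimately show ?thesis by blast
qed

text \<open>A ring below no V contains, for each V, an element outside V. Containing these finitely
  many elements is an open condition that no ring below some V satisfies.\<close>

lemma closure_below_valuations:
  assumes Vs: "finite Vs" and S: "S \<subseteq> down_star D Vs" and Q: "Q \<subseteq> Qstar D"
  shows "(subtopology (zariski D) Q) closure_of S \<subseteq> down_star D Vs"
proof
  fix R assume R: "R \<in> (subtopology (zariski D) Q) closure_of S"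
  then have RQ: "R \<in> Q" using closure_of_subset_topspace[of "subtopology (zariski D) Q" S] by auto
  then have RL: "R \<in> Ldom D" using Q Qstar_point by blast
  show "R \<in> down_star D Vs"
  proof (rule ccontr)
    assume "R \<notin> down_star D Vs"
    then have "\<forall>V\<in>Vs. \<exists>a. a \<in> R \<and> a \<notin> V" using RQ Q by (auto simp: down_star_def)
    then obtain a where a: "\<And>V. V \<in> Vs \<Longrightarrow> a V \<in> R \<and> a V \<notin> V" by metis
    define U where "U = {R \<in> Ldom D. a ` Vs \<subseteq> R} \<inter> Q"
    have "openin (subtopology (zariski D) Q) U" unfolding U_def
      using openin_zariski_basic[of "a ` Vs"] Vs by (auto simp: openin_subtopology)
    moreover have "R \<in> U" using a RL RQ by (auto simp: U_def)
    moreover have "\<forall>T. R \<in> T \<and> openin (subtopology (zariski D) Q) T \<longrightarrow> (\<exists>y. y \<in> S \<and> y \<in> T)"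
      using R by (simp add: in_closure_of)
    ultimately obtain R' where R': "R' \<in> S" "R' \<in> U" by blast
    then obtain V where V: "V \<in> Vs" "R' \<subseteq> V" using S by (auto simp: down_star_def)
    have "a V \<in> R'" using R'(2) V(1) by (auto simp: U_def)
    then show False using a[OF V(1)] V(2) by auto
  qed
qed

text \<open>Stated for an ambient set Q so that the closures in Q*(D) and in Q(D) are both
  instances.\<close>

lemma noetherian_closure_iff:
  assumes Q: "Q \<subseteq> Qstar D" and SQ: "S \<subseteq> Q"
    and below: "noetherian_space (subtopology (zariski D) S) \<Longrightarrow>
      \<exists>Vs. finite Vs \<and> Vs \<subseteq> {V \<in> Qstar D. valuation_ring V} \<and> S \<subseteq> down_star D Vs"
  shows "noetherian_space (subtopology (zariski D) S) \<longleftrightarrow>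
    noetherian_space (subtopology (zariski D) ((subtopology (zariski D) Q) closure_of S))"
proof
  assume "noetherian_space (subtopology (zariski D) S)"
  from below[OF this] obtain Vs where Vs: "finite Vs" "Vs \<subseteq> {V \<in> Qstar D. valuation_ring V}"
    "S \<subseteq> down_star D Vs" by (elim exE conjE)
  show "noetherian_space (subtopology (zariski D) ((subtopology (zariski D) Q) closure_of S))"
    by (rule down_star_noetherian[OF Vs(1,2) closure_below_valuations[OF Vs(1,3) Q]])
next
  assume n: "noetherian_space (subtopology (zariski D) ((subtopology (zariski D) Q) closure_of S))"
  have QL: "Q \<subseteq> Ldom D" using Q Qstar_point by blast
  have top: "topspace (subtopology (zariski D) Q) = Q" using QL by (auto simp: topspace_zariski)
  have "S \<subseteq> (subtopology (zariski D) Q) closure_of S" using SQ top by (simp add: closure_of_subset)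
  moreover have "(subtopology (zariski D) Q) closure_of S \<subseteq> Ldom D"
    using closure_of_subset_topspace[of "subtopology (zariski D) Q" S] top QL by blast
  ultimately show "noetherian_space (subtopology (zariski D) S)" using n noetherian_subset[of "(subtopology (zariski D) Q) closure_of S" D S] by simp
qed

end

theorem theorem5p6:
  fixes D :: "'a::field set" and S :: "'a set set"
  assumes "regular_local D 2" and "quotient_field_of D"
    and "S \<subseteq> Qstar D" and "S \<noteq> {}"
  shows "(noetherian_space (subtopology (zariski D) S)
            \<longleftrightarrow> finite (irreducible_components (subtopology (zariski D) S)))
       \<and> (noetherian_space (subtopology (zariski D) S)
            \<longleftrightarrow> (\<exists>Vs. finite Vs \<and> Vs \<subseteq> {V \<in> Qstar D. valuation_ring V} \<and> S \<subseteq> down_star D Vs))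
       \<and> (noetherian_space (subtopology (zariski D) S)
            \<longleftrightarrow> noetherian_space (subtopology (zariski D)
                   ((subtopology (zariski D) (Qstar D)) closure_of S)))
       \<and> (S \<subseteq> Qreg D \<longrightarrow>
           (noetherian_space (subtopology (zariski D) S)
            \<longleftrightarrow> noetherian_space (subtopology (zariski D)
                   ((subtopology (zariski D) (Qreg D)) closure_of S))))"
proof -
  obtain x y where xy: "regular_pair D x y" using regular_local_regular_pair assms(1,2) by blast
  note ctx = assms(1,2) xy
  have 12: "noetherian_space (subtopology (zariski D) S) \<Longrightarrow>
      finite (irreducible_components (subtopology (zariski D) S))"
    by (rule noetherian_space_finite_components)
  have 23: "finite (irreducible_components (subtopology (zariski D) S)) \<Longrightarrow>
      \<exists>Vs. finite Vs \<and> Vs \<subseteq> {V \<in> Qstar D. valuation_ring V} \<and> S \<subseteq> down_star D Vs"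
    by (rule finite_components_below_valuations[OF ctx assms(3)])
  have 31: "noetherian_space (subtopology (zariski D) S)"
    if "\<exists>Vs. finite Vs \<and> Vs \<subseteq> {V \<in> Qstar D. valuation_ring V} \<and> S \<subseteq> down_star D Vs"
    using that by (elim exE conjE) (rule down_star_noetherian[OF ctx])
  have "Qreg D \<subseteq> Qstar D" by (auto simp: Qstar_def)
  note closures = noetherian_closure_iff[OF ctx order_refl assms(3) 23[OF 12]]
    noetherian_closure_iff[OF ctx this _ 23[OF 12]]
  show ?thesis
    by (intro conjI impI iffI[OF 12 31[OF 23]] iffI[OF 23[OF 12] 31] closures)
qed

end
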